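(* There exists an absolute constant $c>0$ such that the following holds. Let $n$ be a positive integer and $M$ a positive integer with $M<\log n$. If $A\subseteq A_n$ satisfies $A=A^{-1}$ and $\mu(A)\ge e^{-cn^{1-1/M}}$, then there is a set $I\subseteq [n]$ such that $U_I\subseteq A^{8M}$ and $\mu(U_I)\ge \mu(A)^{5M}$.
   Context: $A_n$ is the alternating group on $[n]=\{1,\dots,n\}$ and $\mu(A)=|A|/|A_n|$. $\log$ is the natural logarithm. $A^{-1}=\{a^{-1}:a\in A\}$ and $A^m=\{a_1\cdots a_m:a_i\in A\}$. For $I\subseteq[n]$, $U_I=\{\sigma\in A_n:\sigma(x)=x\text{ for all }x\in I\}$. *)

theory Defs
  imports Complex_Main "HOL-Algebra.Sym_Groups"
begin

definition alt_density :: "nat \<Rightarrow> (nat \<Rightarrow> nat) set \<Rightarrow> real" where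
  "alt_density n A = real (card A) / real (order (alt_group n))"

definition set_pow :: "('a, 'b) monoid_scheme \<Rightarrow> 'a set \<Rightarrow> nat \<Rightarrow> 'a set" where
  "set_pow G A m =
     {foldr (\<otimes>\<^bsub>G\<^esub>) xs \<one>\<^bsub>G\<^esub> | xs. length xs = m \<and> set xs \<subseteq> A}"

definition pointwise_stab :: "nat \<Rightarrow> nat set \<Rightarrow> (nat \<Rightarrow> nat) set" where
  "pointwise_stab n I = {\<sigma> \<in> carrier (alt_group n). \<forall>x\<in>I. \<sigma> x = x}"

end

theory Submission
  imports Defs "HOL-Analysis.Function_Topology" "HOL-Analysis.Convex"
begin

text \<open>
  If $\mu(A) > 1/2$ then $A \cdot A$ is everything, so let $s = 2 c n^{1-1/M} \ge 1$ and
  $r = n^{1/(5M)}$. Among all sets \<open>{a \<in> A. \<forall>x\<in>I. a x = a0 x}\<close> choose one whose density relative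
  to the coset of $U_I$, divided by $r^{|I|}$, is maximal, and translate it to a subset $B$ of $U_I$.
  Then $r^{|I|} \le 1/\mu(A)$, which gives $\mu(U_I) \ge n^{-|I|} = r^{-5M|I|} \ge \mu(A)^{5M}$, and by
  maximality fixing $d$ further values raises the density of $B$ by a factor of at most $r^d$.

  Let $F$ be left averaging over $B$ and $f$ the normalised indicator function of $B$. The function
  $F (F^* F)^{2M-1} f$ is supported in $(B^{-1} B)^{2M} \subseteq A^{4M}$. It has mean 1, so once its
  mean square is below 2, its support $D$ fills more than half of $U_I$, and $U_I = D \cdot D$.

  The mean square is computed by splitting $f$ into parts $f_d$ of pure degree $d$ for $d \le 4m$,
  where $m = \lceil 4s \rceil$, and a part of high degree. On high degree the top eigenspace of $F^* F$ is
  invariant under right multiplication and so has dimension at least $2^m$, whence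
  $\|F\|^2 \le e^s / 2^m$ by comparison of traces. On degree $d$ the squared norm of $F$ is at most the
  average over $d$-sets of the squared $L^2$ norm of the centred law of $B$ there. This average is
  estimated by $(C r \sqrt{s/N})^d$ with $N = n - |I|$: sum it against $\rho^d$ over the subsets of a set
  of $N/4$ points, pass to moments of order about $s/d$ under the uniform measure, which costs a
  factor $e^d$, and expand; simultaneous agreements of several elements of $B$ are controlled by
  the maximality property.
\<close>

section \<open>Inner products and eigenvectors on finite function spaces\<close>

text \<open>Since s r^5 = 2 c n, the quantity r^2 s / N is a small multiple of r^(-3), and the
  degree-d part of f contributes at most N^d (r^(-3) / 8)^(2 M d) to the mean square. The exponent 2
  M makes r^(6 M) outweigh n = r^(5 M): this balance fixes both r and the length of the words. The
  hypothesis M < log n says r^5 = n^(1/M) > e, which turns r^|I| \<le> e^(s/2) into |I| \<le> 5 s /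
  2, so that N stays close to n.

  The degree decomposition is built without characters. The averages over the subgroups fixing d
  points are projections whose ranges are not orthogonal to each other; a frame inequality replaces
  orthogonality at the price of a sum over all d-sets, which is the source of the factor N^d.

  The obstacle in the moment estimate is that d prescribed values of a uniform permutation have
  probability (N - d)! / N! instead of N^(-d). An error of first order in the noise rate would be
  too large; the first-order terms have to cancel against the normalisation, so that only
  second-order terms and genuine coincidences remain.\<close>

definition ip :: "'a set \<Rightarrow> ('a \<Rightarrow> real) \<Rightarrow> ('a \<Rightarrow> real) \<Rightarrow> real" where
  "ip G u v = (\<Sum>x\<in>G. u x * v x)"

text \<open>Vectors are functions on the whole type that vanish outside G, so that equality of
  vectors is plain equality of functions.\<close>

definition lin_sub :: "'a set \<Rightarrow> ('a \<Rightarrow> real) set \<Rightarrow> bool" where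
  "lin_sub G W \<longleftrightarrow> (\<forall>u\<in>W. \<forall>x. x \<notin> G \<longrightarrow> u x = 0) \<and> (\<lambda>_. 0) \<in> W \<and>
     (\<forall>u\<in>W. \<forall>v\<in>W. \<forall>a b. (\<lambda>x. a * u x + b * v x) \<in> W)"

definition lin_op :: "(('a \<Rightarrow> real) \<Rightarrow> ('a \<Rightarrow> real)) \<Rightarrow> bool" where
  "lin_op T \<longleftrightarrow> (\<forall>u v a b. T (\<lambda>x. a * u x + b * v x) = (\<lambda>x. a * T u x + b * T v x))"

definition onset :: "'a set \<Rightarrow> ('a \<Rightarrow> real) set \<Rightarrow> bool" where
  "onset G E \<longleftrightarrow> finite E \<and> (\<forall>e\<in>E. \<forall>e'\<in>E. ip G e e' = of_bool (e = e'))"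

definition onb :: "'a set \<Rightarrow> ('a \<Rightarrow> real) set \<Rightarrow> ('a \<Rightarrow> real) set \<Rightarrow> bool" where
  "onb G W E \<longleftrightarrow> E \<subseteq> W \<and> onset G E \<and> (\<forall>w\<in>W. (\<lambda>x. \<Sum>e\<in>E. ip G w e * e x) = w)"

lemma ip_commute: "ip G u v = ip G v u"
  by (simp add: ip_def mult.commute)

lemma ip_add_left: "ip G (\<lambda>x. a * u x + b * v x) w = a * ip G u w + b * ip G v w"
  by (simp add: ip_def sum.distrib sum_distrib_left algebra_simps)

lemma ip_diff_left: "ip G (\<lambda>x. u x - v x) w = ip G u w - ip G v w"
  by (simp add: ip_def sum_subtractf algebra_simps)

lemma ip_scale_left: "ip G (\<lambda>x. a * u x) w = a * ip G u w"
  by (simp add: ip_def sum_distrib_left algebra_simps)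

lemma ip_scale_right: "ip G w (\<lambda>x. a * u x) = a * ip G w u"
  by (simp add: ip_def sum_distrib_left algebra_simps)

lemma ip_add_right: "ip G w (\<lambda>x. a * u x + b * v x) = a * ip G w u + b * ip G w v"
  by (simp add: ip_def sum.distrib sum_distrib_left algebra_simps)

lemma ip_diff_right: "ip G w (\<lambda>x. u x - v x) = ip G w u - ip G w v"
  by (simp add: ip_def sum_subtractf algebra_simps)

lemma ip_sum_left: "ip G (\<lambda>x. \<Sum>i\<in>S. c i * f i x) w = (\<Sum>i\<in>S. c i * ip G (f i) w)"
  unfolding ip_def sum_distrib_left sum_distrib_right
  by (subst sum.swap) (simp add: algebra_simps)

lemma ip_sum_right: "ip G w (\<lambda>x. \<Sum>i\<in>S. c i * f i x) = (\<Sum>i\<in>S. c i * ip G w (f i))"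
  using ip_sum_left[of G c f S w] by (simp add: ip_commute)

lemma ip_nonneg: "0 \<le> ip G u u"
  by (simp add: ip_def sum_nonneg)

lemma ip_zero_left [simp]: "ip G (\<lambda>_. 0) u = 0"
  by (simp add: ip_def)

lemma ip_zero_right [simp]: "ip G u (\<lambda>_. 0) = 0"
  by (simp add: ip_def)

lemma ip_self_eq_0D:
  assumes "finite G" "\<forall>x. x \<notin> G \<longrightarrow> u x = 0" "ip G u u = 0"
  shows "u = (\<lambda>_. 0)"
proof
  fix x
  show "u x = 0"
    using assms by (cases "x \<in> G") (auto simp: ip_def sum_nonneg_eq_0_iff)
qed

lemma ip_pos:
  assumes "finite G" "\<forall>x. x \<notin> G \<longrightarrow> u x = 0" "u \<noteq> (\<lambda>_. 0)"
  shows "ip G u u > 0"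
  using ip_self_eq_0D[OF assms(1,2)] assms(3) ip_nonneg[of G u] by (metis less_eq_real_def)

lemma ip_Cauchy_Schwarz: "(ip G u v)\<^sup>2 \<le> ip G u u * ip G v v"
  using Cauchy_Schwarz_ineq_sum[of u v G] by (simp add: ip_def power2_eq_square)

lemma lin_sub_zero: "lin_sub G W \<Longrightarrow> (\<lambda>_. 0) \<in> W"
  and lin_sub_comb: "lin_sub G W \<Longrightarrow> u \<in> W \<Longrightarrow> v \<in> W \<Longrightarrow> (\<lambda>x. a * u x + b * v x) \<in> W"
  and lin_sub_off: "lin_sub G W \<Longrightarrow> u \<in> W \<Longrightarrow> x \<notin> G \<Longrightarrow> u x = 0"
  by (auto simp: lin_sub_def)

lemma lin_sub_scale: "lin_sub G W \<Longrightarrow> u \<in> W \<Longrightarrow> (\<lambda>x. a * u x) \<in> W"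
  using lin_sub_comb[of G W u u a 0] by simp

lemma lin_sub_diff: "lin_sub G W \<Longrightarrow> u \<in> W \<Longrightarrow> v \<in> W \<Longrightarrow> (\<lambda>x. u x - v x) \<in> W"
  using lin_sub_comb[of G W u v 1 "-1"] by simp

lemma lin_sub_sum:
  assumes W: "lin_sub G W" and "finite S" and "\<And>i. i \<in> S \<Longrightarrow> f i \<in> W"
  shows "(\<lambda>x. \<Sum>i\<in>S. c i * f i x) \<in> W"
  using assms(2,3)
proof (induction S rule: finite_induct)
  case empty
  then show ?case using W by (simp add: lin_sub_zero)
next
  case (insert j S)
  then show ?case using lin_sub_comb[OF W, of "f j" "\<lambda>x. \<Sum>i\<in>S. c i * f i x" "c j" 1] by simp
qed

lemma lin_op_comb: "lin_op T \<Longrightarrow> T (\<lambda>x. a * u x + b * v x) = (\<lambda>x. a * T u x + b * T v x)"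
  by (simp add: lin_op_def)

lemma lin_op_scale: "lin_op T \<Longrightarrow> T (\<lambda>x. a * u x) = (\<lambda>x. a * T u x)"
  using lin_op_comb[of T a u 0 u] by simp

lemma lin_op_diff: "lin_op T \<Longrightarrow> T (\<lambda>x. u x - v x) = (\<lambda>x. T u x - T v x)"
  using lin_op_comb[of T 1 u "-1" v] by simp

lemma lin_op_zero: "lin_op T \<Longrightarrow> T (\<lambda>_. 0) = (\<lambda>_. 0)"
  using lin_op_scale[of T 0] by simp

lemma lin_op_sum:
  assumes "lin_op T" "finite S"
  shows "T (\<lambda>x. \<Sum>i\<in>S. c i * f i x) = (\<lambda>x. \<Sum>i\<in>S. c i * T (f i) x)"
  using assms(2)
proof (induction S rule: finite_induct)
  case empty
  then show ?case using assms(1) by (simp add: lin_op_zero)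
next
  case (insert j S)
  then show ?case
    using lin_op_comb[OF assms(1), of "c j" "f j" 1 "\<lambda>x. \<Sum>i\<in>S. c i * f i x"] by simp
qed

section \<open>Orthonormal sets, Bessel, Parseval and orthogonal projection\<close>

lemma onset_ip_sum:
  assumes "onset G E" "e \<in> E"
  shows "ip G (\<lambda>x. \<Sum>e\<in>E. c e * e x) e = c e"
proof -
  have "ip G (\<lambda>x. \<Sum>e\<in>E. c e * e x) e = (\<Sum>e'\<in>E. c e' * ip G e' e)"
    by (rule ip_sum_left)
  also have "\<dots> = (\<Sum>e'\<in>E. if e' = e then c e' else 0)"
    using assms by (intro sum.cong) (auto simp: onset_def)
  finally show ?thesis using assms by (simp add: onset_def)
qed

lemma onset_ip_sums:
  assumes "onset G E"
  shows "ip G (\<lambda>x. \<Sum>e\<in>E. c e * e x) (\<lambda>x. \<Sum>e\<in>E. d e * e x) = (\<Sum>e\<in>E. c e * d e)"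
proof -
  have "ip G (\<lambda>x. \<Sum>e\<in>E. c e * e x) (\<lambda>x. \<Sum>e\<in>E. d e * e x)
      = (\<Sum>e'\<in>E. d e' * ip G (\<lambda>x. \<Sum>e\<in>E. c e * e x) e')"
    by (rule ip_sum_right)
  also have "\<dots> = (\<Sum>e\<in>E. c e * d e)"
    by (intro sum.cong) (auto simp: onset_ip_sum[OF assms])
  finally show ?thesis .
qed

lemma Bessel:
  assumes "onset G E"
  shows "(\<Sum>e\<in>E. (ip G v e)\<^sup>2) \<le> ip G v v"
proof -
  let ?p = "\<lambda>x. \<Sum>e\<in>E. ip G v e * e x"
  have pv: "ip G ?p v = (\<Sum>e\<in>E. (ip G v e)\<^sup>2)"
    unfolding ip_sum_left by (simp add: power2_eq_square ip_commute)
  have pp: "ip G ?p ?p = (\<Sum>e\<in>E. (ip G v e)\<^sup>2)"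
    unfolding onset_ip_sums[OF assms] by (simp add: power2_eq_square)
  have "0 \<le> ip G (\<lambda>x. v x - ?p x) (\<lambda>x. v x - ?p x)" by (rule ip_nonneg)
  also have "\<dots> = ip G v v - ip G ?p v - (ip G v ?p - ip G ?p ?p)"
    by (simp only: ip_diff_left ip_diff_right)
  also have "\<dots> = ip G v v - (\<Sum>e\<in>E. (ip G v e)\<^sup>2)"
    using pv pp by (simp add: ip_commute)
  finally show ?thesis by simp
qed

text \<open>The cardinality is a sum of squared norms; after exchanging the sums, Bessel applied to
  a point mass bounds the contribution of each point of G by 1. This bound makes a maximal
  orthonormal set exist.\<close>

lemma onset_card_le:
  assumes "finite G" "onset G E"
  shows "card E \<le> card G"
proof -
  have "real (card E) = (\<Sum>e\<in>E. ip G e e)"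
    using assms(2) by (simp add: onset_def)
  also have "\<dots> = (\<Sum>x\<in>G. \<Sum>e\<in>E. (e x)\<^sup>2)"
    unfolding ip_def by (subst sum.swap) (simp add: power2_eq_square)
  also have "\<dots> \<le> (\<Sum>x\<in>G. 1)"
  proof (rule sum_mono)
    fix x assume x: "x \<in> G"
    have "ip G (\<lambda>y. of_bool (y = x)) u = u x" for u
      using x assms(1) by (simp add: ip_def)
    then show "(\<Sum>e\<in>E. (e x)\<^sup>2) \<le> 1"
      using Bessel[OF assms(2), of "\<lambda>y. of_bool (y = x)"] by simp
  qed
  finally show ?thesis by simp
qed

lemma onset_extend:
  assumes G: "finite G" and W: "lin_sub G W" and E: "onset G E" "E \<subseteq> W"
    and r: "r \<in> W" "r \<noteq> (\<lambda>_. 0)" "\<forall>e\<in>E. ip G r e = 0"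
  shows "\<exists>e\<in>W. e \<notin> E \<and> onset G (insert e E)"
proof -
  have pos: "ip G r r > 0"
    using lin_sub_off[OF W r(1)] r(2) by (intro ip_pos[OF G]) auto
  define e where "e = (\<lambda>x. (1 / sqrt (ip G r r)) * r x)"
  have "ip G e e = (1 / sqrt (ip G r r)) * ((1 / sqrt (ip G r r)) * ip G r r)"
    unfolding e_def by (simp only: ip_scale_left ip_commute[of G r "\<lambda>x. (1 / sqrt (ip G r r)) * r x"])
  then have ee: "ip G e e = 1" using pos by (simp add: field_simps)
  have e0: "ip G e e' = 0" if "e' \<in> E" for e'
    unfolding e_def ip_scale_left using r(3) that by simp
  have e0': "ip G e' e = 0" if "e' \<in> E" for e'
    using e0[OF that] by (subst ip_commute)
  have "e \<notin> E" using e0[of e] ee by auto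
  moreover have "onset G (insert e E)"
    using E(1) ee e0 e0' \<open>e \<notin> E\<close> by (auto simp: onset_def)
  moreover have "e \<in> W" unfolding e_def by (rule lin_sub_scale[OF W r(1)])
  ultimately show ?thesis by blast
qed

lemma onb_exists:
  assumes G: "finite G" and W: "lin_sub G W"
  shows "\<exists>E. onb G W E"
proof -
  define P where "P E \<longleftrightarrow> onset G E \<and> E \<subseteq> W" for E
  have "P {}" by (simp add: P_def onset_def)
  moreover have "\<forall>E. P E \<longrightarrow> card E < Suc (card G)"
    using onset_card_le[OF G] by (auto simp: P_def less_Suc_eq_le)
  ultimately obtain E where E: "P E" and max: "\<forall>E'. P E' \<longrightarrow> card E' \<le> card E"
    using ex_has_greatest_nat[of P "{}" card] by blast
  have exp: "(\<lambda>x. \<Sum>e\<in>E. ip G w e * e x) = w" if w: "w \<in> W" for w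
  proof (rule ccontr)
    assume neq: "\<not> ?thesis"
    \<comment> \<open>The residual of w is orthogonal to all of E; if it were nonzero, its
      normalisation would enlarge a maximal orthonormal set.\<close>
    define r where "r = (\<lambda>x. w x - (\<Sum>e\<in>E. ip G w e * e x))"
    have "r \<in> W" unfolding r_def
      by (rule lin_sub_diff[OF W w lin_sub_sum[OF W]]) (use E in \<open>auto simp: P_def onset_def\<close>)
    moreover have "r \<noteq> (\<lambda>_. 0)"
    proof
      assume "r = (\<lambda>_. 0)"
      then have "(\<Sum>e\<in>E. ip G w e * e x) = w x" for x by (auto simp: r_def fun_eq_iff)
      then have "(\<lambda>x. \<Sum>e\<in>E. ip G w e * e x) = w" by (rule ext)
      with neq show False by contradiction
    qed
    moreover have "\<forall>e\<in>E. ip G r e = 0"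
      using E unfolding r_def ip_diff_left by (auto simp: P_def onset_ip_sum)
    ultimately obtain e where e: "e \<in> W" "e \<notin> E" "onset G (insert e E)"
      using onset_extend[OF G W, of E r] E unfolding P_def by metis
    have "finite E" using E by (simp add: P_def onset_def)
    have "P (insert e E)" using E e by (simp add: P_def)
    then have "card (insert e E) \<le> card E" using max by blast
    with e(2) \<open>finite E\<close> show False by simp
  qed
  with E have "onb G W E" by (simp add: onb_def P_def)
  then show ?thesis by blast
qed

lemma onb_Parseval:
  assumes "onb G W E" "w \<in> W"
  shows "ip G w w = (\<Sum>e\<in>E. (ip G w e)\<^sup>2)"
proof -
  have w: "(\<lambda>x. \<Sum>e\<in>E. ip G w e * e x) = w" using assms by (simp add: onb_def)
  have "ip G w w = ip G (\<lambda>x. \<Sum>e\<in>E. ip G w e * e x) (\<lambda>x. \<Sum>e\<in>E. ip G w e * e x)"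
    using w by simp
  also have "\<dots> = (\<Sum>e\<in>E. ip G w e * ip G w e)"
    using assms by (intro onset_ip_sums) (simp add: onb_def)
  finally show ?thesis by (simp add: power2_eq_square)
qed

text \<open>Sum the squares of all inner products between the two sets: Parseval evaluates the sum
  as \<open>card E'\<close>, Bessel bounds it by \<open>card E\<close>. This plays the part of
  invariance of dimension.\<close>

lemma onset_card_le_onb:
  assumes "onb G W E" "onset G E'" "E' \<subseteq> W"
  shows "card E' \<le> card E"
proof -
  have "real (card E') = (\<Sum>e'\<in>E'. ip G e' e')"
    using assms(2) by (simp add: onset_def)
  also have "\<dots> = (\<Sum>e'\<in>E'. \<Sum>e\<in>E. (ip G e' e)\<^sup>2)"
    using assms by (intro sum.cong) (auto intro!: onb_Parseval)
  also have "\<dots> = (\<Sum>e\<in>E. \<Sum>e'\<in>E'. (ip G e e')\<^sup>2)"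
    by (subst sum.swap) (simp add: ip_commute)
  also have "\<dots> \<le> (\<Sum>e\<in>E. ip G e e)"
    by (intro sum_mono Bessel assms)
  also have "\<dots> = real (card E)"
    using assms(1) by (simp add: onset_def onb_def)
  finally show ?thesis by simp
qed

lemma orth_projection:
  assumes "finite G" "lin_sub G W"
  shows "\<exists>w\<in>W. \<forall>u\<in>W. ip G (\<lambda>x. v x - w x) u = 0"
proof -
  obtain E where E: "onb G W E" using onb_exists[OF assms] by blast
  define w where "w = (\<lambda>x. \<Sum>e\<in>E. ip G v e * e x)"
  have "w \<in> W" unfolding w_def
    using E by (intro lin_sub_sum[OF assms(2)]) (auto simp: onb_def onset_def)
  moreover have "ip G (\<lambda>x. v x - w x) u = 0" if u: "u \<in> W" for u
  proof -
    have ee: "ip G (\<lambda>x. v x - w x) e = 0" if "e \<in> E" for e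
      using onset_ip_sum[of G E e] that E unfolding ip_diff_left w_def by (simp add: onb_def)
    have "(\<lambda>x. \<Sum>e\<in>E. ip G u e * e x) = u" using E u by (simp add: onb_def)
    then have "ip G (\<lambda>x. v x - w x) u = ip G (\<lambda>x. v x - w x) (\<lambda>x. \<Sum>e\<in>E. ip G u e * e x)"
      by simp
    also have "\<dots> = 0" unfolding ip_sum_right by (simp add: ee)
    finally show ?thesis .
  qed
  ultimately show ?thesis by blast
qed

section \<open>Existence of a top eigenvector by compactness\<close>

lemma unit_sphere_compact:
  assumes G: "finite G" and W: "lin_sub G W"
  shows "compact {w \<in> W. ip G w w = 1}"
proof -
  obtain E where E: "onb G W E" using onb_exists[OF assms] by blast
  \<comment> \<open>The underlying type may be infinite, so compactness is taken in the product
    topology: coordinates outside G are confined to {0}, and Tychonoff applies to the whole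
    product.\<close>
  let ?B = "PiE UNIV (\<lambda>x. if x \<in> G then {-1..1::real} else {0})"
  have cB: "compact ?B"
    using compactin_PiE[of "\<lambda>_::'a. euclidean :: real topology" UNIV "\<lambda>x. if x \<in> G then {-1..1} else {0}"]
    unfolding euclidean_product_topology by simp
  \<comment> \<open>Membership in W is rewritten as the equation between w and its expansion in E, a
    closed condition because only finitely many coordinates enter the inner products.\<close>
  have eq: "{w \<in> W. ip G w w = 1}
      = {w. (\<lambda>x. \<Sum>e\<in>E. ip G w e * e x) = w} \<inter> {w. ip G w w = 1}" (is "?K = ?C")
  proof
    show "?K \<subseteq> ?C" using E by (simp add: onb_def subset_iff)
    show "?C \<subseteq> ?K"
    proof
      fix w assume w: "w \<in> ?C"
      have "(\<lambda>x. \<Sum>e\<in>E. ip G w e * e x) \<in> W"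
        using E by (intro lin_sub_sum[OF W]) (auto simp: onb_def onset_def)
      with w show "w \<in> ?K" by simp
    qed
  qed
  have cont_ip: "continuous_on UNIV (\<lambda>w. ip G w e)" for e
    unfolding ip_def by (intro continuous_intros continuous_on_product_coordinates)
  have "closed {w. (\<lambda>x. \<Sum>e\<in>E. ip G w e * e x) = w}"
    unfolding fun_eq_iff
    by (intro closed_Collect_all closed_Collect_eq continuous_on_sum continuous_on_mult
          cont_ip continuous_on_const continuous_on_product_coordinates)
  moreover have "closed {w. ip G w w = 1}"
    unfolding ip_def
    by (intro closed_Collect_eq continuous_intros continuous_on_product_coordinates)
  ultimately have "closed ?K" unfolding eq by (rule closed_Int)
  moreover have "?K \<subseteq> ?B"
  proof (intro subsetI PiE_I)
    fix w x assume w: "w \<in> ?K"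
    show "w x \<in> (if x \<in> G then {-1..1} else {0})"
    proof (cases "x \<in> G")
      case True
      have "(w x)\<^sup>2 \<le> ip G w w"
        unfolding ip_def power2_eq_square using True G
        by (intro member_le_sum) auto
      with w have "\<bar>w x\<bar> \<le> 1" by (simp add: abs_square_le_1)
      with True show ?thesis by auto
    next
      case False
      then show ?thesis using lin_sub_off[OF W, of w x] w by simp
    qed
  qed auto
  ultimately show ?thesis
    using compact_Int_closed[OF cB, of ?K] by (simp add: Int_absorb1)
qed

text \<open>The quadratic form of T attains its maximum l on the compact unit sphere of W at some v,
  and the first variation at v in the direction d = l v - T v forces d = 0.\<close>

lemma top_eigenvector:
  assumes G: "finite G" and W: "lin_sub G W" and w0: "w0 \<in> W" "w0 \<noteq> (\<lambda>_. 0)"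
    and lin: "lin_op T" and TW: "\<And>w. w \<in> W \<Longrightarrow> T w \<in> W"
    and sym: "\<And>u v. u \<in> W \<Longrightarrow> v \<in> W \<Longrightarrow> ip G (T u) v = ip G u (T v)"
  shows "\<exists>l v. v \<in> W \<and> ip G v v = 1 \<and> T v = (\<lambda>x. l * v x) \<and>
           (\<forall>w\<in>W. ip G (T w) w \<le> l * ip G w w)"
proof -
  obtain E where E: "onb G W E" using onb_exists[OF G W] by blast
  let ?K = "{w \<in> W. ip G w w = 1}"
  have ne: "?K \<noteq> {}"
    using onset_extend[OF G W, of "{}" w0] w0 by (auto simp: onset_def)
  have TE: "T w = (\<lambda>x. \<Sum>e\<in>E. ip G w e * T e x)" if "w \<in> W" for w
  proof -
    have "T w = T (\<lambda>x. \<Sum>e\<in>E. ip G w e * e x)"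
      using E that by (simp add: onb_def)
    also have "\<dots> = (\<lambda>x. \<Sum>e\<in>E. ip G w e * T e x)"
      using E by (intro lin_op_sum[OF lin]) (auto simp: onb_def onset_def)
    finally show ?thesis .
  qed
  \<comment> \<open>Expansion in the finite basis makes continuity evident for an arbitrary linear
    T; on W this is the quadratic form of T.\<close>
  define q where "q w = ip G (\<lambda>x. \<Sum>e\<in>E. ip G w e * T e x) w" for w
  have q: "q w = ip G (T w) w" if "w \<in> W" for w
    using TE[OF that] by (simp add: q_def)
  have "continuous_on ?K q"
    unfolding q_def ip_def
    by (rule continuous_on_subset[OF _ subset_UNIV])
       (intro continuous_intros continuous_on_product_coordinates)
  then obtain v where v: "v \<in> ?K" and max: "\<And>w. w \<in> ?K \<Longrightarrow> q w \<le> q v"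
    using continuous_attains_sup[OF unit_sphere_compact[OF G W] ne] by blast
  define l where "l = q v"
  have vW: "v \<in> W" and v1: "ip G v v = 1" using v by auto
  have bound: "ip G (T w) w \<le> l * ip G w w" if w: "w \<in> W" for w
  proof (cases "w = (\<lambda>_. 0)")
    case False
    have pos: "ip G w w > 0"
      using lin_sub_off[OF W w] False by (intro ip_pos[OF G]) auto
    define a where "a = 1 / sqrt (ip G w w)"
    have a2: "a * a * ip G w w = 1" using pos by (simp add: a_def field_simps)
    have *: "ip G (\<lambda>x. a * u x) (\<lambda>x. a * u' x) = a * a * ip G u u'" for u u'
      by (simp add: ip_def sum_distrib_left algebra_simps)
    have aw: "(\<lambda>x. a * w x) \<in> W" by (rule lin_sub_scale[OF W w])
    then have "q (\<lambda>x. a * w x) \<le> l" unfolding l_def using a2 by (intro max) (simp add: *)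
    then have "a * a * ip G (T w) w \<le> l" by (simp add: q[OF aw] lin_op_scale[OF lin] *)
    then have "(a * a) * ip G (T w) w \<le> (a * a) * (l * ip G w w)"
      using a2 by (simp add: mult.left_commute)
    moreover have "a * a > 0" using pos by (simp add: a_def)
    ultimately show ?thesis by (simp only: mult_le_cancel_left_pos)
  qed (simp add: lin_op_zero[OF lin])
  define d where "d = (\<lambda>x. l * v x - T v x)"
  have dW: "d \<in> W"
    unfolding d_def using lin_sub_comb[OF W vW TW[OF vW], of l "-1"] by simp
  have orth: "ip G d v = 0"
    unfolding d_def ip_diff_left ip_scale_left using v1 q[OF vW] by (simp add: l_def)
  have "ip G d d = 0"
  proof (rule ccontr)
    assume "ip G d d \<noteq> 0"
    then have dd: "ip G d d > 0" using ip_nonneg[of G d] by simp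
    define c where "c = l * ip G d d - ip G (T d) d"
    have c: "c \<ge> 0" using bound[OF dW] by (simp add: c_def)
    have key: "0 \<le> 2 * \<epsilon> * ip G d d + \<epsilon>\<^sup>2 * c" for \<epsilon>
    proof -
      let ?w = "\<lambda>x. 1 * v x + \<epsilon> * d x"
      have wW: "?w \<in> W" by (rule lin_sub_comb[OF W vW dW])
      have Td: "T v = (\<lambda>x. l * v x - d x)" by (simp add: d_def)
      have 1: "ip G (T v) d = - ip G d d"
        unfolding Td ip_diff_left ip_scale_left using orth by (simp add: ip_commute)
      have 2: "ip G (T d) v = - ip G d d"
        using sym[OF dW vW] 1 by (simp add: ip_commute)
      have 3: "ip G (T v) v = l" using q[OF vW] by (simp add: l_def)
      have "ip G (T ?w) ?w \<le> l * ip G ?w ?w" by (rule bound[OF wW])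
      then show ?thesis
        unfolding lin_op_comb[OF lin] ip_add_left ip_add_right
        using 1 2 3 orth v1 by (simp add: ip_commute[of G v d] c_def power2_eq_square algebra_simps)
    qed
    show False
    proof (cases "c = 0")
      case True
      then show False using key[of "-1"] dd by simp
    next
      case False
      with c have "c > 0" by simp
      \<comment> \<open>This value of \<epsilon> minimises the quadratic in
        \<open>key\<close>.\<close>
      have "2 * (- (ip G d d / c)) * ip G d d + (- (ip G d d / c))\<^sup>2 * c = - (ip G d d)\<^sup>2 / c"
        using \<open>c > 0\<close> by (simp add: field_simps power2_eq_square)
      moreover have "- (ip G d d)\<^sup>2 / c < 0" using dd \<open>c > 0\<close> by simp
      ultimately show False using key[of "- (ip G d d / c)"] by simp
    qed
  qed
  then have "d = (\<lambda>_. 0)" 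
    using lin_sub_off[OF W dW] by (intro ip_self_eq_0D[OF G]) simp_all
  then have "T v = (\<lambda>x. l * v x)" by (auto simp: d_def fun_eq_iff)
  with vW v1 bound show ?thesis by blast
qed

section \<open>Frame bound and even permutations\<close>

lemma lin_sub_orth:
  assumes W: "lin_sub G W"
  shows "lin_sub G {w \<in> W. \<forall>b\<in>B. ip G w b = 0}"
  unfolding lin_sub_def
  using lin_sub_off[OF W] lin_sub_zero[OF W] lin_sub_comb[OF W] by (auto simp: ip_add_left)

text \<open>On Y, orthogonality to b is orthogonality to the projection p of b onto Y. Either p = 0
  and nothing is lost, or E1 together with the normalised p is an orthonormal basis of Y.\<close>

lemma onb_card_hyperplane:
  assumes G: "finite G" and Y: "lin_sub G Y" and E: "onb G Y E"
    and E1: "onb G {y \<in> Y. ip G y b = 0} E1"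
  shows "card E \<le> card E1 + 1"
proof -
  obtain p where p: "p \<in> Y" and bp: "\<And>u. u \<in> Y \<Longrightarrow> ip G (\<lambda>x. b x - p x) u = 0"
    using orth_projection[OF G Y, of b] by auto
  have bp': "ip G u b = ip G u p" if "u \<in> Y" for u
    using bp[OF that] unfolding ip_diff_left by (simp add: ip_commute)
  show ?thesis
  proof (cases "p = (\<lambda>_. 0)")
    case True
    then have "E \<subseteq> {y \<in> Y. ip G y b = 0}"
      using E bp' by (auto simp: onb_def)
    then have "card E \<le> card E1"
      using E by (intro onset_card_le_onb[OF E1]) (auto simp: onb_def)
    then show ?thesis by simp
  next
    case False
    have E1': "E1 \<subseteq> Y" "onset G E1" "finite E1" "\<And>e. e \<in> E1 \<Longrightarrow> ip G e b = 0"
      using E1 by (auto simp: onb_def onset_def)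
    obtain k where k: "k > 0" "k * k * ip G p p = 1"
    proof
      have pos: "ip G p p > 0"
        using False lin_sub_off[OF Y p] by (intro ip_pos[OF G]) auto
      show "1 / sqrt (ip G p p) > 0" using pos by simp
      show "1 / sqrt (ip G p p) * (1 / sqrt (ip G p p)) * ip G p p = 1"
        using pos by (simp add: field_simps)
    qed
    define e0 where "e0 = (\<lambda>x. k * p x)"
    have e0Y: "e0 \<in> Y" unfolding e0_def by (rule lin_sub_scale[OF Y p])
    have ip0: "ip G e0 u = k * ip G p u" for u unfolding e0_def by (rule ip_scale_left)
    have e00: "ip G e0 e0 = 1"
      using k(2) ip0[of p] by (simp add: ip0 ip_commute[of G p e0])
    have orth: "ip G e0 e = 0" if "e \<in> E1" for e
      using E1'(4)[OF that] bp'[of e] E1'(1) that by (auto simp: ip0 ip_commute[of G p])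
    have orth': "ip G e e0 = 0" if "e \<in> E1" for e
      using orth[OF that] by (subst ip_commute)
    have ni: "e0 \<notin> E1" using orth e00 by auto
    have ons: "onset G (insert e0 E1)"
      using E1'(2) e00 orth orth' ni by (auto simp: onset_def)
    have expand: "(\<lambda>x. \<Sum>e\<in>insert e0 E1. ip G y e * e x) = y" if y: "y \<in> Y" for y
    proof -
      define z where "z = (\<lambda>x. 1 * y x + (- ip G y e0) * e0 x)"
      have zY: "z \<in> Y" unfolding z_def by (rule lin_sub_comb[OF Y y e0Y])
      have "ip G z e0 = 0" unfolding z_def ip_add_left using e00 by simp
      then have "ip G z p = 0" using k(1) ip0[of z] by (simp add: ip_commute)
      then have "z \<in> {y \<in> Y. ip G y b = 0}" using zY bp' by simp
      then have zx: "(\<lambda>x. \<Sum>e\<in>E1. ip G z e * e x) = z" using E1 unfolding onb_def by blast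
      have ze: "ip G z e = ip G y e" if "e \<in> E1" for e
        unfolding z_def ip_add_left using orth[OF that] by simp
      show ?thesis
      proof
        fix x
        have "(\<Sum>e\<in>insert e0 E1. ip G y e * e x) = ip G y e0 * e0 x + (\<Sum>e\<in>E1. ip G z e * e x)"
          using ni E1'(3) ze by simp
        also have "\<dots> = y x" using fun_cong[OF zx, of x] by (simp add: z_def)
        finally show "(\<Sum>e\<in>insert e0 E1. ip G y e * e x) = y x" .
      qed
    qed
    have "onb G Y (insert e0 E1)"
      unfolding onb_def using e0Y E1'(1) ons expand by blast
    moreover have "onset G E" "E \<subseteq> Y" using E by (auto simp: onb_def)
    ultimately have "card E \<le> card (insert e0 E1)" by (rule onset_card_le_onb)
    then show ?thesis using ni E1'(3) by simp
  qed
qed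

text \<open>Each orthogonality condition costs at most one dimension. Applied with
  \<open>card B < card E\<close>, this produces a unit vector of Y orthogonal to all of B.\<close>

lemma onb_card_orth:
  assumes G: "finite G" and "finite B" and "lin_sub G Y" and "onb G Y E"
  shows "\<exists>E'. onb G {y \<in> Y. \<forall>b\<in>B. ip G y b = 0} E' \<and> card E \<le> card E' + card B"
  using assms(2-)
proof (induction B arbitrary: Y E rule: finite_induct)
  case empty
  then show ?case by auto
next
  case (insert b B)
  let ?Y1 = "{y \<in> Y. ip G y b = 0}"
  have Y1: "lin_sub G ?Y1" using lin_sub_orth[OF insert.prems(1), of "{b}"] by simp
  then obtain E1 where E1: "onb G ?Y1 E1" using onb_exists[OF G] by blast
  obtain E' where "onb G {y \<in> ?Y1. \<forall>b\<in>B. ip G y b = 0} E'" "card E1 \<le> card E' + card B"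
    using insert.IH[OF Y1 E1] by blast
  moreover have "{y \<in> ?Y1. \<forall>b\<in>B. ip G y b = 0} = {y \<in> Y. \<forall>b\<in>insert b B. ip G y b = 0}"
    by auto
  moreover have "card E \<le> card E1 + 1"
    by (rule onb_card_hyperplane[OF G insert.prems E1])
  ultimately show ?case using insert.hyps by fastforce
qed

text \<open>On the eigenspace of the smallest eigenvalue $s$ of $S = \sum_i R_i$ the trace of $S$ is both
  $s$ times the dimension and the sum of the ranks of the projections $R_i$. These ranks add up to
  at least the dimension because the kernels intersect trivially, hence $s \ge 1$.\<close>

lemma projection_frame_bound:
  assumes G: "finite G" and W: "lin_sub G W" and I: "finite I"
    and lin: "\<And>i. i \<in> I \<Longrightarrow> lin_op (R i)"
    and RW: "\<And>i w. i \<in> I \<Longrightarrow> w \<in> W \<Longrightarrow> R i w \<in> W"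
    and sym: "\<And>i u v. i \<in> I \<Longrightarrow> u \<in> W \<Longrightarrow> v \<in> W \<Longrightarrow> ip G (R i u) v = ip G u (R i v)"
    and idem: "\<And>i w. i \<in> I \<Longrightarrow> w \<in> W \<Longrightarrow> R i (R i w) = R i w"
    and comm: "\<And>i w. i \<in> I \<Longrightarrow> w \<in> W \<Longrightarrow>
      R i (\<lambda>x. \<Sum>j\<in>I. R j w x) = (\<lambda>x. \<Sum>j\<in>I. R j (R i w) x)"
    and ker: "\<And>w. w \<in> W \<Longrightarrow> (\<And>i. i \<in> I \<Longrightarrow> R i w = (\<lambda>_. 0)) \<Longrightarrow> w = (\<lambda>_. 0)"
    and w: "w \<in> W"
  shows "ip G w w \<le> (\<Sum>i\<in>I. ip G (R i w) (R i w))"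
proof (cases "w = (\<lambda>_. 0)")
  case True
  then show ?thesis by (simp add: sum_nonneg ip_nonneg)
next
  case False
  define S where "S u = (\<lambda>x. \<Sum>j\<in>I. R j u x)" for u
  have S1: "S u = (\<lambda>x. \<Sum>j\<in>I. 1 * R j u x)" for u by (simp add: S_def)
  have SW: "S u \<in> W" if "u \<in> W" for u
    unfolding S1 by (rule lin_sub_sum[OF W I]) (use RW that in auto)
  have Slin: "lin_op S"
    unfolding lin_op_def S_def
    by (auto simp: lin_op_comb[OF lin] sum.distrib sum_distrib_left fun_eq_iff)
  have ipS: "ip G (S u) v = (\<Sum>i\<in>I. ip G (R i u) v)" for u v
    unfolding S1 ip_sum_left by simp
  have ipS': "ip G v (S u) = (\<Sum>i\<in>I. ip G v (R i u))" for u v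
    unfolding S1 ip_sum_right by simp
  have Rsq: "ip G (R i u) u = ip G (R i u) (R i u)" if "i \<in> I" "u \<in> W" for i u
    using sym[of i u "R i u"] RW idem that by (simp add: ip_commute)
  have Ssym: "ip G (S u) v = ip G u (S v)" if "u \<in> W" "v \<in> W" for u v
    using sym that by (simp add: ipS ipS')
  \<comment> \<open>The top eigenvector of -S belongs to the smallest eigenvalue s of S.\<close>
  define T where "T u = (\<lambda>x. (-1) * S u x)" for u
  have "lin_op T" unfolding T_def lin_op_def by (auto simp: lin_op_comb[OF Slin] fun_eq_iff algebra_simps)
  moreover have "T u \<in> W" if "u \<in> W" for u
    unfolding T_def by (rule lin_sub_scale[OF W SW[OF that]])
  moreover have "ip G (T u) v = ip G u (T v)" if "u \<in> W" "v \<in> W" for u v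
    unfolding T_def using Ssym[OF that]
    by (simp only: ip_scale_left ip_scale_right)
  ultimately obtain l v where v: "v \<in> W" "ip G v v = 1" and Tv: "T v = (\<lambda>x. l * v x)"
    and bd: "\<And>u. u \<in> W \<Longrightarrow> ip G (T u) u \<le> l * ip G u u"
    using top_eigenvector[OF G W w False, of T] by blast
  define s where "s = - l"
  have Sv: "S v = (\<lambda>x. s * v x)"
  proof
    show "S v x = s * v x" for x using fun_cong[OF Tv, of x] by (simp add: T_def s_def)
  qed
  have lower: "s * ip G u u \<le> (\<Sum>i\<in>I. ip G (R i u) (R i u))" if u: "u \<in> W" for u
  proof -
    have "ip G (T u) u = - ip G (S u) u" unfolding T_def ip_scale_left by simp
    then have "s * ip G u u \<le> ip G (S u) u" using bd[OF u] by (simp add: s_def)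
    also have "\<dots> = (\<Sum>i\<in>I. ip G (R i u) (R i u))" unfolding ipS using Rsq u by simp
    finally show ?thesis .
  qed
  have "s \<ge> 1"
  proof (rule ccontr)
    assume "\<not> s \<ge> 1"
    define Y where "Y = {u \<in> W. S u = (\<lambda>x. s * u x)}"
    have Y: "lin_sub G Y"
      unfolding lin_sub_def
    proof (intro conjI ballI allI impI)
      show "(\<lambda>_. 0) \<in> Y" by (simp add: Y_def lin_sub_zero[OF W] lin_op_zero[OF Slin])
      show "(\<lambda>x. a * u x + b * v x) \<in> Y" if "u \<in> Y" "v \<in> Y" for u v a b
        using that by (auto simp: Y_def lin_sub_comb[OF W] lin_op_comb[OF Slin] fun_eq_iff algebra_simps)
      show "u x = 0" if "u \<in> Y" "x \<notin> G" for u x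
        using that lin_sub_off[OF W] by (auto simp: Y_def)
    qed
    have YW: "Y \<subseteq> W" by (auto simp: Y_def)
    \<comment> \<open>S commutes with every \<open>R i\<close>, so \<open>R i\<close> preserves the
      eigenspace Y and is an orthogonal projection there, with range \<open>Yi i\<close>.\<close>
    have RY: "R i u \<in> Y" if i: "i \<in> I" and u: "u \<in> Y" for i u
    proof -
      have "S (R i u) = R i (S u)" using comm[of i u] i u YW by (auto simp: S_def)
      also have "\<dots> = (\<lambda>x. s * R i u x)" using u by (simp add: Y_def lin_op_scale[OF lin[OF i]])
      finally show ?thesis using RW i u by (simp add: Y_def)
    qed
    obtain E where E: "onb G Y E" using onb_exists[OF G Y] by blast
    have Efin: "finite E" and EY: "E \<subseteq> Y" and E1: "\<And>e. e \<in> E \<Longrightarrow> ip G e e = 1"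
      using E by (auto simp: onb_def onset_def)
    define Yi where "Yi i = {u \<in> Y. R i u = u}" for i
    have Yi: "lin_sub G (Yi i)" if "i \<in> I" for i
      unfolding lin_sub_def
    proof (intro conjI ballI allI impI)
      show "(\<lambda>_. 0) \<in> Yi i" by (simp add: Yi_def lin_sub_zero[OF Y] lin_op_zero[OF lin[OF that]])
      show "(\<lambda>x. a * u x + b * v x) \<in> Yi i" if "u \<in> Yi i" "v \<in> Yi i" for u v a b
        using that \<open>i \<in> I\<close> by (auto simp: Yi_def lin_sub_comb[OF Y] lin_op_comb[OF lin] fun_eq_iff)
      show "u x = 0" if "u \<in> Yi i" "x \<notin> G" for u x
        using that lin_sub_off[OF Y] by (auto simp: Yi_def)
    qed
    have "\<exists>B. \<forall>i\<in>I. onb G (Yi i) (B i)"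
      using onb_exists[OF G Yi] by (intro bchoice) blast
    then obtain B where B: "\<And>i. i \<in> I \<Longrightarrow> onb G (Yi i) (B i)" by blast
    have Bfin: "finite (B i)" and BY: "B i \<subseteq> Yi i" and B1: "\<And>b. b \<in> B i \<Longrightarrow> ip G b b = 1"
      if "i \<in> I" for i
      using B[OF that] by (auto simp: onb_def onset_def)
    \<comment> \<open>The trace of the projection \<open>R i\<close> on Y, computed once in the
      basis E and once in the basis \<open>B i\<close> of its range.\<close>
    have rank: "(\<Sum>e\<in>E. ip G (R i e) (R i e)) = real (card (B i))" if i: "i \<in> I" for i
    proof -
      have "(\<Sum>e\<in>E. ip G (R i e) (R i e)) = (\<Sum>e\<in>E. \<Sum>b\<in>B i. (ip G (R i e) b)\<^sup>2)"
      proof (rule sum.cong[OF refl])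
        fix e assume "e \<in> E"
        then have "R i e \<in> Yi i" using EY YW RY i idem by (auto simp: Yi_def)
        then show "ip G (R i e) (R i e) = (\<Sum>b\<in>B i. (ip G (R i e) b)\<^sup>2)"
          by (rule onb_Parseval[OF B[OF i]])
      qed
      also have "\<dots> = (\<Sum>e\<in>E. \<Sum>b\<in>B i. (ip G b e)\<^sup>2)"
      proof (intro sum.cong[OF refl])
        fix e b assume eb: "e \<in> E" "b \<in> B i"
        then have "e \<in> W" "b \<in> W" "R i b = b" using EY YW BY[OF i] by (auto simp: Yi_def)
        then have "ip G (R i e) b = ip G e b" using sym[OF i, of e b] by simp
        then show "(ip G (R i e) b)\<^sup>2 = (ip G b e)\<^sup>2" by (simp add: ip_commute)
      qed
      also have "\<dots> = (\<Sum>b\<in>B i. \<Sum>e\<in>E. (ip G b e)\<^sup>2)" by (rule sum.swap)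
      also have "\<dots> = (\<Sum>b\<in>B i. ip G b b)"
        using BY[OF i] by (intro sum.cong refl onb_Parseval[OF E, symmetric]) (auto simp: Yi_def)
      finally show ?thesis using B1[OF i] by simp
    qed
    have "s * card E = (\<Sum>e\<in>E. ip G (S e) e)"
    proof -
      have "ip G (S e) e = s" if "e \<in> E" for e
        using EY that E1[OF that] by (auto simp: Y_def ip_scale_left subset_iff)
      then show ?thesis by simp
    qed
    also have "\<dots> = (\<Sum>e\<in>E. \<Sum>i\<in>I. ip G (R i e) (R i e))"
      unfolding ipS using Rsq EY YW by (intro sum.cong) auto
    also have "\<dots> = (\<Sum>i\<in>I. real (card (B i)))"
      by (subst sum.swap) (simp add: rank)
    finally have tr: "s * card E = (\<Sum>i\<in>I. real (card (B i)))" .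
    have "E \<noteq> {}"
    proof
      assume "E = {}"
      have "ip G v v = 0" using onb_Parseval[OF E, of v] v Sv \<open>E = {}\<close> by (simp add: Y_def)
      with v show False by simp
    qed
    then have "real (card E) > 0" using Efin by (simp add: card_gt_0_iff)
    then have "s * card E < card E" using \<open>\<not> s \<ge> 1\<close> by simp
    then have "(\<Sum>i\<in>I. card (B i)) < card E" using tr by (simp flip: of_nat_sum)
    moreover have "card (\<Union>i\<in>I. B i) \<le> (\<Sum>i\<in>I. card (B i))"
      by (rule card_UN_le[OF I])
    ultimately have small: "card (\<Union>i\<in>I. B i) < card E" by simp
    \<comment> \<open>The ranges together have fewer basis vectors than Y has dimensions, so some
      unit vector y of Y is orthogonal to all of them and is killed by every
      \<open>R i\<close>.\<close>
    have "finite (\<Union>i\<in>I. B i)" using I Bfin by blast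
    from onb_card_orth[OF G this Y E] small obtain E' where
      E': "onb G {y \<in> Y. \<forall>b\<in>(\<Union>i\<in>I. B i). ip G y b = 0} E'" "card E' > 0"
      by fastforce
    then obtain y where yE: "y \<in> E'" by (metis card.empty ex_in_conv less_irrefl)
    then have y1: "ip G y y = 1" and yY: "y \<in> Y" and yb: "\<And>i b. i \<in> I \<Longrightarrow> b \<in> B i \<Longrightarrow> ip G y b = 0"
      using E' by (auto simp: onb_def onset_def)
    have "R i y = (\<lambda>_. 0)" if i: "i \<in> I" for i
    proof -
      have RyY: "R i y \<in> Yi i" using RY[OF i yY] idem[OF i] yY YW by (auto simp: Yi_def)
      have "ip G (R i y) b = 0" if b: "b \<in> B i" for b
      proof -
        have "b \<in> W" "R i b = b" using BY[OF i] b YW by (auto simp: Yi_def)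
        then show ?thesis using sym[OF i, of y b] yY YW yb[OF i b] by auto
      qed
      then have "ip G (R i y) (R i y) = 0" using onb_Parseval[OF B[OF i] RyY] by simp
      then show ?thesis using lin_sub_off[OF Y RY[OF i yY]] by (intro ip_self_eq_0D[OF G]) simp_all
    qed
    then have "y = (\<lambda>_. 0)" using ker yY YW by blast
    with y1 show False by simp
  qed
  have "ip G w w \<le> s * ip G w w" using \<open>s \<ge> 1\<close> ip_nonneg[of G w] by (simp add: mult_le_cancel_right1)
  also have "\<dots> \<le> (\<Sum>i\<in>I. ip G (R i w) (R i w))" by (rule lower[OF w])
  finally show ?thesis .
qed

section \<open>Even permutations of a finite set\<close>

definition AltS :: "'a set \<Rightarrow> ('a \<Rightarrow> 'a) set" where
  "AltS S = {p. p permutes S \<and> evenperm p}"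

lemma AltS_permutes: "p \<in> AltS S \<Longrightarrow> p permutes S"
  by (simp add: AltS_def)

lemma AltS_bij: "p \<in> AltS S \<Longrightarrow> bij p"
  using permutes_bij by (auto simp: AltS_def)

lemma AltS_comp_inv: "p \<in> AltS S \<Longrightarrow> p \<circ> inv' p = id"
  and AltS_inv_comp: "p \<in> AltS S \<Longrightarrow> inv' p \<circ> p = id"
  using permutes_inv_o by (auto simp: AltS_def)

lemma id_AltS [simp]: "id \<in> AltS S"
  by (simp add: AltS_def permutes_id)

lemma AltS_comp:
  assumes "finite S" "p \<in> AltS S" "q \<in> AltS S"
  shows "p \<circ> q \<in> AltS S"
  using assms evenperm_comp[of p q] by (auto simp: AltS_def permutes_compose permutation_permutes)

lemma AltS_inv:
  assumes "finite S" "p \<in> AltS S"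
  shows "inv' p \<in> AltS S"
  using assms evenperm_inv[of p] by (auto simp: AltS_def permutes_inv permutation_permutes)

lemma AltS_mono: "T \<subseteq> S \<Longrightarrow> AltS T \<subseteq> AltS S"
  by (auto simp: AltS_def intro: permutes_subset)

lemma finite_AltS: "finite S \<Longrightarrow> finite (AltS S)"
  by (rule finite_subset[of _ "{p. p permutes S}"]) (auto simp: AltS_def finite_permutations)

text \<open>The ground set is kept arbitrary so that a pointwise stabilizer is again an alternating
  group; whatever holds for S can then be applied inside U_I.\<close>

lemma AltS_fixing:
  assumes "D \<subseteq> S"
  shows "{p \<in> AltS S. \<forall>x\<in>D. p x = x} = AltS (S - D)"
proof
  show "{p \<in> AltS S. \<forall>x\<in>D. p x = x} \<subseteq> AltS (S - D)"
    by (auto simp: AltS_def intro: permutes_superset)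
  show "AltS (S - D) \<subseteq> {p \<in> AltS S. \<forall>x\<in>D. p x = x}"
    using AltS_mono[of "S - D" S] by (auto simp: AltS_def permutes_def)
qed

lemma AltS_comp_right_iff:
  assumes "finite S" "g \<in> AltS S"
  shows "p \<circ> g \<in> AltS S \<longleftrightarrow> p \<in> AltS S"
proof
  assume "p \<circ> g \<in> AltS S"
  then have "(p \<circ> g) \<circ> inv' g \<in> AltS S" by (rule AltS_comp[OF assms(1) _ AltS_inv[OF assms]])
  moreover have "(p \<circ> g) \<circ> inv' g = p"
    using AltS_bij[OF assms(2)] by (simp add: fun_eq_iff bij_is_surj surj_f_inv_f)
  ultimately show "p \<in> AltS S" by (simp only:)
qed (use assms in \<open>auto intro: AltS_comp\<close>)

lemma AltS_comp_left_iff: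
  assumes "finite S" "g \<in> AltS S"
  shows "g \<circ> p \<in> AltS S \<longleftrightarrow> p \<in> AltS S"
proof
  assume "g \<circ> p \<in> AltS S"
  then have "inv' g \<circ> (g \<circ> p) \<in> AltS S" by (rule AltS_comp[OF assms(1) AltS_inv[OF assms]])
  moreover have "inv' g \<circ> (g \<circ> p) = p"
    using AltS_bij[OF assms(2)] by (simp add: fun_eq_iff bij_is_inj inv_f_f)
  ultimately show "p \<in> AltS S" by (simp only:)
qed (use assms in \<open>auto intro: AltS_comp\<close>)

lemma sum_AltS_right:
  assumes "finite S" "g \<in> AltS S"
  shows "(\<Sum>p\<in>AltS S. f (p \<circ> g)) = (\<Sum>p\<in>AltS S. f p)"
proof (rule sum.reindex_bij_witness[where i = "\<lambda>p. p \<circ> inv' g" and j = "\<lambda>p. p \<circ> g"])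
  have b: "bij g" by (rule AltS_bij[OF assms(2)])
  show "p \<circ> g \<circ> inv' g = p" for p using b by (simp add: fun_eq_iff bij_is_surj surj_f_inv_f)
  show "p \<circ> inv' g \<circ> g = p" for p using b by (simp add: fun_eq_iff bij_is_inj inv_f_f)
qed (use assms in \<open>auto intro: AltS_comp AltS_inv\<close>)

lemma sum_AltS_left:
  assumes "finite S" "g \<in> AltS S"
  shows "(\<Sum>p\<in>AltS S. f (g \<circ> p)) = (\<Sum>p\<in>AltS S. f p)"
proof (rule sum.reindex_bij_witness[where i = "\<lambda>p. inv' g \<circ> p" and j = "\<lambda>p. g \<circ> p"])
  have b: "bij g" by (rule AltS_bij[OF assms(2)])
  show "inv' g \<circ> (g \<circ> p) = p" for p using b by (simp add: fun_eq_iff bij_is_inj inv_f_f)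
  show "g \<circ> (inv' g \<circ> p) = p" for p using b by (simp add: fun_eq_iff bij_is_surj surj_f_inv_f)
qed (use assms in \<open>auto intro: AltS_comp AltS_inv\<close>)

lemma sum_AltS_inv:
  assumes "finite S"
  shows "(\<Sum>p\<in>AltS S. f (inv' p)) = (\<Sum>p\<in>AltS S. f p)"
proof (rule sum.reindex_bij_witness[where i = "inv'" and j = "inv'"])
  show "inv' (inv' p) = p" if "p \<in> AltS S" for p
    using AltS_bij[OF that] by (rule inv_inv_eq)
  show "inv' (inv' p) = p" if "p \<in> AltS S" for p
    using AltS_bij[OF that] by (rule inv_inv_eq)
qed (use assms in \<open>auto intro: AltS_inv\<close>)

lemma AltS_transposition2:
  assumes "a \<in> S" "b \<in> S" "a \<noteq> b" "c \<in> S" "d \<in> S" "c \<noteq> d" "finite S"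
  shows "transpose a b \<circ> transpose c d \<in> AltS S"
proof -
  have "permutation (transpose a b)" "permutation (transpose c d)"
    using assms permutes_swap_id permutation_permutes by metis+
  then show ?thesis
    using assms by (auto simp: AltS_def evenperm_comp evenperm_swap intro!: permutes_compose permutes_swap_id)
qed

text \<open>Composition with one fixed transposition exchanges even and odd permutations; two points
  are required for a transposition to exist.\<close>

lemma card_AltS:
  assumes "finite S" "card S \<ge> 2"
  shows "2 * card (AltS S) = fact (card S)"
proof -
  obtain a b where ab: "a \<in> S" "b \<in> S" "a \<noteq> b"
    using assms by (metis card_2_iff' card_le_Suc0_iff_eq not_less_eq_eq numeral_2_eq_2 One_nat_def)
  let ?t = "transpose a b"
  have t: "?t permutes S" using ab by (simp add: permutes_swap_id)
  have pt: "permutation ?t" using t assms permutation_permutes by blast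
  have tt: "?t \<circ> (?t \<circ> p) = p" for p by (simp add: fun_eq_iff)
  have odd: "{p. p permutes S \<and> \<not> evenperm p} = (\<lambda>p. ?t \<circ> p) ` AltS S"
  proof (intro Set.set_eqI iffI)
    fix p assume p: "p \<in> {p. p permutes S \<and> \<not> evenperm p}"
    then have "permutation p" using assms permutation_permutes by blast
    then have "?t \<circ> p \<in> AltS S"
      using p t pt ab by (auto simp: AltS_def evenperm_comp evenperm_swap permutes_compose)
    then show "p \<in> (\<lambda>p. ?t \<circ> p) ` AltS S" using tt[of p] by (metis imageI)
  next
    fix p assume "p \<in> (\<lambda>p. ?t \<circ> p) ` AltS S"
    then obtain q where q: "p = ?t \<circ> q" "q permutes S" "evenperm q" by (auto simp: AltS_def)
    then have "permutation q" using assms permutation_permutes by blast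
    then show "p \<in> {p. p permutes S \<and> \<not> evenperm p}"
      using q t pt ab by (auto simp: evenperm_comp evenperm_swap permutes_compose)
  qed
  have "inj_on (\<lambda>p. ?t \<circ> p) (AltS S)" by (metis inj_onI tt)
  then have "card {p. p permutes S \<and> \<not> evenperm p} = card (AltS S)"
    unfolding odd by (rule card_image)
  moreover have "{p. p permutes S} = AltS S \<union> {p. p permutes S \<and> \<not> evenperm p}"
    by (auto simp: AltS_def)
  moreover have "AltS S \<inter> {p. p permutes S \<and> \<not> evenperm p} = {}"
    by (auto simp: AltS_def)
  moreover have "finite {p. p permutes S \<and> \<not> evenperm p}"
    using finite_permutations[OF assms(1)] by (rule rev_finite_subset) auto
  ultimately have "card {p. p permutes S} = card (AltS S) + card (AltS S)"
    using card_Un_disjoint[OF finite_AltS[OF assms(1)]] by metis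
  then show ?thesis using card_permutations[OF refl assms(1)] by simp
qed

lemma card_AltS_pos: "finite S \<Longrightarrow> card (AltS S) > 0"
  unfolding card_gt_0_iff using finite_AltS[of S] id_AltS[of S] by blast

text \<open>Two points outside D guarantee that both alternating groups have index exactly 2 in
  their symmetric groups, so the factors 1/2 cancel.\<close>

lemma card_AltS_ratio:
  assumes "finite S" "D \<subseteq> S" "card D + 2 \<le> card S"
  shows "real (card (AltS S)) = fact (card S) / fact (card S - card D) * real (card (AltS (S - D)))"
proof -
  have c: "card (S - D) = card S - card D"
    using assms by (simp add: card_Diff_subset finite_subset)
  have "2 * card (AltS S) = fact (card S)" using assms by (intro card_AltS) auto
  moreover have "2 * card (AltS (S - D)) = fact (card S - card D)"
    using card_AltS[of "S - D"] assms c by simp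
  ultimately have 1: "fact (card S) = 2 * real (card (AltS S))"
    and 2: "fact (card S - card D) = 2 * real (card (AltS (S - D)))"
    by (metis of_nat_fact of_nat_mult of_nat_numeral)+
  have "real (card (AltS (S - D))) > 0" using card_AltS_pos[of "S - D"] assms(1) by simp
  then show ?thesis unfolding 1 2 by simp
qed

lemma AltS_fiber:
  assumes "finite S" "D \<subseteq> S" "g \<in> AltS S"
  shows "{p \<in> AltS S. \<forall>x\<in>D. p x = g x} = (\<lambda>u. g \<circ> u) ` AltS (S - D)"
proof (intro Set.set_eqI iffI)
  fix p assume p: "p \<in> {p \<in> AltS S. \<forall>x\<in>D. p x = g x}"
  have b: "bij g" by (rule AltS_bij[OF assms(3)])
  have "inv' g \<circ> p \<in> {p \<in> AltS S. \<forall>x\<in>D. p x = x}"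
    using p assms b by (auto intro: AltS_comp AltS_inv simp: bij_is_inj inv_f_f)
  then have "inv' g \<circ> p \<in> AltS (S - D)" using AltS_fixing[OF assms(2)] by blast
  moreover have "g \<circ> (inv' g \<circ> p) = p" using b by (simp add: fun_eq_iff bij_is_surj surj_f_inv_f)
  ultimately show "p \<in> (\<lambda>u. g \<circ> u) ` AltS (S - D)" by (metis imageI)
next
  fix p assume "p \<in> (\<lambda>u. g \<circ> u) ` AltS (S - D)"
  then obtain u where u: "p = g \<circ> u" "u \<in> AltS (S - D)" by blast
  then have "u \<in> AltS S" "\<forall>x\<in>D. u x = x" using AltS_fixing[OF assms(2)] by blast+
  then show "p \<in> {p \<in> AltS S. \<forall>x\<in>D. p x = g x}"
    using u assms by (auto intro: AltS_comp)
qed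

lemma inj_on_comp_left: "bij g \<Longrightarrow> inj_on (\<lambda>u. g \<circ> u) A"
  by (rule inj_onI) (metis bij_is_inj fun.inj_map_strong inj_eq)

lemma card_AltS_fiber_le:
  assumes "finite S" "D \<subseteq> S"
  shows "card {p \<in> AltS S. \<forall>x\<in>D. p x = w x} \<le> card (AltS (S - D))"
proof (cases "{p \<in> AltS S. \<forall>x\<in>D. p x = w x} = {}")
  case False
  then obtain g where g: "g \<in> AltS S" "\<forall>x\<in>D. g x = w x" by blast
  then have "{p \<in> AltS S. \<forall>x\<in>D. p x = w x} = {p \<in> AltS S. \<forall>x\<in>D. p x = g x}" by auto
  also have "\<dots> = (\<lambda>u. g \<circ> u) ` AltS (S - D)" by (rule AltS_fiber[OF assms g(1)])
  finally show ?thesis using finite_AltS[of "S - D"] assms(1) by (simp add: card_image_le)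
next
  case True
  show ?thesis unfolding True by simp
qed

text \<open>Any permutation of S carrying D to D' will do up to parity, and a wrong parity is
  repaired by a transposition of two points outside D.\<close>

lemma AltS_transitive_sets:
  assumes "finite S" "D \<subseteq> S" "D' \<subseteq> S" "card D = card D'" "card D + 2 \<le> card S"
  shows "\<exists>g\<in>AltS S. g ` D = D'"
proof -
  have fin: "finite D" "finite D'" using assms finite_subset by auto
  obtain f where f: "bij_betw f D D'"
    using fin assms(4) finite_same_card_bij by blast
  have "card (S - D) = card (S - D')"
    using assms fin by (simp add: card_Diff_subset)
  then obtain h where h: "bij_betw h (S - D) (S - D')"
    using assms(1) finite_same_card_bij[of "S - D" "S - D'"] by auto
  define g where "g x = (if x \<in> D then f x else if x \<in> S then h x else x)" for x
  have gD: "bij_betw g D D'" using f by (simp add: g_def cong: bij_betw_cong)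
  have gS: "bij_betw g (S - D) (S - D')"
    using h by (rule bij_betw_cong[THEN iffD1, rotated]) (auto simp: g_def)
  have "bij_betw g (D \<union> (S - D)) (D' \<union> (S - D'))"
    using gD gS by (rule bij_betw_combine) auto
  then have "bij_betw g S S" using assms by (simp add: Un_absorb1)
  then have gp: "g permutes S" using assms(2) by (intro bij_imp_permutes) (auto simp: g_def)
  have gim: "g ` D = D'" using gD by (simp add: bij_betw_def)
  show ?thesis
  proof (cases "evenperm g")
    case True
    then show ?thesis using gp gim by (auto simp: AltS_def)
  next
    case False
    have "card (S - D) \<ge> 2" using assms fin by (simp add: card_Diff_subset)
    then obtain a b where ab: "a \<in> S - D" "b \<in> S - D" "a \<noteq> b"
      using assms(1) by (metis card_le_Suc0_iff_eq finite_Diff not_less_eq_eq numeral_2_eq_2)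
    have t: "transpose a b permutes S" using ab by (simp add: permutes_swap_id)
    have pt: "permutation (transpose a b)" "permutation g"
      using t gp assms(1) permutation_permutes by blast+
    have "g \<circ> transpose a b \<in> AltS S"
      using t gp False pt ab by (auto simp: AltS_def evenperm_comp evenperm_swap permutes_compose)
    moreover have "(g \<circ> transpose a b) ` D = D'"
      using ab gim by (auto simp: transpose_def image_def)
    ultimately show ?thesis by blast
  qed
qed

lemma AltS_conj_fixing:
  assumes "finite S" "D \<subseteq> S" "g \<in> AltS S" "u \<in> AltS (S - D)"
  shows "g \<circ> u \<circ> inv' g \<in> AltS (S - g ` D)"
proof -
  have b: "bij g" by (rule AltS_bij[OF assms(3)])
  have u: "u \<in> AltS S" "\<forall>x\<in>D. u x = x" using assms(4) AltS_fixing[OF assms(2)] by blast+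
  have "g ` D \<subseteq> S"
    using assms(2) AltS_permutes[OF assms(3)] by (metis image_mono permutes_image)
  moreover have "g \<circ> u \<circ> inv' g \<in> {p \<in> AltS S. \<forall>x\<in>g ` D. p x = x}"
    using u assms b by (auto intro!: AltS_comp AltS_inv simp: bij_is_inj inv_f_f)
  ultimately show ?thesis using AltS_fixing[of "g ` D" S] by blast
qed

section \<open>Averaging operators on the alternating group\<close>

text \<open>With S - D in place of S, this is the mean over all even permutations that agree with
  \<sigma> on D; on functions on the full group it is the orthogonal projection onto those depending
  on the values on D only.\<close>

definition alt_avg :: "'a set \<Rightarrow> (('a \<Rightarrow> 'a) \<Rightarrow> real) \<Rightarrow> ('a \<Rightarrow> 'a) \<Rightarrow> real" where
  "alt_avg S v = (\<lambda>\<sigma>. (\<Sum>u\<in>AltS S. v (\<sigma> \<circ> u)) / card (AltS S))"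

definition shift :: "('a \<Rightarrow> 'a) \<Rightarrow> (('a \<Rightarrow> 'a) \<Rightarrow> real) \<Rightarrow> ('a \<Rightarrow> 'a) \<Rightarrow> real" where
  "shift g v = (\<lambda>\<sigma>. v (\<sigma> \<circ> g))"

text \<open>The operator F, with \<open>left_avg_inv\<close> as its adjoint. It multiplies on the
  left whereas \<open>shift\<close> and \<open>alt_avg\<close> act on the right, so it commutes with
  both; hence all spaces defined by degree are invariant under it.\<close>

definition left_avg :: "('a \<Rightarrow> 'a) set \<Rightarrow> (('a \<Rightarrow> 'a) \<Rightarrow> real) \<Rightarrow> ('a \<Rightarrow> 'a) \<Rightarrow> real" where
  "left_avg B v = (\<lambda>\<sigma>. (\<Sum>b\<in>B. v (b \<circ> \<sigma>)) / card B)"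

definition left_avg_inv :: "('a \<Rightarrow> 'a) set \<Rightarrow> (('a \<Rightarrow> 'a) \<Rightarrow> real) \<Rightarrow> ('a \<Rightarrow> 'a) \<Rightarrow> real" where
  "left_avg_inv B v = (\<lambda>\<sigma>. (\<Sum>b\<in>B. v (inv' b \<circ> \<sigma>)) / card B)"

definition Fun :: "'a set \<Rightarrow> (('a \<Rightarrow> 'a) \<Rightarrow> real) set" where
  "Fun S = {v. \<forall>\<sigma>. \<sigma> \<notin> AltS S \<longrightarrow> v \<sigma> = 0}"

text \<open>The functions orthogonal to all those that depend on the values at \<open>d\<close> points only.\<close>

definition high :: "'a set \<Rightarrow> nat \<Rightarrow> (('a \<Rightarrow> 'a) \<Rightarrow> real) set" where
  "high S d = {v \<in> Fun S. \<forall>D. D \<subseteq> S \<longrightarrow> card D = d \<longrightarrow> alt_avg (S - D) v = (\<lambda>_. 0)}"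

lemma lin_op_alt_avg: "lin_op (alt_avg S)"
  by (auto simp: lin_op_def alt_avg_def sum.distrib sum_distrib_left add_divide_distrib
      sum_divide_distrib fun_eq_iff)

lemma lin_op_shift: "lin_op (shift g)"
  by (auto simp: lin_op_def shift_def)

lemma lin_op_left_avg: "lin_op (left_avg B)"
  by (auto simp: lin_op_def left_avg_def sum.distrib sum_distrib_left add_divide_distrib
      sum_divide_distrib fun_eq_iff)

lemma lin_op_left_avg_inv: "lin_op (left_avg_inv B)"
  by (auto simp: lin_op_def left_avg_inv_def sum.distrib sum_distrib_left add_divide_distrib
      sum_divide_distrib fun_eq_iff)

lemma lin_sub_Fun: "lin_sub (AltS S) (Fun S)"
  by (auto simp: lin_sub_def Fun_def)

lemma Fun_shift:
  assumes "finite S" "g \<in> AltS S" "v \<in> Fun S"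
  shows "shift g v \<in> Fun S"
  using assms by (auto simp: Fun_def shift_def AltS_comp_right_iff)

lemma Fun_alt_avg:
  assumes "finite S" "T \<subseteq> S" "v \<in> Fun S"
  shows "alt_avg T v \<in> Fun S"
proof -
  have "v (\<sigma> \<circ> u) = 0" if "\<sigma> \<notin> AltS S" "u \<in> AltS T" for \<sigma> u
    using that assms AltS_mono[OF assms(2)] by (auto simp: Fun_def AltS_comp_right_iff subset_iff)
  then show ?thesis by (simp add: Fun_def alt_avg_def)
qed

lemma Fun_left_avg:
  assumes "finite S" "B \<subseteq> AltS S" "v \<in> Fun S"
  shows "left_avg B v \<in> Fun S"
proof -
  have "v (b \<circ> \<sigma>) = 0" if "\<sigma> \<notin> AltS S" "b \<in> B" for \<sigma> b
    using that assms by (auto simp: Fun_def AltS_comp_left_iff subset_iff)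
  then show ?thesis by (simp add: Fun_def left_avg_def)
qed

lemma Fun_left_avg_inv:
  assumes "finite S" "B \<subseteq> AltS S" "v \<in> Fun S"
  shows "left_avg_inv B v \<in> Fun S"
proof -
  have "v (inv' b \<circ> \<sigma>) = 0" if "\<sigma> \<notin> AltS S" "b \<in> B" for \<sigma> b
    using that assms AltS_inv[OF assms(1)] by (auto simp: Fun_def AltS_comp_left_iff subset_iff)
  then show ?thesis by (simp add: Fun_def left_avg_inv_def)
qed

lemma ip_shift:
  assumes "finite S" "g \<in> AltS S"
  shows "ip (AltS S) (shift g u) (shift g v) = ip (AltS S) u v"
  unfolding ip_def shift_def by (rule sum_AltS_right[OF assms, of "\<lambda>p. u p * v p"])

lemma ip_shift_left:
  assumes "finite S" "g \<in> AltS S"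
  shows "ip (AltS S) (shift g u) v = ip (AltS S) u (shift (inv' g) v)"
proof -
  have "inv' g \<circ> g = id" by (rule AltS_inv_comp[OF assms(2)])
  moreover have "shift (inv' g) (shift g u) = (\<lambda>\<sigma>. u (\<sigma> \<circ> (inv' g \<circ> g)))"
    by (simp add: shift_def comp_assoc)
  ultimately have "shift (inv' g) (shift g u) = u" by (simp only: comp_id)
  then show ?thesis using ip_shift[OF assms(1) AltS_inv[OF assms], of "shift g u" v] by simp
qed

lemma ip_alt_avg:
  assumes S: "finite S" and T: "T \<subseteq> S"
  shows "ip (AltS S) (alt_avg T u) v = ip (AltS S) u (alt_avg T v)"
proof -
  have fT: "finite T" using S T finite_subset by blast
  have avg: "alt_avg T w = (\<lambda>\<sigma>. \<Sum>g\<in>AltS T. (1 / card (AltS T)) * shift g w \<sigma>)" for w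
    by (simp add: alt_avg_def shift_def sum_divide_distrib)
  have "ip (AltS S) (alt_avg T u) v = (\<Sum>g\<in>AltS T. (1 / card (AltS T)) * ip (AltS S) u (shift (inv' g) v))"
    unfolding avg ip_sum_left using ip_shift_left[OF S] AltS_mono[OF T] by (intro sum.cong) auto
  also have "\<dots> = (\<Sum>g\<in>AltS T. (1 / card (AltS T)) * ip (AltS S) u (shift g v))"
    by (rule sum_AltS_inv[OF fT])
  also have "\<dots> = ip (AltS S) u (alt_avg T v)"
    unfolding avg ip_sum_right ..
  finally show ?thesis .
qed

lemma ip_left_avg:
  assumes S: "finite S" and B: "B \<subseteq> AltS S"
  shows "ip (AltS S) (left_avg B u) v = ip (AltS S) u (left_avg_inv B v)"
proof -
  have "(\<Sum>\<sigma>\<in>AltS S. u (b \<circ> \<sigma>) * v \<sigma>) = (\<Sum>\<sigma>\<in>AltS S. u \<sigma> * v (inv' b \<circ> \<sigma>))" if "b \<in> B" for b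
  proof -
    have b: "b \<in> AltS S" using that B by blast
    have "inv' b \<circ> b = id" by (rule AltS_inv_comp[OF b])
    then have bb: "inv' b \<circ> (b \<circ> \<sigma>) = \<sigma>" for \<sigma> by (simp flip: comp_assoc)
    show ?thesis using sum_AltS_left[OF S b, of "\<lambda>\<sigma>. u \<sigma> * v (inv' b \<circ> \<sigma>)"] by (simp add: bb)
  qed
  then have "(\<Sum>b\<in>B. \<Sum>\<sigma>\<in>AltS S. u (b \<circ> \<sigma>) * v \<sigma>) = (\<Sum>b\<in>B. \<Sum>\<sigma>\<in>AltS S. u \<sigma> * v (inv' b \<circ> \<sigma>))"
    by simp
  then have "(\<Sum>\<sigma>\<in>AltS S. \<Sum>b\<in>B. u (b \<circ> \<sigma>) * v \<sigma>) = (\<Sum>\<sigma>\<in>AltS S. \<Sum>b\<in>B. u \<sigma> * v (inv' b \<circ> \<sigma>))"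
    by (subst (1 2) sum.swap)
  then show ?thesis
    unfolding ip_def left_avg_def left_avg_inv_def
    by (simp add: sum_distrib_left sum_distrib_right flip: sum_divide_distrib)
qed

text \<open>The inner average is absorbed by translation invariance of the outer one; T = S gives
  idempotence.\<close>

lemma alt_avg_absorb1:
  assumes "finite S" "T \<subseteq> S"
  shows "alt_avg S (alt_avg T v) = alt_avg S v"
proof
  fix \<sigma>
  have fT: "finite T" using assms finite_subset by blast
  have "(\<Sum>u\<in>AltS S. \<Sum>w\<in>AltS T. v (\<sigma> \<circ> u \<circ> w)) = (\<Sum>w\<in>AltS T. \<Sum>u\<in>AltS S. v (\<sigma> \<circ> (u \<circ> w)))"
    by (subst sum.swap) (simp add: comp_assoc)
  also have "\<dots> = (\<Sum>w\<in>AltS T. \<Sum>u\<in>AltS S. v (\<sigma> \<circ> u))"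
    using AltS_mono[OF assms(2)]
    by (intro sum.cong refl sum_AltS_right[OF assms(1), of _ "\<lambda>u. v (\<sigma> \<circ> u)"]) auto
  finally show "alt_avg S (alt_avg T v) \<sigma> = alt_avg S v \<sigma>"
    using card_AltS_pos[OF fT] by (simp add: alt_avg_def flip: sum_divide_distrib)
qed

text \<open>Conjugation by g carries the stabilizer of D onto the stabilizer of the image of
  D.\<close>

lemma shift_alt_avg:
  assumes S: "finite S" and D: "D \<subseteq> S" and g: "g \<in> AltS S"
  shows "shift g (alt_avg (S - D) v) = alt_avg (S - g ` D) (shift g v)"
proof
  fix \<sigma>
  have b: "bij g" by (rule AltS_bij[OF g])
  have gi: "inv' g \<circ> g = id" "g \<circ> inv' g = id"
    using AltS_inv_comp[OF g] AltS_comp_inv[OF g] by simp_all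
  have gD: "g ` D \<subseteq> S" using D AltS_permutes[OF g] by (metis image_mono permutes_image)
  have ig: "inv' g \<in> AltS S" by (rule AltS_inv[OF S g])
  have igD: "inv' g ` g ` D = D" using b by (simp add: image_inv_f_f bij_is_inj)
  have iig: "inv' (inv' g) = g" using b by (rule inv_inv_eq)
  let ?f = "\<lambda>u. g \<circ> u \<circ> inv' g" and ?h = "\<lambda>u. inv' g \<circ> u \<circ> g"
  have hf: "?h (?f u) = u" and fh: "?f (?h u) = u" for u
  proof -
    have "?h (?f u) = (inv' g \<circ> g) \<circ> u \<circ> (inv' g \<circ> g)" by (simp only: comp_assoc)
    then show "?h (?f u) = u" unfolding gi by simp
    have "?f (?h u) = (g \<circ> inv' g) \<circ> u \<circ> (g \<circ> inv' g)" by (simp only: comp_assoc)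
    then show "?f (?h u) = u" unfolding gi by simp
  qed
  have fin: "?f u \<in> AltS (S - g ` D)" if "u \<in> AltS (S - D)" for u
    by (rule AltS_conj_fixing[OF S D g that])
  have hin: "?h u \<in> AltS (S - D)" if "u \<in> AltS (S - g ` D)" for u
    using AltS_conj_fixing[OF S gD ig that] unfolding igD iig .
  have "bij_betw ?f (AltS (S - D)) (AltS (S - g ` D))"
  proof (rule bij_betw_byWitness[where f' = ?h])
    show "\<forall>u\<in>AltS (S - D). ?h (?f u) = u" by (intro ballI hf)
    show "\<forall>u\<in>AltS (S - g ` D). ?f (?h u) = u" by (intro ballI fh)
    show "?f ` AltS (S - D) \<subseteq> AltS (S - g ` D)" by (intro image_subsetI fin)
    show "?h ` AltS (S - g ` D) \<subseteq> AltS (S - D)" by (intro image_subsetI hin)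
  qed
  then have "card (AltS (S - D)) = card (AltS (S - g ` D))" by (rule bij_betw_same_card)
  moreover have "(\<Sum>u\<in>AltS (S - D). v (\<sigma> \<circ> g \<circ> u)) = (\<Sum>u\<in>AltS (S - g ` D). v (\<sigma> \<circ> u \<circ> g))"
  proof (rule sum.reindex_bij_witness[where i = ?h and j = ?f])
    fix u
    show "?h (?f u) = u" by (rule hf)
    show "?f (?h u) = u" by (rule fh)
    show "?f u \<in> AltS (S - g ` D)" if "u \<in> AltS (S - D)" using that by (rule fin)
    show "?h u \<in> AltS (S - D)" if "u \<in> AltS (S - g ` D)" using that by (rule hin)
    have "\<sigma> \<circ> ?f u \<circ> g = \<sigma> \<circ> g \<circ> u \<circ> (inv' g \<circ> g)" by (simp only: comp_assoc)
    then show "v (\<sigma> \<circ> ?f u \<circ> g) = v (\<sigma> \<circ> g \<circ> u)" unfolding gi by simp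
  qed
  ultimately show "shift g (alt_avg (S - D) v) \<sigma> = alt_avg (S - g ` D) (shift g v) \<sigma>"
    by (simp add: shift_def alt_avg_def)
qed

lemma left_avg_alt_avg: "left_avg B (alt_avg T v) = alt_avg T (left_avg B v)"
proof
  fix \<sigma>
  have "(\<Sum>b\<in>B. \<Sum>u\<in>AltS T. v (b \<circ> \<sigma> \<circ> u)) = (\<Sum>u\<in>AltS T. \<Sum>b\<in>B. v (b \<circ> (\<sigma> \<circ> u)))"
    by (subst sum.swap) (simp add: comp_assoc)
  then show "left_avg B (alt_avg T v) \<sigma> = alt_avg T (left_avg B v) \<sigma>"
    by (simp add: left_avg_def alt_avg_def mult.commute flip: sum_divide_distrib)
qed

lemma left_avg_inv_alt_avg: "left_avg_inv B (alt_avg T v) = alt_avg T (left_avg_inv B v)"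
proof
  fix \<sigma>
  have "(\<Sum>b\<in>B. \<Sum>u\<in>AltS T. v (inv' b \<circ> \<sigma> \<circ> u)) = (\<Sum>u\<in>AltS T. \<Sum>b\<in>B. v (inv' b \<circ> (\<sigma> \<circ> u)))"
    by (subst sum.swap) (simp add: comp_assoc)
  then show "left_avg_inv B (alt_avg T v) \<sigma> = alt_avg T (left_avg_inv B v) \<sigma>"
    by (simp add: left_avg_inv_def alt_avg_def mult.commute flip: sum_divide_distrib)
qed

lemma left_avg_shift: "left_avg B (shift g v) = shift g (left_avg B v)"
  by (simp add: left_avg_def shift_def comp_assoc)

lemma left_avg_inv_shift: "left_avg_inv B (shift g v) = shift g (left_avg_inv B v)"
  by (simp add: left_avg_inv_def shift_def comp_assoc)

section \<open>The filtration by degree\<close>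

lemma lin_sub_high: "lin_sub (AltS S) (high S d)"
  unfolding lin_sub_def
proof (intro conjI ballI allI impI)
  show "(\<lambda>_. 0) \<in> high S d"
    by (simp add: high_def lin_sub_zero[OF lin_sub_Fun] lin_op_zero[OF lin_op_alt_avg])
  show "(\<lambda>x. a * u x + b * v x) \<in> high S d" if "u \<in> high S d" "v \<in> high S d" for u v a b
    using that by (simp add: high_def lin_sub_comb[OF lin_sub_Fun] lin_op_comb[OF lin_op_alt_avg])
  show "u x = 0" if "u \<in> high S d" "x \<notin> AltS S" for u x
    using that by (simp add: high_def Fun_def)
qed

lemma highD: "v \<in> high S d \<Longrightarrow> D \<subseteq> S \<Longrightarrow> card D = d \<Longrightarrow> alt_avg (S - D) v = (\<lambda>_. 0)"
  by (simp add: high_def)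

lemma high_Fun: "v \<in> high S d \<Longrightarrow> v \<in> Fun S"
  by (simp add: high_def)

text \<open>D extends to a set with exactly d elements, and the average over the larger stabilizer
  factors through the average over the smaller one.\<close>

lemma high_alt_avg_0:
  assumes S: "finite S" and v: "v \<in> high S d" and D: "D \<subseteq> S" "card D \<le> d" and d: "d \<le> card S"
  shows "alt_avg (S - D) v = (\<lambda>_. 0)"
proof -
  have fD: "finite D" using S D finite_subset by blast
  have "d - card D \<le> card (S - D)" using S D d fD by (simp add: card_Diff_subset)
  then obtain C where C: "C \<subseteq> S - D" "card C = d - card D" "finite C"
    by (rule obtain_subset_with_card_n)
  have "card (D \<union> C) = d" using C D fD by (subst card_Un_disjoint) auto
  then have "alt_avg (S - (D \<union> C)) v = (\<lambda>_. 0)"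
    using C D by (intro highD[OF v]) auto
  moreover have "alt_avg (S - D) (alt_avg (S - (D \<union> C)) v) = alt_avg (S - D) v"
    using S by (intro alt_avg_absorb1) auto
  ultimately show ?thesis by (simp add: lin_op_zero[OF lin_op_alt_avg])
qed

lemma high_antimono:
  assumes "finite S" "d \<le> d'" "d' \<le> card S"
  shows "high S d' \<subseteq> high S d"
  using high_alt_avg_0[OF assms(1)] assms(2,3) by (auto simp: high_def)

lemma high_left_avg:
  assumes "finite S" "B \<subseteq> AltS S" "v \<in> high S d"
  shows "left_avg B v \<in> high S d"
  using assms Fun_left_avg[OF assms(1,2)]
  by (simp add: high_def lin_op_zero[OF lin_op_left_avg] flip: left_avg_alt_avg)

lemma high_left_avg_inv:
  assumes "finite S" "B \<subseteq> AltS S" "v \<in> high S d"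
  shows "left_avg_inv B v \<in> high S d"
  using assms Fun_left_avg_inv[OF assms(1,2)]
  by (simp add: high_def lin_op_zero[OF lin_op_left_avg_inv] flip: left_avg_inv_alt_avg)

lemma high_shift:
  assumes S: "finite S" and g: "g \<in> AltS S" and v: "v \<in> high S d"
  shows "shift g v \<in> high S d"
  unfolding high_def
proof (intro CollectI conjI allI impI)
  show "shift g v \<in> Fun S" by (rule Fun_shift[OF S g high_Fun[OF v]])
  fix D assume D: "D \<subseteq> S" "card D = d"
  have b: "bij g" by (rule AltS_bij[OF g])
  have gi: "g ` inv' g ` D = D" using b by (simp add: image_f_inv_f bij_is_surj)
  have ig: "inv' g \<in> AltS S" by (rule AltS_inv[OF S g])
  have D': "inv' g ` D \<subseteq> S" using D AltS_permutes[OF ig] by (metis image_mono permutes_image)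
  have "card (inv' g ` D) = d"
    using D AltS_bij[OF ig] by (metis bij_is_inj card_image inj_on_subset subset_UNIV)
  then have "alt_avg (S - inv' g ` D) v = (\<lambda>_. 0)" by (rule highD[OF v D'])
  then show "alt_avg (S - D) (shift g v) = (\<lambda>_. 0)"
    using shift_alt_avg[OF S D' g, of v] by (simp add: gi shift_def)
qed

lemma high_alt_avg:
  assumes S: "finite S" and T: "T \<subseteq> S" and v: "v \<in> high S d"
  shows "alt_avg T v \<in> high S d"
proof -
  have "(\<lambda>\<sigma>. \<Sum>g\<in>AltS T. (1 / card (AltS T)) * shift g v \<sigma>) \<in> high S d"
    using S T AltS_mono[OF T] finite_subset
    by (intro lin_sub_sum[OF lin_sub_high] finite_AltS high_shift[OF S _ v]) auto
  then show ?thesis by (simp add: alt_avg_def shift_def sum_divide_distrib)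
qed

text \<open>The functions of degree at most d. Defined as an orthogonal complement, they inherit
  invariance under F from \<open>high S d\<close> by adjoints, and an orthogonal projection supplies
  the splitting of any function.\<close>

definition low :: "'a set \<Rightarrow> nat \<Rightarrow> (('a \<Rightarrow> 'a) \<Rightarrow> real) set" where
  "low S d = {v \<in> Fun S. \<forall>u\<in>high S d. ip (AltS S) v u = 0}"

lemma low_left_avg:
  assumes "finite S" "B \<subseteq> AltS S" "v \<in> low S d"
  shows "left_avg B v \<in> low S d"
  using assms high_left_avg_inv[OF assms(1,2)] Fun_left_avg[OF assms(1,2)]
  by (simp add: low_def ip_left_avg)

lemma low_left_avg_inv:
  assumes "finite S" "B \<subseteq> AltS S" "v \<in> low S d"
  shows "left_avg_inv B v \<in> low S d"
proof -
  have "ip (AltS S) (left_avg_inv B v) u = 0" if "u \<in> high S d" for u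
  proof -
    have "ip (AltS S) v (left_avg B u) = 0"
      using assms(3) high_left_avg[OF assms(1,2) that] by (simp add: low_def)
    then show ?thesis
      using ip_left_avg[OF assms(1,2), of u v] by (simp add: ip_commute)
  qed
  then show ?thesis using assms(3) Fun_left_avg_inv[OF assms(1,2)] by (simp add: low_def)
qed

text \<open>A function killed by the averages of all d-sets lies in \<open>high S d\<close>, which
  meets \<open>low S d\<close> only in 0; so these averages satisfy the kernel condition of
  \<open>projection_frame_bound\<close> on \<open>low S d\<close>.\<close>

lemma low_frame_bound:
  assumes S: "finite S" and v: "v \<in> low S d"
  shows "ip (AltS S) v v \<le> (\<Sum>D | D \<subseteq> S \<and> card D = d.
           ip (AltS S) (alt_avg (S - D) v) (alt_avg (S - D) v))"
proof -
  let ?G = "AltS S" and ?I = "{D. D \<subseteq> S \<and> card D = d}"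
  have fI: "finite ?I" using S by simp
  have lin_low: "lin_sub ?G (low S d)"
    unfolding low_def by (rule lin_sub_orth[OF lin_sub_Fun])
  \<comment> \<open>Relabelling by g permutes the d-sets, so the sum over all of them commutes with
    right translations and therefore with every average of translations.\<close>
  have sh: "(\<lambda>x. \<Sum>D\<in>?I. alt_avg (S - D) (shift g w) x) = shift g (\<lambda>x. \<Sum>D\<in>?I. alt_avg (S - D) w x)"
    if g: "g \<in> ?G" for g w
  proof
    fix x
    have b: "bij g" by (rule AltS_bij[OF g])
    have gS: "g ` S = S" using AltS_permutes[OF g] by (rule permutes_image)
    have inv: "inv' g ` S = S" using AltS_permutes[OF AltS_inv[OF S g]] by (rule permutes_image)
    have ci: "card (g ` D) = card D" "card (inv' g ` D) = card D" for D
      using b bij_imp_bij_inv[OF b] by (metis bij_is_inj card_image inj_on_subset subset_UNIV)+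
    have "(\<Sum>D\<in>?I. alt_avg (S - D) (shift g w) x) = (\<Sum>D\<in>?I. alt_avg (S - g ` D) (shift g w) x)"
    proof (rule sum.reindex_bij_witness[where i = "\<lambda>D. g ` D" and j = "\<lambda>D. inv' g ` D"])
      show "g ` inv' g ` D = D" for D using b by (simp add: image_f_inv_f bij_is_surj)
      show "inv' g ` g ` D = D" for D using b by (simp add: image_inv_f_f bij_is_inj)
      show "alt_avg (S - g ` inv' g ` D) (shift g w) x = alt_avg (S - D) (shift g w) x" for D
        using b by (simp add: image_f_inv_f bij_is_surj)
      show "inv' g ` D \<in> ?I" if "D \<in> ?I" for D
        using that image_mono[of D S "inv' g"] inv ci(2)[of D] by simp
      show "g ` D \<in> ?I" if "D \<in> ?I" for D
        using that image_mono[of D S g] gS ci(1)[of D] by simp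
    qed
    also have "\<dots> = (\<Sum>D\<in>?I. shift g (alt_avg (S - D) w) x)"
      using shift_alt_avg[OF S _ g, of _ w] by (intro sum.cong) auto
    finally show "(\<Sum>D\<in>?I. alt_avg (S - D) (shift g w) x) = shift g (\<lambda>x. \<Sum>D\<in>?I. alt_avg (S - D) w x) x"
      by (simp add: shift_def)
  qed
  show ?thesis
  proof (rule projection_frame_bound[OF finite_AltS[OF S] lin_low fI, where R = "\<lambda>D. alt_avg (S - D)"])
    show "lin_op (alt_avg (S - D))" for D :: "'a set" by (rule lin_op_alt_avg)
    show "ip ?G (alt_avg (S - D) u) w = ip ?G u (alt_avg (S - D) w)" for D u w
      by (rule ip_alt_avg[OF S]) auto
    then show "alt_avg (S - D) w \<in> low S d" if "D \<in> ?I" "w \<in> low S d" for D w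
      using that high_alt_avg[OF S, of "S - D"] Fun_alt_avg[OF S, of "S - D"] by (simp add: low_def)
    show "alt_avg (S - D) (alt_avg (S - D) w) = alt_avg (S - D) w" for D w
      using S by (intro alt_avg_absorb1) auto
    show "alt_avg (S - D) (\<lambda>x. \<Sum>D\<in>?I. alt_avg (S - D) w x)
        = (\<lambda>x. \<Sum>D'\<in>?I. alt_avg (S - D') (alt_avg (S - D) w) x)" if "D \<in> ?I" for D w
    proof -
      let ?T = "\<lambda>w x. \<Sum>D\<in>?I. alt_avg (S - D) w x"
      have linT: "lin_op ?T"
        unfolding lin_op_def
        by (auto simp: lin_op_comb[OF lin_op_alt_avg] sum.distrib sum_distrib_left fun_eq_iff)
      have avg: "alt_avg (S - D) w = (\<lambda>\<sigma>. \<Sum>g\<in>AltS (S - D). (1 / card (AltS (S - D))) * shift g w \<sigma>)" for w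
        by (simp add: alt_avg_def shift_def sum_divide_distrib)
      have fin: "finite (AltS (S - D))" using S by (intro finite_AltS) simp
      have "?T (alt_avg (S - D) w) = (\<lambda>x. \<Sum>g\<in>AltS (S - D). (1 / card (AltS (S - D))) * ?T (shift g w) x)"
        unfolding avg by (rule lin_op_sum[OF linT fin])
      also have "\<dots> = (\<lambda>x. \<Sum>g\<in>AltS (S - D). (1 / card (AltS (S - D))) * shift g (?T w) x)"
      proof
        fix x
        have "?T (shift g w) x = shift g (?T w) x" if "g \<in> AltS (S - D)" for g
          using sh[of g w] that AltS_mono[of "S - D" S] by (auto simp: fun_eq_iff)
        then show "(\<Sum>g\<in>AltS (S - D). (1 / card (AltS (S - D))) * ?T (shift g w) x)
            = (\<Sum>g\<in>AltS (S - D). (1 / card (AltS (S - D))) * shift g (?T w) x)" by simp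
      qed
      finally show ?thesis unfolding avg[of "?T w"] by simp
    qed
    show "w = (\<lambda>_. 0)" if w: "w \<in> low S d" and "\<And>D. D \<in> ?I \<Longrightarrow> alt_avg (S - D) w = (\<lambda>_. 0)" for w
    proof -
      have "w \<in> high S d" using that by (simp add: high_def low_def)
      then have "ip ?G w w = 0" using w by (simp add: low_def)
      then show ?thesis
        using w by (intro ip_self_eq_0D[OF finite_AltS[OF S]]) (auto simp: low_def Fun_def)
    qed
  qed (rule v)
qed

section \<open>Dimension of invariant spaces\<close>

lemma shift_comp: "shift (p \<circ> q) w = shift p (shift q w)"
  by (simp add: shift_def comp_assoc)

lemma shift_id [simp]: "shift id w = w"
  by (simp add: shift_def)

lemma lin_sub_eigen:
  assumes W: "lin_sub G W" and T: "lin_op T"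
  shows "lin_sub G {w \<in> W. T w = (\<lambda>x. k * w x)}"
  unfolding lin_sub_def
proof (intro conjI ballI allI impI)
  show "(\<lambda>_. 0) \<in> {w \<in> W. T w = (\<lambda>x. k * w x)}"
    by (simp add: lin_sub_zero[OF W] lin_op_zero[OF T])
  show "(\<lambda>x. a * u x + b * v x) \<in> {w \<in> W. T w = (\<lambda>x. k * w x)}"
    if "u \<in> {w \<in> W. T w = (\<lambda>x. k * w x)}" "v \<in> {w \<in> W. T w = (\<lambda>x. k * w x)}" for u v a b
    using that lin_sub_comb[OF W, of u v a b] by (simp add: lin_op_comb[OF T] algebra_simps)
  show "u x = 0" if "u \<in> {w \<in> W. T w = (\<lambda>x. k * w x)}" "x \<notin> G" for u x
    using that lin_sub_off[OF W, of u x] by simp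
qed

text \<open>A double transposition splits an invariant space into two orthogonal eigenspaces, both of
  them invariant under the permutations of the remaining points. If one of the eigenspaces
  vanishes for every double transposition, then the alternating group acts trivially.\<close>

lemma alt_invariant_dimension:
  assumes S: "finite S" and "T \<subseteq> S" and "lin_sub (AltS S) W"
    and "\<And>g w. g \<in> AltS T \<Longrightarrow> w \<in> W \<Longrightarrow> shift g w \<in> W"
    and "w0 \<in> W" "w0 \<noteq> (\<lambda>_. 0)" and "card T \<ge> L + 4 * m" and L: "L \<ge> 5"
    and "\<And>T' w. T' \<subseteq> T \<Longrightarrow> card T' \<ge> L \<Longrightarrow> w \<in> W \<Longrightarrow>
           (\<And>g. g \<in> AltS T' \<Longrightarrow> shift g w = w) \<Longrightarrow> w = (\<lambda>_. 0)"
  shows "\<exists>E. onset (AltS S) E \<and> E \<subseteq> W \<and> card E = 2 ^ m"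
  using assms(2-7,9)
proof (induction m arbitrary: T W w0)
  case 0
  have "\<exists>e\<in>W. e \<notin> {} \<and> onset (AltS S) {e}"
    using 0(4,5) by (intro onset_extend[OF finite_AltS[OF S] 0(2)]) (auto simp: onset_def)
  then obtain e where "e \<in> W" "onset (AltS S) {e}" by blast
  then show ?case by (intro exI[of _ "{e}"]) auto
next
  case (Suc m)
  let ?G = "AltS S"
  note W = Suc.prems(2) and inv = Suc.prems(3)
  have TS: "finite T" using S Suc.prems(1) finite_subset by blast
  define z where "z a b c d = transpose a b \<circ> transpose c d" for a b c d :: 'a
  define dist where "dist a b c d \<longleftrightarrow> a \<in> T \<and> b \<in> T \<and> c \<in> T \<and> d \<in> T \<and>
    a \<noteq> b \<and> a \<noteq> c \<and> a \<noteq> d \<and> b \<noteq> c \<and> b \<noteq> d \<and> c \<noteq> d" for a b c d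
  have zT: "z a b c d \<in> AltS T" if "dist a b c d" for a b c d
    unfolding z_def using that TS by (intro AltS_transposition2) (auto simp: dist_def)
  define Wp where "Wp k p = {w \<in> W. shift p w = (\<lambda>x. k * w x)}" for k p
  have Wp: "lin_sub ?G (Wp k p)" for k p
    unfolding Wp_def by (rule lin_sub_eigen[OF W lin_op_shift])
  show ?case
  proof (cases "\<exists>a b c d. dist a b c d \<and> Wp 1 (z a b c d) \<noteq> {\<lambda>_. 0} \<and> Wp (-1) (z a b c d) \<noteq> {\<lambda>_. 0}")
    case True
    then obtain a b c d where abcd: "dist a b c d"
      and ne: "Wp 1 (z a b c d) \<noteq> {\<lambda>_. 0}" "Wp (-1) (z a b c d) \<noteq> {\<lambda>_. 0}" by blast
    define p where "p = z a b c d"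
    have pT: "p \<in> AltS T" unfolding p_def by (rule zT[OF abcd])
    then have pS: "p \<in> ?G" using AltS_mono[OF Suc.prems(1)] by blast
    let ?Q = "{a, b, c, d}"
    \<comment> \<open>p moves points of Q only, so permutations of the other points commute with it
      and preserve both of its eigenspaces.\<close>
    have comm: "p \<circ> g = g \<circ> p" if g: "g \<in> AltS (T - ?Q)" for g
    proof
      fix x
      have gp: "g permutes (T - ?Q)" by (rule AltS_permutes[OF g])
      have pQ: "p permutes ?Q" unfolding p_def z_def
        by (intro permutes_compose permutes_swap_id) auto
      show "(p \<circ> g) x = (g \<circ> p) x"
      proof (cases "x \<in> ?Q")
        case True
        then have "p x \<in> ?Q" using pQ by (simp only: permutes_in_image)
        then show ?thesis using True permutes_not_in[OF gp, of x] permutes_not_in[OF gp, of "p x"] by auto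
      next
        case False
        have "g x \<notin> ?Q"
        proof (cases "x \<in> T - ?Q")
          case True
          then have "g x \<in> T - ?Q" using gp by (simp only: permutes_in_image)
          then show ?thesis by blast
        next
          case False
          then show ?thesis using permutes_not_in[OF gp, of x] \<open>x \<notin> ?Q\<close> by simp
        qed
        then show ?thesis using permutes_not_in[OF pQ, of "g x"] permutes_not_in[OF pQ False] by simp
      qed
    qed
    have "card ?Q = 4" using abcd by (simp add: dist_def)
    \<comment> \<open>Each doubling of the dimension uses up four points.\<close>
    then have cT: "card (T - ?Q) \<ge> L + 4 * m"
      using Suc.prems(6) TS abcd by (subst card_Diff_subset) (auto simp: dist_def)
    have ex: "\<exists>E. onset ?G E \<and> E \<subseteq> Wp k p \<and> card E = 2 ^ m" if k: "Wp k p \<noteq> {\<lambda>_. 0}" for k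
    proof -
      obtain u where u: "u \<in> Wp k p" "u \<noteq> (\<lambda>_. 0)"
        using k lin_sub_zero[OF Wp, of k p] by blast
      show ?thesis
      proof (rule Suc.IH[OF _ Wp _ u cT])
        show "T - ?Q \<subseteq> S" using Suc.prems(1) by blast
        show "shift g w \<in> Wp k p" if g: "g \<in> AltS (T - ?Q)" and w: "w \<in> Wp k p" for g w
        proof -
          have "shift p (shift g w) = shift g (shift p w)" by (simp add: comm[OF g] flip: shift_comp)
          also have "\<dots> = (\<lambda>x. k * shift g w x)"
            using w by (simp add: Wp_def lin_op_scale[OF lin_op_shift])
          finally show ?thesis
            using inv[of g w] AltS_mono[of "T - ?Q" T] g w by (auto simp: Wp_def)
        qed
        show "w = (\<lambda>_. 0)"
          if "T' \<subseteq> T - ?Q" "card T' \<ge> L" "w \<in> Wp k p" "\<And>g. g \<in> AltS T' \<Longrightarrow> shift g w = w" for T' w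
          using that by (intro Suc.prems(7)[of T' w]) (auto simp: Wp_def)
      qed
    qed
    obtain E1 where E1: "onset ?G E1" "E1 \<subseteq> Wp 1 p" "card E1 = 2 ^ m"
      using ex[of 1] ne by (auto simp: p_def)
    obtain E2 where E2: "onset ?G E2" "E2 \<subseteq> Wp (-1) p" "card E2 = 2 ^ m"
      using ex[of "-1"] ne by (auto simp: p_def)
    \<comment> \<open>Translation by p is an isometry, so its eigenspaces for 1 and -1 are
      orthogonal.\<close>
    have orth: "ip ?G u v = 0" if u: "u \<in> Wp 1 p" and v: "v \<in> Wp (-1) p" for u v
    proof -
      have "ip ?G u v = ip ?G (shift p u) (shift p v)" by (simp add: ip_shift[OF S pS])
      also have "\<dots> = ip ?G (\<lambda>x. 1 * u x) (\<lambda>x. (-1) * v x)" using u v by (simp add: Wp_def)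
      also have "\<dots> = - ip ?G u v" unfolding ip_scale_left ip_scale_right by simp
      finally show ?thesis by simp
    qed
    have orth': "ip ?G v u = 0" if "u \<in> Wp 1 p" "v \<in> Wp (-1) p" for u v
      using orth[OF that] by (subst ip_commute)
    have disj: "E1 \<inter> E2 = {}"
    proof (rule ccontr)
      assume "E1 \<inter> E2 \<noteq> {}"
      then obtain e where e: "e \<in> E1" "e \<in> E2" by blast
      then have "ip ?G e e = 0" using orth E1(2) E2(2) by blast
      then show False using E1(1) e by (simp add: onset_def)
    qed
    have fin: "finite E1" "finite E2" using E1 E2 by (auto simp: onset_def)
    have "ip ?G e e' = of_bool (e = e')" if ee: "e \<in> E1 \<union> E2" "e' \<in> E1 \<union> E2" for e e'
    proof -
      consider "e \<in> E1" "e' \<in> E1" | "e \<in> E2" "e' \<in> E2" | "e \<in> E1" "e' \<in> E2" | "e \<in> E2" "e' \<in> E1"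
        using ee by blast
      then show ?thesis
      proof cases
        case 3
        then have "e \<noteq> e'" using disj by blast
        then show ?thesis using 3 orth[of e e'] E1(2) E2(2) by auto
      next
        case 4
        then have "e \<noteq> e'" using disj by blast
        then show ?thesis using 4 orth'[of e' e] E1(2) E2(2) by auto
      qed (use E1(1) E2(1) in \<open>simp_all add: onset_def\<close>)
    qed
    then have "onset ?G (E1 \<union> E2)" using fin by (simp add: onset_def)
    moreover have "E1 \<union> E2 \<subseteq> W" using E1(2) E2(2) by (auto simp: Wp_def)
    moreover have "card (E1 \<union> E2) = 2 ^ Suc m"
      using card_Un_disjoint[OF fin disj] E1(3) E2(3) by simp
    ultimately show ?thesis by blast
  next
    case False
    \<comment> \<open>The double transposition is an involution, so w + k (shift w) is an
      eigenvector for k = 1 and for k = -1; if one of the two eigenspaces vanishes, the involution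
      acts as a scalar.\<close>
    have scalar: "(\<forall>w\<in>W. shift (z a b c d) w = w) \<or> (\<forall>w\<in>W. shift (z a b c d) w = (\<lambda>x. - w x))"
      if abcd: "dist a b c d" for a b c d
    proof -
      let ?p = "z a b c d"
      have pT: "?p \<in> AltS T" by (rule zT[OF abcd])
      have pp: "?p \<circ> ?p = id"
        using abcd by (auto simp: z_def dist_def transpose_def fun_eq_iff)
      have spp: "shift ?p (shift ?p w) = w" for w using pp by (simp flip: shift_comp)
      have mem: "(\<lambda>x. 1 * w x + k * shift ?p w x) \<in> Wp k ?p" if "w \<in> W" "k * k = 1" for w k
      proof -
        have "shift ?p (\<lambda>x. 1 * w x + k * shift ?p w x) = (\<lambda>x. 1 * shift ?p w x + k * w x)"
          unfolding lin_op_comb[OF lin_op_shift] spp ..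
        also have "\<dots> = (\<lambda>x. k * (1 * w x + k * shift ?p w x))"
          using that(2) by (simp add: algebra_simps fun_eq_iff flip: mult.assoc)
        finally show ?thesis
          using lin_sub_comb[OF W that(1) inv[OF pT that(1)], of 1 k] by (simp add: Wp_def)
      qed
      have "Wp 1 ?p = {\<lambda>_. 0} \<or> Wp (-1) ?p = {\<lambda>_. 0}" using False abcd by blast
      then show ?thesis
      proof
        assume *: "Wp 1 ?p = {\<lambda>_. 0}"
        have "shift ?p w = (\<lambda>x. - w x)" if "w \<in> W" for w
        proof
          fix x
          have "(\<lambda>x. 1 * w x + 1 * shift ?p w x) = (\<lambda>_. 0)" using mem[OF that, of 1] * by simp
          from fun_cong[OF this, of x] show "shift ?p w x = - w x" by simp
        qed
        then show ?thesis by blast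
      next
        assume *: "Wp (-1) ?p = {\<lambda>_. 0}"
        have "shift ?p w = w" if "w \<in> W" for w
        proof
          fix x
          have "(\<lambda>x. 1 * w x + (-1) * shift ?p w x) = (\<lambda>_. 0)" using mem[OF that, of "-1"] * by simp
          from fun_cong[OF this, of x] show "shift ?p w x = w x" by simp
        qed
        then show ?thesis by blast
      qed
    qed
    have neg_ne: "u \<noteq> (\<lambda>x. - u x)" if "u \<noteq> (\<lambda>_. 0)" for u :: "('a \<Rightarrow> 'a) \<Rightarrow> real"
    proof
      assume u: "u = (\<lambda>x. - u x)"
      have "u x = 0" for x using fun_cong[OF u, of x] by simp
      with that show False by blast
    qed
    have shift_ne: "shift g u \<noteq> (\<lambda>_. 0)" if "g \<in> AltS T" "u \<noteq> (\<lambda>_. 0)" for g u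
    proof
      assume "shift g u = (\<lambda>_. 0)"
      then have "shift (inv' g) (shift g u) = (\<lambda>_. 0)" by (simp add: shift_def)
      then show False using AltS_inv_comp[OF that(1)] that(2) by (simp flip: shift_comp)
    qed
    \<comment> \<open>The scalar -1 is impossible: the 3-cycle g on b, c, d permutes the three
      double transpositions of a, b, c, d cyclically, so all three would act as -1, yet the product
      of two of them is the third.\<close>
    have triv: "shift (z a b c d) w = w" if abcd: "dist a b c d" and w: "w \<in> W" for a b c d w
    proof (rule ccontr)
      assume "shift (z a b c d) w \<noteq> w"
      with scalar[OF abcd] w have z1: "\<And>u. u \<in> W \<Longrightarrow> shift (z a b c d) u = (\<lambda>x. - u x)" by blast
      define g where "g = transpose b c \<circ> transpose c d"
      have gT: "g \<in> AltS T" unfolding g_def using abcd TS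
        by (intro AltS_transposition2) (auto simp: dist_def)
      have neg: "\<And>u. u \<in> W \<Longrightarrow> shift q' u = (\<lambda>x. - u x)"
        if "dist a' b' c' d'" "q' = z a' b' c' d'" "g \<circ> q = q' \<circ> g"
          "\<And>u. u \<in> W \<Longrightarrow> shift q u = (\<lambda>x. - u x)" for q q' a' b' c' d'
      proof -
        let ?u = "shift g w0"
        have "shift q' ?u = shift g (shift q w0)" using that(3) by (simp flip: shift_comp)
        also have "\<dots> = (\<lambda>x. - ?u x)" using that(4)[OF Suc.prems(4)] by (simp add: shift_def)
        finally have "shift q' ?u \<noteq> ?u"
          using neg_ne[OF shift_ne[OF gT Suc.prems(5)]] by simp
        moreover have "?u \<in> W" by (rule inv[OF gT Suc.prems(4)])
        ultimately show "\<And>u. u \<in> W \<Longrightarrow> shift q' u = (\<lambda>x. - u x)"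
          using scalar[OF that(1)] that(2) by blast
      qed
      have d2: "dist a c d b" and d3: "dist a d b c" using abcd by (auto simp: dist_def)
      have "g \<circ> z a b c d = z a c d b \<circ> g"
        using abcd by (auto simp: g_def z_def dist_def transpose_def fun_eq_iff)
      from neg[OF d2 refl this z1] have z2: "\<And>u. u \<in> W \<Longrightarrow> shift (z a c d b) u = (\<lambda>x. - u x)" .
      have "g \<circ> z a c d b = z a d b c \<circ> g"
        using abcd by (auto simp: g_def z_def dist_def transpose_def fun_eq_iff)
      from neg[OF d3 refl this z2] have z3: "\<And>u. u \<in> W \<Longrightarrow> shift (z a d b c) u = (\<lambda>x. - u x)" .
      have "z a b c d \<circ> z a c d b = z a d b c"
        using abcd by (auto simp: z_def dist_def transpose_def fun_eq_iff)
      then have "shift (z a d b c) w0 = shift (z a b c d) (shift (z a c d b) w0)"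
        by (simp flip: shift_comp)
      also have "\<dots> = (\<lambda>x. - shift (z a b c d) w0 x)"
        unfolding z2[OF Suc.prems(4)] by (simp add: shift_def)
      also have "\<dots> = w0" unfolding z1[OF Suc.prems(4)] by simp
      finally show False using z3[OF Suc.prems(4)] neg_ne[OF Suc.prems(5)] by simp
    qed
    have triv2: "shift (transpose a b \<circ> transpose c d) w = w"
      if ab: "a \<in> T" "b \<in> T" "a \<noteq> b" and cd: "c \<in> T" "d \<in> T" "c \<noteq> d" and w: "w \<in> W" for a b c d w
    proof -
      have "card {a, b, c, d} \<le> 4"
        by (intro order.trans[OF card_insert_le_m1]) auto
      then have "card (T - {a, b, c, d}) \<ge> 2"
        using diff_card_le_card_Diff[of "{a,b,c,d}" T] Suc.prems(6) L by simp
      then obtain e f where ef: "e \<in> T - {a, b, c, d}" "f \<in> T - {a, b, c, d}" "e \<noteq> f"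
        using TS by (metis card_le_Suc0_iff_eq finite_Diff not_less_eq_eq numeral_2_eq_2)
      have "dist e f c d" "dist a b e f" using ab cd ef by (auto simp: dist_def)
      then have "shift (z a b e f) (shift (z e f c d) w) = w"
        using triv w by simp
      moreover have "z a b e f \<circ> z e f c d = transpose a b \<circ> transpose c d"
        by (simp add: z_def fun_eq_iff)
      ultimately show ?thesis by (simp flip: shift_comp)
    qed
    have "card T \<ge> 2" using Suc.prems(6) L by simp
    then obtain a0 b0 where a0: "a0 \<in> T" "b0 \<in> T" "a0 \<noteq> b0"
      using TS by (metis card_le_Suc0_iff_eq not_less_eq_eq numeral_2_eq_2)
    \<comment> \<open>Induction over single transpositions passes through odd permutations; these
      are made even by one fixed transposition of a0 and b0.\<close>
    have "(evenperm p \<longrightarrow> (\<forall>w\<in>W. shift p w = w)) \<and>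
      (\<not> evenperm p \<longrightarrow> (\<forall>w\<in>W. shift (transpose a0 b0 \<circ> p) w = w))" if "p permutes T" for p
      using that TS
    proof (induction rule: permutes_induct)
      case id
      show ?case by (simp add: shift_def comp_def)
    next
      case (swap a b p)
      have "permutation p" "permutation (transpose a b)"
        using swap TS permutes_swap_id permutation_permutes by metis+
      then have ev: "evenperm (transpose a b \<circ> p) \<longleftrightarrow> \<not> evenperm p"
        using swap by (simp add: evenperm_comp evenperm_swap)
      have "shift (transpose a b \<circ> p) w = w" if "\<not> evenperm p" "w \<in> W" for w
      proof -
        have "transpose a b \<circ> p = (transpose a b \<circ> transpose a0 b0) \<circ> (transpose a0 b0 \<circ> p)"
          by (simp add: fun_eq_iff)
        then have "shift (transpose a b \<circ> p) w
            = shift (transpose a b \<circ> transpose a0 b0) (shift (transpose a0 b0 \<circ> p) w)"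
          by (simp only: flip: shift_comp)
        then show ?thesis using swap that triv2[of a b a0 b0 w] a0 by simp
      qed
      moreover have "shift (transpose a0 b0 \<circ> (transpose a b \<circ> p)) w = w" if "evenperm p" "w \<in> W" for w
      proof -
        have "shift (transpose a0 b0 \<circ> (transpose a b \<circ> p)) w
            = shift (transpose a0 b0 \<circ> transpose a b) (shift p w)"
          by (simp only: comp_assoc flip: shift_comp)
        then show ?thesis using swap that triv2[of a0 b0 a b w] a0 by simp
      qed
      ultimately show ?case using ev by blast
    qed
    then have "shift g w0 = w0" if "g \<in> AltS T" for g
      using that Suc.prems(4) by (auto simp: AltS_def)
    then have "w0 = (\<lambda>_. 0)"
      using Suc.prems(4,6) by (intro Suc.prems(7)[of T w0]) auto
    with Suc.prems(5) show ?thesis by simp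
  qed
qed

text \<open>The left side is part of the squared Hilbert-Schmidt norm of F: the row of F at \<sigma>
  is the normalised indicator of B \<sigma>, its squared norm is 1 / |B|, and Bessel applies to each
  row.\<close>

lemma sum_left_avg_onset_le:
  assumes S: "finite S" and B: "B \<subseteq> AltS S" "B \<noteq> {}" and E: "onset (AltS S) E"
  shows "(\<Sum>e\<in>E. ip (AltS S) (left_avg B e) (left_avg B e)) \<le> card (AltS S) / card B"
proof -
  let ?G = "AltS S"
  have fB: "finite B" using B finite_AltS[OF S] finite_subset by blast
  have cB: "card B > 0" using fB B by (simp add: card_gt_0_iff)
  define \<phi> where "\<phi> \<sigma> \<tau> = (if \<tau> \<in> (\<lambda>b. b \<circ> \<sigma>) ` B then 1 / real (card B) else 0)"
    for \<sigma> \<tau> :: "'a \<Rightarrow> 'a"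
  have inj: "inj_on (\<lambda>b. b \<circ> \<sigma>) B" if "\<sigma> \<in> ?G" for \<sigma>
  proof (rule inj_onI)
    fix b b' assume eq: "b \<circ> \<sigma> = b' \<circ> \<sigma>"
    have "b = (b \<circ> \<sigma>) \<circ> inv' \<sigma>" "b' = (b' \<circ> \<sigma>) \<circ> inv' \<sigma>"
      using AltS_comp_inv[OF that] by (simp_all add: comp_assoc)
    with eq show "b = b'" by simp
  qed
  have sub: "(\<lambda>b. b \<circ> \<sigma>) ` B \<subseteq> ?G" if "\<sigma> \<in> ?G" for \<sigma>
    using B AltS_comp[OF S _ that] by blast
  have sum\<phi>: "(\<Sum>\<tau>\<in>?G. \<phi> \<sigma> \<tau> * h \<tau>) = (\<Sum>b\<in>B. h (b \<circ> \<sigma>)) / card B" if "\<sigma> \<in> ?G" for \<sigma> h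
  proof -
    have "(\<Sum>\<tau>\<in>?G. \<phi> \<sigma> \<tau> * h \<tau>) = (\<Sum>\<tau>\<in>(\<lambda>b. b \<circ> \<sigma>) ` B. \<phi> \<sigma> \<tau> * h \<tau>)"
      using sub[OF that] finite_AltS[OF S] by (intro sum.mono_neutral_right) (auto simp: \<phi>_def)
    also have "\<dots> = (\<Sum>b\<in>B. h (b \<circ> \<sigma>) / card B)"
      unfolding sum.reindex[OF inj[OF that]] by (intro sum.cong) (auto simp: \<phi>_def)
    finally show ?thesis by (simp add: sum_divide_distrib)
  qed
  have ip\<phi>: "ip ?G (\<phi> \<sigma>) e = left_avg B e \<sigma>" if "\<sigma> \<in> ?G" for \<sigma> e
    unfolding ip_def left_avg_def using sum\<phi>[OF that] by simp
  have norm\<phi>: "ip ?G (\<phi> \<sigma>) (\<phi> \<sigma>) = 1 / card B" if "\<sigma> \<in> ?G" for \<sigma>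
    unfolding ip\<phi>[OF that] left_avg_def using cB by (simp add: \<phi>_def)
  have "(\<Sum>e\<in>E. ip ?G (left_avg B e) (left_avg B e)) = (\<Sum>\<sigma>\<in>?G. \<Sum>e\<in>E. (left_avg B e \<sigma>)\<^sup>2)"
    unfolding ip_def by (subst sum.swap) (simp add: power2_eq_square)
  also have "\<dots> = (\<Sum>\<sigma>\<in>?G. \<Sum>e\<in>E. (ip ?G (\<phi> \<sigma>) e)\<^sup>2)"
    using ip\<phi> by simp
  also have "\<dots> \<le> (\<Sum>\<sigma>\<in>?G. ip ?G (\<phi> \<sigma>) (\<phi> \<sigma>))"
    by (intro sum_mono Bessel[OF E])
  also have "\<dots> = card ?G / card B" using norm\<phi> by simp
  finally show ?thesis .
qed

lemma high_left_avg_bound: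
  assumes S: "finite S" and B: "B \<subseteq> AltS S" "B \<noteq> {}" and m: "card S \<ge> 4 * m + 5"
    and v: "v \<in> high S (4 * m)"
  shows "ip (AltS S) (left_avg B v) (left_avg B v)
    \<le> card (AltS S) / card B / 2 ^ m * ip (AltS S) v v"
proof (cases "v = (\<lambda>_. 0)")
  case True
  then show ?thesis by (simp add: lin_op_zero[OF lin_op_left_avg])
next
  case False
  let ?G = "AltS S"
  define W where "W = high S (4 * m)"
  define T where "T w = left_avg_inv B (left_avg B w)" for w
  have W: "lin_sub ?G W" unfolding W_def by (rule lin_sub_high)
  have Tlin: "lin_op T"
    by (simp add: lin_op_def T_def lin_op_comb[OF lin_op_left_avg] lin_op_comb[OF lin_op_left_avg_inv])
  have ipT: "ip ?G (T u) w = ip ?G (left_avg B u) (left_avg B w)" for u w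
    using ip_left_avg[OF S B(1), of w "left_avg B u"] by (simp add: T_def ip_commute)
  have ipT': "ip ?G u (T w) = ip ?G (left_avg B u) (left_avg B w)" for u w
    using ip_left_avg[OF S B(1), of u "left_avg B w"] by (simp add: T_def)
  have TW: "T w \<in> W" if "w \<in> W" for w
    using that high_left_avg[OF S B(1)] high_left_avg_inv[OF S B(1)] by (simp add: T_def W_def)
  have vW: "v \<in> W" using v by (simp add: W_def)
  have "\<exists>l u. u \<in> W \<and> ip ?G u u = 1 \<and> T u = (\<lambda>x. l * u x) \<and>
      (\<forall>w\<in>W. ip ?G (T w) w \<le> l * ip ?G w w)"
    by (rule top_eigenvector[OF finite_AltS[OF S] W vW False Tlin TW])
       (simp_all only: ipT ipT')
  then obtain l u where u: "u \<in> W" "ip ?G u u = 1" "T u = (\<lambda>x. l * u x)"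
    and bd: "\<And>w. w \<in> W \<Longrightarrow> ip ?G (T w) w \<le> l * ip ?G w w" by blast
  let ?Y = "{w \<in> W. T w = (\<lambda>x. l * w x)}"
  have "\<exists>E. onset ?G E \<and> E \<subseteq> ?Y \<and> card E = 2 ^ m"
  proof (rule alt_invariant_dimension[OF S order.refl, where L = "card S - 4 * m" and ?w0.0 = u])
    show "lin_sub ?G ?Y" by (rule lin_sub_eigen[OF W Tlin])
    show "shift g w \<in> ?Y" if "g \<in> ?G" "w \<in> ?Y" for g w
      using that high_shift[OF S that(1), of w]
      by (simp add: W_def T_def left_avg_shift left_avg_inv_shift lin_op_scale[OF lin_op_shift])
    show "u \<in> ?Y" using u by simp
    show "u \<noteq> (\<lambda>_. 0)" using u(2) by auto
    show "card S - 4 * m + 4 * m \<le> card S" using m by simp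
    show "5 \<le> card S - 4 * m" using m by simp
    \<comment> \<open>A function invariant under all even permutations of at least |S| - 4 m points
      depends on at most 4 m values, so it vanishes in \<open>high S (4 * m)\<close>.\<close>
    show "w = (\<lambda>_. 0)" if T': "T' \<subseteq> S" "card S - 4 * m \<le> card T'" and w: "w \<in> ?Y"
      and fix': "\<And>g. g \<in> AltS T' \<Longrightarrow> shift g w = w" for T' w
    proof -
      have fT: "finite T'" using S T' finite_subset by blast
      obtain C where C: "C \<subseteq> T'" "card C = card S - 4 * m" "finite C"
        using T'(2) by (rule obtain_subset_with_card_n)
      have CS: "C \<subseteq> S" using C T' by blast
      have "card (S - C) = 4 * m" using C CS S m by (simp add: card_Diff_subset)
      then have "alt_avg (S - (S - C)) w = (\<lambda>_. 0)"
        using w by (intro highD[of w S "4 * m"]) (auto simp: W_def)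
      moreover have "S - (S - C) = C" using CS by blast
      moreover have "alt_avg C w = w"
      proof
        fix \<sigma>
        have "w (\<sigma> \<circ> g) = w \<sigma>" if "g \<in> AltS C" for g
          using fix'[of g] that AltS_mono[OF C(1)] by (auto simp: shift_def fun_eq_iff)
        then show "alt_avg C w \<sigma> = w \<sigma>" using card_AltS_pos[OF C(3)] by (simp add: alt_avg_def)
      qed
      ultimately show ?thesis by simp
    qed
  qed
  then obtain E where E: "onset ?G E" "E \<subseteq> ?Y" "card E = 2 ^ m" by blast
  have "l * 2 ^ m = (\<Sum>e\<in>E. ip ?G (left_avg B e) (left_avg B e))"
  proof -
    have "ip ?G (left_avg B e) (left_avg B e) = l" if "e \<in> E" for e
    proof -
      have "T e = (\<lambda>x. l * e x)" "ip ?G e e = 1" using E that by (auto simp: onset_def)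
      then show ?thesis using ipT[of e e] by (simp add: ip_scale_left)
    qed
    then show ?thesis using E(3) by simp
  qed
  also have "\<dots> \<le> card ?G / card B" by (rule sum_left_avg_onset_le[OF S B E(1)])
  finally have "l \<le> card ?G / card B / 2 ^ m" by (subst pos_le_divide_eq) simp_all
  then have "l * ip ?G v v \<le> card ?G / card B / 2 ^ m * ip ?G v v"
    by (rule mult_right_mono) (rule ip_nonneg)
  moreover have "ip ?G (left_avg B v) (left_avg B v) \<le> l * ip ?G v v"
    using bd[of v] v by (simp add: ipT W_def)
  ultimately show ?thesis by linarith
qed

section \<open>Agreement weights\<close>

text \<open>For $X$ uniform on \<open>B\<close> and $|D| = d$, \<open>agreement_weight S B D\<close> is the squared norm of the part
  of the law of $X|_D$ that has mean zero in each coordinate, relative to the product measure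
  on $S^D$.\<close>

definition agreement_weight :: "'a set \<Rightarrow> ('a \<Rightarrow> 'a) set \<Rightarrow> 'a set \<Rightarrow> real" where
  "agreement_weight S B D =
     (\<Sum>b\<in>B. \<Sum>b'\<in>B. \<Prod>x\<in>D. real (card S) * of_bool (b x = b' x) - 1) / (card B)\<^sup>2"

definition mean_weight :: "'a set \<Rightarrow> ('a \<Rightarrow> 'a) set \<Rightarrow> nat \<Rightarrow> real" where
  "mean_weight S B d =
     (\<Sum>D | D \<subseteq> S \<and> card D = d. agreement_weight S B D) / (card S choose d)"

text \<open>The density of the centred law of X on D with respect to the uniform measure on the maps
  from D to S.\<close>

definition centered_law :: "'a set \<Rightarrow> ('a \<Rightarrow> 'a) set \<Rightarrow> 'a set \<Rightarrow> ('a \<Rightarrow> 'a) \<Rightarrow> real" where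
  "centered_law S B D w = (\<Sum>b\<in>B. \<Prod>x\<in>D. real (card S) * of_bool (b x = w x) - 1) / card B"

text \<open>Writing the weight as a sum of squares shows that it is nonnegative, although single
  pairs of permutations contribute with either sign.\<close>

lemma agreement_weight_eq:
  assumes S: "finite S" "S \<noteq> {}" and B: "B \<subseteq> AltS S" and D: "D \<subseteq> S"
  shows "agreement_weight S B D
    = (\<Sum>w\<in>D \<rightarrow>\<^sub>E S. (centered_law S B D w)\<^sup>2) / real (card S) ^ card D"
proof -
  let ?N = "real (card S)"
  let ?p = "\<lambda>b w. \<Prod>x\<in>D. ?N * of_bool (b x = w x) - 1"
  have fD: "finite D" using S D finite_subset by blast
  have N: "?N > 0" using S by (simp add: card_gt_0_iff)
  \<comment> \<open>The kernel N [p = y] - 1 reproduces itself under averaging over y in S.\<close>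
  have one: "(\<Sum>y\<in>S. (?N * of_bool (p = y) - 1) * (?N * of_bool (q = y) - 1))
      = ?N * (?N * of_bool (p = q) - 1)" if "p \<in> S" "q \<in> S" for p q
  proof -
    have "(\<Sum>y\<in>S. (?N * of_bool (p = y) - 1) * (?N * of_bool (q = y) - 1))
        = (\<Sum>y\<in>S. ?N\<^sup>2 * of_bool (p = q) * of_bool (p = y) - ?N * of_bool (p = y)
            - ?N * of_bool (q = y) + 1)"
      by (intro sum.cong refl) (auto simp: power2_eq_square algebra_simps)
    also have "\<dots> = ?N\<^sup>2 * of_bool (p = q) * (\<Sum>y\<in>S. of_bool (p = y))
        - ?N * (\<Sum>y\<in>S. of_bool (p = y)) - ?N * (\<Sum>y\<in>S. of_bool (q = y)) + ?N"
      by (simp add: sum.distrib sum_subtractf sum_distrib_left)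
    also have "(\<Sum>y\<in>S. of_bool (p = y)) = (1::real)" using that S by simp
    also have "(\<Sum>y\<in>S. of_bool (q = y)) = (1::real)" using that S by simp
    finally show ?thesis by (simp add: power2_eq_square algebra_simps)
  qed
  have prod: "(\<Sum>w\<in>D \<rightarrow>\<^sub>E S. ?p b w * ?p b' w)
      = ?N ^ card D * (\<Prod>x\<in>D. ?N * of_bool (b x = b' x) - 1)" if "b \<in> B" "b' \<in> B" for b b'
  proof -
    have "(\<Sum>w\<in>D \<rightarrow>\<^sub>E S. ?p b w * ?p b' w)
        = (\<Sum>w\<in>D \<rightarrow>\<^sub>E S. \<Prod>x\<in>D. (?N * of_bool (b x = w x) - 1) * (?N * of_bool (b' x = w x) - 1))"
      by (simp add: prod.distrib)
    also have "\<dots> = (\<Prod>x\<in>D. \<Sum>y\<in>S. (?N * of_bool (b x = y) - 1) * (?N * of_bool (b' x = y) - 1))"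
      using S by (intro prod_sum_PiE[OF fD, symmetric]) simp
    also have "\<dots> = (\<Prod>x\<in>D. ?N * (?N * of_bool (b x = b' x) - 1))"
    proof (intro prod.cong refl one)
      fix x assume "x \<in> D"
      then have xS: "x \<in> S" using D by blast
      have "b permutes S" "b' permutes S" using that B AltS_permutes by blast+
      then show "b x \<in> S" "b' x \<in> S" using xS by (simp_all add: permutes_in_image)
    qed
    finally show ?thesis by (simp add: prod.distrib)
  qed
  have "(\<Sum>w\<in>D \<rightarrow>\<^sub>E S. (centered_law S B D w)\<^sup>2)
      = (\<Sum>w\<in>D \<rightarrow>\<^sub>E S. (\<Sum>b\<in>B. \<Sum>b'\<in>B. ?p b w * ?p b' w) / (card B)\<^sup>2)"
    by (simp add: centered_law_def power_divide power2_eq_square sum_product)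
  also have "\<dots> = (\<Sum>b\<in>B. \<Sum>b'\<in>B. \<Sum>w\<in>D \<rightarrow>\<^sub>E S. ?p b w * ?p b' w) / (card B)\<^sup>2"
    unfolding sum_divide_distrib[symmetric]
    by (subst sum.swap, subst (2) sum.swap) simp
  also have "\<dots> = (\<Sum>b\<in>B. \<Sum>b'\<in>B. ?N ^ card D * (\<Prod>x\<in>D. ?N * of_bool (b x = b' x) - 1)) / (card B)\<^sup>2"
    using prod by simp
  also have "\<dots> = ?N ^ card D * agreement_weight S B D"
    by (simp add: agreement_weight_def sum_distrib_left)
  finally show ?thesis using N by simp
qed

lemma agreement_weight_nonneg:
  assumes "finite S" "S \<noteq> {}" "B \<subseteq> AltS S" "D \<subseteq> S"
  shows "0 \<le> agreement_weight S B D"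
  unfolding agreement_weight_eq[OF assms] by (simp add: sum_nonneg)

lemma mean_weight_nonneg:
  assumes "finite S" "S \<noteq> {}" "B \<subseteq> AltS S"
  shows "0 \<le> mean_weight S B d"
  unfolding mean_weight_def
  using agreement_weight_nonneg[OF assms] by (intro divide_nonneg_nonneg sum_nonneg) auto

text \<open>By transitivity the sum over g is the same for every C of the size of D; summing over C
  and exchanging the sums evaluates it.\<close>

lemma sum_AltS_image:
  fixes f :: "'a set \<Rightarrow> real"
  assumes S: "finite S" and D: "D \<subseteq> S" "card D + 2 \<le> card S"
  shows "(\<Sum>g\<in>AltS S. f (g ` D)) * real (card S choose card D)
    = card (AltS S) * (\<Sum>C | C \<subseteq> S \<and> card C = card D. f C)"
proof -
  let ?I = "{C. C \<subseteq> S \<and> card C = card D}"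
  have 1: "(\<Sum>g\<in>AltS S. f (g ` C)) = (\<Sum>g\<in>AltS S. f (g ` D))" if C: "C \<in> ?I" for C
  proof -
    obtain h where h: "h \<in> AltS S" "h ` D = C"
      using AltS_transitive_sets[OF S D(1), of C] C D(2) by auto
    then have "(\<Sum>g\<in>AltS S. f (g ` C)) = (\<Sum>g\<in>AltS S. f ((g \<circ> h) ` D))"
      by (simp add: image_comp flip: image_image)
    also have "\<dots> = (\<Sum>g\<in>AltS S. f (g ` D))"
      by (rule sum_AltS_right[OF S h(1), of "\<lambda>g. f (g ` D)"])
    finally show ?thesis .
  qed
  have 2: "(\<Sum>C\<in>?I. f (g ` C)) = (\<Sum>C\<in>?I. f C)" if g: "g \<in> AltS S" for g
  proof (rule sum.reindex_bij_witness[where i = "\<lambda>C. inv' g ` C" and j = "\<lambda>C. g ` C"])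
    have b: "bij g" by (rule AltS_bij[OF g])
    have gS: "g ` S = S" using AltS_permutes[OF g] by (rule permutes_image)
    have inv: "inv' g ` S = S" using AltS_permutes[OF AltS_inv[OF S g]] by (rule permutes_image)
    have ci: "card (g ` D) = card D" "card (inv' g ` D) = card D" for D
      using b bij_imp_bij_inv[OF b] by (metis bij_is_inj card_image inj_on_subset subset_UNIV)+
    show "inv' g ` g ` C = C" for C using b by (simp add: image_inv_f_f bij_is_inj)
    show "g ` inv' g ` C = C" for C using b by (simp add: image_f_inv_f bij_is_surj)
    show "g ` C \<in> ?I" if "C \<in> ?I" for C
      using that image_mono[of C S g] gS ci(1)[of C] by simp
    show "inv' g ` C \<in> ?I" if "C \<in> ?I" for C
      using that image_mono[of C S "inv' g"] inv ci(2)[of C] by simp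
  qed simp
  have "real (card ?I) * (\<Sum>g\<in>AltS S. f (g ` D)) = (\<Sum>C\<in>?I. \<Sum>g\<in>AltS S. f (g ` C))"
    using 1 by simp
  also have "\<dots> = (\<Sum>g\<in>AltS S. \<Sum>C\<in>?I. f (g ` C))" by (rule sum.swap)
  also have "\<dots> = card (AltS S) * (\<Sum>C\<in>?I. f C)" using 2 by simp
  also have "card ?I = card S choose card D" by (rule n_subsets[OF S])
  finally show ?thesis by (simp add: mult.commute)
qed

lemma sum_AltS_weight:
  assumes S: "finite S" and D: "D \<subseteq> S" "card D + 2 \<le> card S"
  shows "(\<Sum>g\<in>AltS S. agreement_weight S B (g ` D)) = card (AltS S) * mean_weight S B (card D)"
proof -
  have "real (card S choose card D) > 0" using D(2) by simp
  then show ?thesis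
    using sum_AltS_image[OF S D, of "agreement_weight S B"]
    by (simp add: mean_weight_def field_simps)
qed

text \<open>At most \<open>card (AltS (S - D))\<close> even permutations share a restriction to D,
  and maps that are not such restrictions only add nonnegative terms. This trades permutations for a
  product space, on which sums of products factor.\<close>

lemma sum_AltS_restrict_le:
  fixes F :: "('a \<Rightarrow> 'a) \<Rightarrow> real"
  assumes S: "finite S" and D: "D \<subseteq> S" and F: "\<And>w. F w \<ge> 0"
  shows "(\<Sum>h\<in>AltS S. F (restrict h D)) \<le> card (AltS (S - D)) * (\<Sum>w\<in>D \<rightarrow>\<^sub>E S. F w)"
proof -
  have fD: "finite D" using S D finite_subset by blast
  have "(\<Sum>h\<in>AltS S. F (restrict h D))
      = (\<Sum>w\<in>D \<rightarrow>\<^sub>E S. \<Sum>h | h \<in> AltS S \<and> restrict h D = w. F (restrict h D))"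
  proof (rule sum.group[symmetric])
    show "finite (AltS S)" by (rule finite_AltS[OF S])
    show "finite (D \<rightarrow>\<^sub>E S)" using fD S by (simp add: finite_PiE)
    show "(\<lambda>h. restrict h D) ` AltS S \<subseteq> D \<rightarrow>\<^sub>E S"
    proof (intro image_subsetI PiE_I)
      fix h x assume "h \<in> AltS S" "x \<in> D"
      then show "restrict h D x \<in> S"
        using D permutes_in_image[OF AltS_permutes, of h S x] by auto
    qed auto
  qed
  also have "\<dots> = (\<Sum>w\<in>D \<rightarrow>\<^sub>E S. card {h \<in> AltS S. restrict h D = w} * F w)"
    by (intro sum.cong refl) simp
  also have "\<dots> \<le> (\<Sum>w\<in>D \<rightarrow>\<^sub>E S. card (AltS (S - D)) * F w)"
  proof (intro sum_mono mult_right_mono F)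
    fix w
    have "{h \<in> AltS S. restrict h D = w} \<subseteq> {h \<in> AltS S. \<forall>x\<in>D. h x = w x}" by auto
    then have "card {h \<in> AltS S. restrict h D = w} \<le> card {h \<in> AltS S. \<forall>x\<in>D. h x = w x}"
      using finite_AltS[OF S] by (intro card_mono) auto
    also have "\<dots> \<le> card (AltS (S - D))" by (rule card_AltS_fiber_le[OF S D])
    finally show "real (card {h \<in> AltS S. restrict h D = w}) \<le> real (card (AltS (S - D)))" by simp
  qed
  finally show ?thesis by (simp add: sum_distrib_left)
qed

text \<open>Expanding the product over X \<subseteq> D yields, up to factors, the averages of v over
  the stabilizers of X; all of them vanish by purity except the one for X = D.\<close>

lemma pure_function_reproducing:
  assumes S: "finite S" and D: "D \<subseteq> S" and v: "alt_avg (S - D) v = v"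
    and pure: "\<And>C. C \<subset> D \<Longrightarrow> alt_avg (S - C) v = (\<lambda>_. 0)" and \<tau>: "\<tau> \<in> AltS S"
  shows "(\<Sum>g\<in>AltS S. v g * (\<Prod>i\<in>D. real (card S) * of_bool (g i = \<tau> i) - 1))
    = real (card S) ^ card D * card (AltS (S - D)) * v \<tau>"
proof -
  let ?N = "real (card S)" and ?G = "AltS S"
  have fD: "finite D" using S D finite_subset by blast
  have fiber: "(\<Sum>g\<in>?G. v g * (\<Prod>i\<in>X. ?N * of_bool (g i = \<tau> i)))
      = ?N ^ card X * card (AltS (S - X)) * alt_avg (S - X) v \<tau>" if X: "X \<subseteq> D" for X
  proof -
    have XS: "X \<subseteq> S" using X D by blast
    have fX: "finite X" using X fD finite_subset by blast
    have "(\<Prod>i\<in>X. ?N * of_bool (g i = \<tau> i)) = ?N ^ card X * of_bool (\<forall>i\<in>X. g i = \<tau> i)" for g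
      using fX by (auto simp: prod.distrib)
    then have "(\<Sum>g\<in>?G. v g * (\<Prod>i\<in>X. ?N * of_bool (g i = \<tau> i)))
        = (\<Sum>g\<in>?G. if \<forall>i\<in>X. g i = \<tau> i then ?N ^ card X * v g else 0)"
      by (intro sum.cong) auto
    also have "\<dots> = (\<Sum>g\<in>{g \<in> ?G. \<forall>i\<in>X. g i = \<tau> i}. ?N ^ card X * v g)"
      using finite_AltS[OF S] by (rule sum.inter_filter[symmetric])
    also have "\<dots> = (\<Sum>u\<in>AltS (S - X). ?N ^ card X * v (\<tau> \<circ> u))"
      unfolding AltS_fiber[OF S XS \<tau>]
      by (subst sum.reindex[OF inj_on_comp_left[OF AltS_bij[OF \<tau>]]]) simp
    also have "\<dots> = ?N ^ card X * (\<Sum>u\<in>AltS (S - X). v (\<tau> \<circ> u))"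
      by (rule sum_distrib_left[symmetric])
    also have "(\<Sum>u\<in>AltS (S - X). v (\<tau> \<circ> u)) = card (AltS (S - X)) * alt_avg (S - X) v \<tau>"
      using card_AltS_pos[of "S - X"] S by (simp add: alt_avg_def)
    finally show ?thesis by simp
  qed
  have "(\<Prod>i\<in>D. ?N * of_bool (g i = \<tau> i) - 1)
      = (\<Sum>X\<in>Pow D. (-1) ^ card (D - X) * (\<Prod>i\<in>X. ?N * of_bool (g i = \<tau> i)))" for g
    using prod_add[OF fD, of "\<lambda>i. ?N * of_bool (g i = \<tau> i)" "\<lambda>_. -1"] by (simp add: mult.commute)
  then have "(\<Sum>g\<in>?G. v g * (\<Prod>i\<in>D. ?N * of_bool (g i = \<tau> i) - 1))
      = (\<Sum>g\<in>?G. \<Sum>X\<in>Pow D. (-1) ^ card (D - X) * (v g * (\<Prod>i\<in>X. ?N * of_bool (g i = \<tau> i))))"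
    by (simp add: sum_distrib_left mult.left_commute)
  also have "\<dots> = (\<Sum>X\<in>Pow D. (-1) ^ card (D - X) * (\<Sum>g\<in>?G. v g * (\<Prod>i\<in>X. ?N * of_bool (g i = \<tau> i))))"
    by (subst sum.swap) (simp add: sum_distrib_left)
  also have "\<dots> = (\<Sum>X\<in>Pow D. (-1) ^ card (D - X) *
      (?N ^ card X * card (AltS (S - X)) * alt_avg (S - X) v \<tau>))"
    using fiber by (intro sum.cong) auto
  also have "\<dots> = (\<Sum>X\<in>{D}. (-1) ^ card (D - X) *
      (?N ^ card X * card (AltS (S - X)) * alt_avg (S - X) v \<tau>))"
  proof (rule sum.mono_neutral_right)
    show "\<forall>X\<in>Pow D - {D}. (-1) ^ card (D - X) *
        (?N ^ card X * card (AltS (S - X)) * alt_avg (S - X) v \<tau>) = 0"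
      using pure by (auto simp: psubset_eq)
  qed (use fD in auto)
  finally show ?thesis using v by simp
qed

lemma fact_ratio_le_power:
  assumes "d \<le> n"
  shows "fact n / fact (n - d) \<le> real n ^ d"
proof -
  have "fact n / fact (n - d) = real (fact n div fact (n - d))"
    by (simp add: real_of_nat_div fact_dvd)
  also have "\<dots> \<le> real (n ^ d)"
    using fact_div_fact_le_pow[OF assms] by (simp only: of_nat_le_iff)
  finally show ?thesis by simp
qed

text \<open>The reproducing identity at b o \<sigma>, averaged over b, writes F v at \<sigma> as an
  inner product of v with the centred law of B on the image of D; Cauchy-Schwarz leaves the squared
  norm of that law, which is the agreement weight.\<close>

lemma pure_function_left_avg:
  assumes S: "finite S" and D: "D \<subseteq> S" "card D + 2 \<le> card S" and B: "B \<subseteq> AltS S" "B \<noteq> {}"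
    and v: "alt_avg (S - D) v = v"
    and pure: "\<And>C. C \<subset> D \<Longrightarrow> alt_avg (S - C) v = (\<lambda>_. 0)" and \<sigma>: "\<sigma> \<in> AltS S"
  shows "(left_avg B v \<sigma>)\<^sup>2 \<le> agreement_weight S B (\<sigma> ` D) * ip (AltS S) v v / card (AltS S)"
proof -
  let ?N = "real (card S)" and ?G = "AltS S" and ?d = "card D"
  define E where "E = \<sigma> ` D"
  have b: "bij \<sigma>" by (rule AltS_bij[OF \<sigma>])
  have i\<sigma>: "inv' \<sigma> \<in> ?G" by (rule AltS_inv[OF S \<sigma>])
  have ES: "E \<subseteq> S"
    using D(1) AltS_permutes[OF \<sigma>] unfolding E_def by (metis image_mono permutes_image)
  have cE: "card E = ?d"
    unfolding E_def using b by (metis bij_is_inj card_image inj_on_subset subset_UNIV)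
  have fB: "finite B" using B finite_AltS[OF S] finite_subset by blast
  have cB: "card B > 0" using fB B by (simp add: card_gt_0_iff)
  have Sne: "S \<noteq> {}" using D(2) by auto
  have N: "?N > 0" using S Sne by (simp add: card_gt_0_iff)
  define u where "u = real (card (AltS (S - D)))"
  have u: "u > 0" unfolding u_def using card_AltS_pos[of "S - D"] S by simp
  have ratio: "card ?G = fact (card S) / fact (card S - ?d) * u"
    unfolding u_def by (rule card_AltS_ratio[OF S D])
  have uE: "real (card (AltS (S - E))) = u"
    using card_AltS_ratio[OF S ES] D(2) ratio unfolding cE by simp
  define P where "P g = (\<Sum>b\<in>B. \<Prod>i\<in>D. ?N * of_bool (b (\<sigma> i) = g i) - 1) / card B" for g :: "'a \<Rightarrow> 'a"
  have "?N ^ ?d * u * left_avg B v \<sigma> = (\<Sum>b\<in>B. (?N ^ ?d * u * v (b \<circ> \<sigma>))) / card B"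
    by (simp add: left_avg_def sum_distrib_left)
  also have "\<dots> = (\<Sum>b\<in>B. \<Sum>g\<in>?G. v g * (\<Prod>i\<in>D. ?N * of_bool (b (\<sigma> i) = g i) - 1)) / card B"
  proof -
    have "?N ^ ?d * u * v (b \<circ> \<sigma>) = (\<Sum>g\<in>?G. v g * (\<Prod>i\<in>D. ?N * of_bool (b (\<sigma> i) = g i) - 1))"
      if "b \<in> B" for b
    proof -
      have "b \<circ> \<sigma> \<in> ?G" using that B AltS_comp[OF S _ \<sigma>] by blast
      from pure_function_reproducing[OF S D(1) v pure this] show ?thesis
        by (simp add: u_def eq_commute[of _ "b (\<sigma> _)"])
    qed
    then show ?thesis by simp
  qed
  also have "\<dots> = (\<Sum>g\<in>?G. v g * P g)"
    unfolding P_def by (subst sum.swap) (simp add: sum_distrib_left sum_divide_distrib)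
  finally have eq: "?N ^ ?d * u * left_avg B v \<sigma> = (\<Sum>g\<in>?G. v g * P g)" .
  have PC: "P g = centered_law S B E (restrict (g \<circ> inv' \<sigma>) E)" for g
  proof -
    have "(\<Prod>x\<in>E. ?N * of_bool (b x = restrict (g \<circ> inv' \<sigma>) E x) - 1)
        = (\<Prod>i\<in>D. ?N * of_bool (b (\<sigma> i) = g i) - 1)" for b
      unfolding E_def using b
      by (subst prod.reindex[OF inj_on_subset[OF bij_is_inj[OF b] subset_UNIV]])
         (simp add: bij_is_inj inv_f_f)
    then show ?thesis by (simp add: P_def centered_law_def)
  qed
  have "(\<Sum>g\<in>?G. (P g)\<^sup>2) = (\<Sum>h\<in>?G. (centered_law S B E (restrict h E))\<^sup>2)"
    unfolding PC by (rule sum_AltS_right[OF S i\<sigma>, of "\<lambda>h. (centered_law S B E (restrict h E))\<^sup>2"])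
  also have "\<dots> \<le> card (AltS (S - E)) * (\<Sum>w\<in>E \<rightarrow>\<^sub>E S. (centered_law S B E w)\<^sup>2)"
    by (rule sum_AltS_restrict_le[OF S ES]) simp
  also have "\<dots> = u * (?N ^ ?d * agreement_weight S B E)"
    unfolding agreement_weight_eq[OF S Sne B(1) ES] cE uE using N by simp
  finally have Psq: "(\<Sum>g\<in>?G. (P g)\<^sup>2) \<le> u * (?N ^ ?d * agreement_weight S B E)" .
  have "(?N ^ ?d * u * left_avg B v \<sigma>)\<^sup>2 \<le> ip ?G v v * (\<Sum>g\<in>?G. (P g)\<^sup>2)"
    unfolding eq using Cauchy_Schwarz_ineq_sum[of v P ?G] by (simp add: ip_def power2_eq_square)
  also have "\<dots> \<le> ip ?G v v * (u * (?N ^ ?d * agreement_weight S B E))"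
    by (rule mult_left_mono[OF Psq ip_nonneg])
  finally have "(?N ^ ?d * u) * ((?N ^ ?d * u) * (left_avg B v \<sigma>)\<^sup>2)
      \<le> (?N ^ ?d * u) * (agreement_weight S B E * ip ?G v v)"
    by (simp add: power2_eq_square algebra_simps)
  then have main: "(?N ^ ?d * u) * (left_avg B v \<sigma>)\<^sup>2 \<le> agreement_weight S B E * ip ?G v v"
    using mult_le_cancel_left_pos[of "?N ^ ?d * u"] N u by simp
  have "fact (card S) / fact (card S - ?d) \<le> ?N ^ ?d"
    using D(2) by (intro fact_ratio_le_power) simp
  then have "card ?G \<le> ?N ^ ?d * u" unfolding ratio using u by (intro mult_right_mono) simp_all
  then have "card ?G * (left_avg B v \<sigma>)\<^sup>2 \<le> (?N ^ ?d * u) * (left_avg B v \<sigma>)\<^sup>2"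
    by (rule mult_right_mono) simp
  also note main
  finally show ?thesis
    using card_AltS_pos[OF S] by (simp add: E_def field_simps)
qed

text \<open>Summing the pointwise bound over \<sigma> makes the image of D run uniformly over all
  sets of its size.\<close>

lemma pure_function_left_avg_norm:
  assumes S: "finite S" and D: "D \<subseteq> S" "card D + 2 \<le> card S" and B: "B \<subseteq> AltS S" "B \<noteq> {}"
    and v: "alt_avg (S - D) v = v"
    and pure: "\<And>C. C \<subset> D \<Longrightarrow> alt_avg (S - C) v = (\<lambda>_. 0)"
  shows "ip (AltS S) (left_avg B v) (left_avg B v) \<le> mean_weight S B (card D) * ip (AltS S) v v"
proof -
  let ?G = "AltS S"
  have "ip ?G (left_avg B v) (left_avg B v) = (\<Sum>\<sigma>\<in>?G. (left_avg B v \<sigma>)\<^sup>2)"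
    by (simp add: ip_def power2_eq_square)
  also have "\<dots> \<le> (\<Sum>\<sigma>\<in>?G. agreement_weight S B (\<sigma> ` D) * ip ?G v v / card ?G)"
    by (intro sum_mono pure_function_left_avg[OF S D B v pure])
  also have "\<dots> = (\<Sum>\<sigma>\<in>?G. agreement_weight S B (\<sigma> ` D)) * (ip ?G v v / card ?G)"
    by (simp add: sum_distrib_right sum_divide_distrib)
  also have "\<dots> = mean_weight S B (card D) * ip ?G v v"
    unfolding sum_AltS_weight[OF S D] using card_AltS_pos[OF S] by simp
  finally show ?thesis .
qed

section \<open>The alternating walk\<close>

text \<open>F (F^* F)^k. With F as the outermost operator, a function supported in B is carried to
  one supported in products of factors b^(-1) b'.\<close>

definition walk :: "('a \<Rightarrow> 'a) set \<Rightarrow> nat \<Rightarrow> (('a \<Rightarrow> 'a) \<Rightarrow> real) \<Rightarrow> ('a \<Rightarrow> 'a) \<Rightarrow> real" where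
  "walk B k v = left_avg B (((\<lambda>w. left_avg_inv B (left_avg B w)) ^^ k) v)"

lemma funpow_mem: "(\<And>w. w \<in> M \<Longrightarrow> T w \<in> M) \<Longrightarrow> v \<in> M \<Longrightarrow> (T ^^ k) v \<in> M"
  by (induction k) auto

lemma lin_op_funpow: "lin_op T \<Longrightarrow> lin_op (T ^^ k)"
  by (induction k) (auto simp: lin_op_def)

lemma lin_op_walk: "lin_op (walk B k)"
proof -
  have "lin_op (\<lambda>w. left_avg_inv B (left_avg B w))"
    by (simp add: lin_op_def lin_op_comb[OF lin_op_left_avg] lin_op_comb[OF lin_op_left_avg_inv])
  from lin_op_funpow[OF this, of k] show ?thesis
    by (simp add: walk_def lin_op_def lin_op_comb[OF lin_op_left_avg])
qed

lemma walk_mem: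
  assumes "\<And>w. w \<in> M \<Longrightarrow> left_avg B w \<in> M" "\<And>w. w \<in> M \<Longrightarrow> left_avg_inv B w \<in> M" "v \<in> M"
  shows "walk B k v \<in> M"
  unfolding walk_def by (intro assms(1) funpow_mem) (use assms in auto)

lemma walk_alt_avg: "walk B k (alt_avg T v) = alt_avg T (walk B k v)"
proof -
  have "((\<lambda>w. left_avg_inv B (left_avg B w)) ^^ k) (alt_avg T v)
      = alt_avg T (((\<lambda>w. left_avg_inv B (left_avg B w)) ^^ k) v)"
    by (induction k) (simp_all add: left_avg_alt_avg left_avg_inv_alt_avg)
  then show ?thesis by (simp add: walk_def left_avg_alt_avg)
qed

text \<open>The adjoint satisfies the same bound on M because |F^* w|^2 = <F F^* w, w>; the walk is
  composed of 2 k + 1 operators.\<close>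

lemma walk_norm:
  assumes S: "finite S" and B: "B \<subseteq> AltS S"
    and M: "\<And>w. w \<in> M \<Longrightarrow> left_avg B w \<in> M" "\<And>w. w \<in> M \<Longrightarrow> left_avg_inv B w \<in> M"
    and l: "l \<ge> 0"
    and bd: "\<And>w. w \<in> M \<Longrightarrow> ip (AltS S) (left_avg B w) (left_avg B w) \<le> l * ip (AltS S) w w"
    and v: "v \<in> M"
  shows "ip (AltS S) (walk B k v) (walk B k v) \<le> l ^ (2 * k + 1) * ip (AltS S) v v"
proof -
  let ?G = "AltS S"
  have bd': "ip ?G (left_avg_inv B w) (left_avg_inv B w) \<le> l * ip ?G w w" if w: "w \<in> M" for w
  proof -
    let ?y = "left_avg_inv B w"
    have "ip ?G ?y ?y = ip ?G (left_avg B ?y) w"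
      using ip_left_avg[OF S B, of ?y w] by simp
    then have "(ip ?G ?y ?y)\<^sup>2 \<le> ip ?G (left_avg B ?y) (left_avg B ?y) * ip ?G w w"
      by (simp add: ip_Cauchy_Schwarz)
    also have "\<dots> \<le> (l * ip ?G ?y ?y) * ip ?G w w"
      by (rule mult_right_mono[OF bd[OF M(2)[OF w]] ip_nonneg])
    finally have "ip ?G ?y ?y * ip ?G ?y ?y \<le> ip ?G ?y ?y * (l * ip ?G w w)"
      by (simp add: power2_eq_square algebra_simps)
    then show ?thesis
      using ip_nonneg[of ?G ?y] ip_nonneg[of ?G w] l
      by (cases "ip ?G ?y ?y = 0") (simp_all add: mult_le_cancel_left)
  qed
  have "(((\<lambda>w. left_avg_inv B (left_avg B w)) ^^ k) v) \<in> M \<and>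
    ip ?G (((\<lambda>w. left_avg_inv B (left_avg B w)) ^^ k) v) (((\<lambda>w. left_avg_inv B (left_avg B w)) ^^ k) v)
      \<le> l ^ (2 * k) * ip ?G v v"
  proof (induction k)
    case 0
    then show ?case using v by simp
  next
    case (Suc k)
    define u where "u = ((\<lambda>w. left_avg_inv B (left_avg B w)) ^^ k) v"
    have u: "u \<in> M" "ip ?G u u \<le> l ^ (2 * k) * ip ?G v v" using Suc by (auto simp: u_def)
    have "ip ?G (left_avg_inv B (left_avg B u)) (left_avg_inv B (left_avg B u))
        \<le> l * ip ?G (left_avg B u) (left_avg B u)"
      by (rule bd'[OF M(1)[OF u(1)]])
    also have "\<dots> \<le> l * (l * (l ^ (2 * k) * ip ?G v v))"
      using bd[OF u(1)] u(2) l
      by (intro mult_left_mono) (auto intro: order.trans mult_left_mono)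
    finally show ?case using M u(1) by (simp add: u_def mult.assoc)
  qed
  then have u: "(((\<lambda>w. left_avg_inv B (left_avg B w)) ^^ k) v) \<in> M"
    and le: "ip ?G (((\<lambda>w. left_avg_inv B (left_avg B w)) ^^ k) v) (((\<lambda>w. left_avg_inv B (left_avg B w)) ^^ k) v)
      \<le> l ^ (2 * k) * ip ?G v v" by blast+
  have "ip ?G (walk B k v) (walk B k v) \<le> l * (l ^ (2 * k) * ip ?G v v)"
    unfolding walk_def using bd[OF u] mult_left_mono[OF le l] by linarith
  then show ?thesis by (simp add: mult.assoc)
qed

text \<open>Here u and u' are the parts of f of degree at least d and at least d + 1, so u - u' has
  pure degree d. Of the 2 k + 2 factors \<open>mean_weight S B d\<close>, the walk supplies 2 k + 1;
  the last one comes from f, whose component along a d-set D has squared norm at most the order of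
  the group times \<open>agreement_weight S B D\<close>.\<close>

lemma level_bound:
  assumes S: "finite S" and B: "B \<subseteq> AltS S" "B \<noteq> {}" and d: "1 \<le> d" "d + 2 \<le> card S"
    and u: "u \<in> high S (d - 1)" "u' \<in> high S d"
    and fu: "(\<lambda>x. f x - u x) \<in> low S (d - 1)" "(\<lambda>x. f x - u' x) \<in> low S d"
    and f: "f = (\<lambda>g. if g \<in> B then card (AltS S) / card B else 0)"
  shows "ip (AltS S) (walk B k u) (walk B k u) \<le> ip (AltS S) (walk B k u') (walk B k u')
    + (card S choose d) * card (AltS S) * mean_weight S B d ^ (2 * k + 2)"
proof -
  let ?G = "AltS S" and ?I = "{D. D \<subseteq> S \<and> card D = d}"
  let ?Y = "walk B k" and ?mw = "mean_weight S B d"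
  have Sne: "S \<noteq> {}" using d by auto
  have fG: "finite ?G" by (rule finite_AltS[OF S])
  have fB: "finite B" using B fG finite_subset by blast
  have cB: "card B > 0" using fB B by (simp add: card_gt_0_iff)
  have cG: "card ?G > 0" by (rule card_AltS_pos[OF S])
  have mw0: "?mw \<ge> 0" by (rule mean_weight_nonneg[OF S Sne B(1)])
  have hsub: "high S d \<subseteq> high S (d - 1)" using d by (intro high_antimono[OF S]) auto
  have lsub: "low S (d - 1) \<subseteq> low S d" using hsub by (auto simp: low_def)
  have lin_low: "lin_sub ?G (low S d)"
    unfolding low_def by (rule lin_sub_orth[OF lin_sub_Fun])
  define g where "g = (\<lambda>x. u x - u' x)"
  have gh: "g \<in> high S (d - 1)"
    unfolding g_def using u hsub by (intro lin_sub_diff[OF lin_sub_high]) auto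
  have "g = (\<lambda>x. (f x - u' x) - (f x - u x))" by (simp add: g_def)
  then have gl: "g \<in> low S d"
    using fu lsub lin_sub_diff[OF lin_low, of "\<lambda>x. f x - u' x" "\<lambda>x. f x - u x"] by auto
  have Yg: "?Y g \<in> low S d"
    by (rule walk_mem[OF low_left_avg[OF S B(1)] low_left_avg_inv[OF S B(1)] gl])
  have Yu': "?Y u' \<in> high S d"
    by (rule walk_mem[OF high_left_avg[OF S B(1)] high_left_avg_inv[OF S B(1)] u(2)])
  have orth: "ip ?G (?Y g) (?Y u') = 0" using Yg Yu' by (simp add: low_def)
  have "?Y g = (\<lambda>x. ?Y u x - ?Y u' x)" unfolding g_def by (rule lin_op_diff[OF lin_op_walk])
  then have Yu: "?Y u = (\<lambda>x. 1 * ?Y g x + 1 * ?Y u' x)" by simp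
  have pyth: "ip ?G (?Y u) (?Y u) = ip ?G (?Y g) (?Y g) + ip ?G (?Y u') (?Y u')"
    unfolding Yu ip_add_left ip_add_right using orth by (simp add: ip_commute[of ?G "?Y u'" "?Y g"])
  define R where "R D v = alt_avg (S - D) v" for D :: "'a set" and v :: "('a \<Rightarrow> 'a) \<Rightarrow> real"
  have Rip: "ip ?G (R D v) w = ip ?G v (R D w)" for D v w
    unfolding R_def by (rule ip_alt_avg[OF S]) auto
  have RR: "R D (R D v) = R D v" for D v
    unfolding R_def using S by (intro alt_avg_absorb1) auto
  have set_bound: "ip ?G (R D (?Y g)) (R D (?Y g))
      \<le> ?mw ^ (2 * k + 1) * (card ?G * agreement_weight S B D)" if D: "D \<in> ?I" for D
  proof -
    have DS: "D \<subseteq> S" and cD: "card D = d" using D by auto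
    \<comment> \<open>\<open>R D\<close> commutes with the walk, so it suffices to follow v, which
      depends on the values on D and has zero average over the stabilizer of any proper subset of
      D.\<close>
    define v where "v = R D g"
    define M where "M = {w \<in> high S (d - 1). R D w = w}"
    have fD: "finite D" using DS S finite_subset by blast
    have vM: "v \<in> M"
      unfolding M_def v_def using RR high_alt_avg[OF S _ gh, of "S - D"] by (auto simp: R_def)
    have pure: "alt_avg (S - C) w = (\<lambda>_. 0)" if w: "w \<in> M" and C: "C \<subset> D" for w C
    proof (rule high_alt_avg_0[OF S, of w "d - 1"])
      show "card C \<le> d - 1" using psubset_card_mono[OF fD C] cD by simp
    qed (use w C DS d in \<open>auto simp: M_def\<close>)
    have Mcl: "left_avg B w \<in> M" "left_avg_inv B w \<in> M" if "w \<in> M" for w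
      using that high_left_avg[OF S B(1), of w] high_left_avg_inv[OF S B(1), of w]
      by (auto simp: M_def R_def simp flip: left_avg_alt_avg left_avg_inv_alt_avg)
    have Mfix: "alt_avg (S - D) w = w" if "w \<in> M" for w using that by (simp add: M_def R_def)
    have Mbd: "ip ?G (left_avg B w) (left_avg B w) \<le> ?mw * ip ?G w w" if "w \<in> M" for w
      using pure_function_left_avg_norm[OF S DS _ B Mfix[OF that] pure[OF that]] cD d by simp
    have 1: "ip ?G (R D (?Y g)) (R D (?Y g)) \<le> ?mw ^ (2 * k + 1) * ip ?G v v"
      using walk_norm[OF S B(1) Mcl mw0 Mbd vM, of k] by (simp add: v_def R_def walk_alt_avg)
    \<comment> \<open>In the inner product with v, f may replace u - u': f - u is orthogonal to
      \<open>high S (d - 1)\<close>, and u' is killed by \<open>R D\<close>.\<close>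
    have Rg: "ip ?G g v = ip ?G v v" unfolding v_def using Rip RR by metis
    have "ip ?G u' v = ip ?G (R D u') g" unfolding v_def by (simp only: Rip)
    also have "\<dots> = 0" using highD[OF u(2) DS cD] by (simp add: R_def)
    finally have "ip ?G u v = ip ?G v v"
      using Rg by (simp add: g_def ip_diff_left)
    moreover have "ip ?G (\<lambda>x. f x - u x) v = 0"
      using fu(1) vM by (simp add: low_def M_def)
    ultimately have "ip ?G v v = ip ?G f v" by (simp add: ip_diff_left)
    \<comment> \<open>f is the normalised indicator of B, so pairing with f evaluates F v at the
      identity. The pointwise bound then controls the squared norm of v in terms of itself, and one
      factor cancels.\<close>
    also have "\<dots> = card ?G * left_avg B v id"
    proof -
      have "ip ?G f v = (\<Sum>b\<in>B. card ?G / card B * v b)"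
        unfolding ip_def f using B(1) fG
        by (subst sum.mono_neutral_right[of ?G B]) auto
      then show ?thesis by (simp add: left_avg_def sum_distrib_left sum_divide_distrib)
    qed
    finally have vv: "ip ?G v v = card ?G * left_avg B v id" .
    have "(left_avg B v id)\<^sup>2 \<le> agreement_weight S B (id ` D) * ip ?G v v / card ?G"
      by (rule pure_function_left_avg[OF S DS _ B Mfix[OF vM] pure[OF vM]]) (use cD d in auto)
    then have "(card ?G * left_avg B v id)\<^sup>2 \<le> (real (card ?G))\<^sup>2 * (agreement_weight S B D * ip ?G v v / card ?G)"
      unfolding power_mult_distrib by (intro mult_left_mono) auto
    also have "\<dots> = (card ?G * agreement_weight S B D) * ip ?G v v"
      using cG by (simp add: power2_eq_square)
    finally have "ip ?G v v * ip ?G v v \<le> (card ?G * agreement_weight S B D) * ip ?G v v"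
      unfolding vv[symmetric] by (simp add: power2_eq_square)
    then have "ip ?G v v \<le> card ?G * agreement_weight S B D"
      using ip_nonneg[of ?G v] agreement_weight_nonneg[OF S Sne B(1) DS]
      by (cases "ip ?G v v = 0") (simp_all add: mult_le_cancel_right)
    then have "?mw ^ (2 * k + 1) * ip ?G v v \<le> ?mw ^ (2 * k + 1) * (card ?G * agreement_weight S B D)"
      using mw0 by (intro mult_left_mono) auto
    with 1 show ?thesis by linarith
  qed
  have "ip ?G (?Y g) (?Y g) \<le> (\<Sum>D\<in>?I. ip ?G (R D (?Y g)) (R D (?Y g)))"
    unfolding R_def by (rule low_frame_bound[OF S Yg])
  also have "\<dots> \<le> (\<Sum>D\<in>?I. ?mw ^ (2 * k + 1) * (card ?G * agreement_weight S B D))"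
    by (intro sum_mono set_bound)
  also have "\<dots> = ?mw ^ (2 * k + 1) * card ?G * (\<Sum>D\<in>?I. agreement_weight S B D)"
    by (simp add: sum_distrib_left mult.assoc)
  also have "(\<Sum>D\<in>?I. agreement_weight S B D) = (card S choose d) * ?mw"
    unfolding mean_weight_def using d by (simp add: binomial_eq_0_iff)
  finally have "ip ?G (?Y g) (?Y g) \<le> (card S choose d) * card ?G * ?mw ^ (2 * k + 2)"
    by (simp add: algebra_simps power_add)
  with pyth show ?thesis by linarith
qed

text \<open>\<open>level_bound\<close> telescopes over the degrees 1 to 4 m; the summand 1 is the
  constant part of f, and the last summand is its part in \<open>high S (4 * m)\<close>.\<close>

lemma walk_norm_bound:
  assumes S: "finite S" and B: "B \<subseteq> AltS S" "B \<noteq> {}" and m: "4 * m + 5 \<le> card S"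
    and f: "f = (\<lambda>g. if g \<in> B then card (AltS S) / card B else 0)"
  shows "ip (AltS S) (walk B k f) (walk B k f) \<le> card (AltS S) *
    (1 + (\<Sum>d\<in>{1..4 * m}. (card S choose d) * mean_weight S B d ^ (2 * k + 2))
       + (card (AltS S) / card B / 2 ^ m) ^ (2 * k + 1) * (card (AltS S) / card B))"
proof -
  let ?G = "AltS S" and ?Y = "walk B k"
  have fG: "finite ?G" by (rule finite_AltS[OF S])
  have fB: "finite B" using B fG finite_subset by blast
  have cB: "card B > 0" using fB B by (simp add: card_gt_0_iff)
  have cG: "card ?G > 0" by (rule card_AltS_pos[OF S])
  have fF: "f \<in> Fun S" using B by (auto simp: f Fun_def)
  have ff: "ip ?G f f = card ?G * (card ?G / card B)"
  proof -
    have "ip ?G f f = (\<Sum>b\<in>B. (card ?G / card B) * (card ?G / card B))"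
      unfolding ip_def f using B(1) fG by (subst sum.mono_neutral_right[of ?G B]) auto
    then show ?thesis using cB by simp
  qed
  have lowI: "\<exists>u\<in>high S d. (\<lambda>x. f x - u x) \<in> low S d" for d
  proof -
    obtain u where u: "u \<in> high S d" "\<And>w. w \<in> high S d \<Longrightarrow> ip ?G (\<lambda>x. f x - u x) w = 0"
      using orth_projection[OF fG lin_sub_high[of S d], of f] by blast
    then have "(\<lambda>x. f x - u x) \<in> low S d"
      using lin_sub_diff[OF lin_sub_Fun fF high_Fun[OF u(1)]] by (simp add: low_def)
    with u(1) show ?thesis by blast
  qed
  define U where "U d = (SOME u. u \<in> high S d \<and> (\<lambda>x. f x - u x) \<in> low S d)" for d
  have U: "U d \<in> high S d" "(\<lambda>x. f x - U d x) \<in> low S d" for d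
    using someI_ex[of "\<lambda>u. u \<in> high S d \<and> (\<lambda>x. f x - u x) \<in> low S d"] lowI[of d]
    unfolding U_def by blast+
  have step: "ip ?G (?Y (U 0)) (?Y (U 0)) \<le> ip ?G (?Y (U j)) (?Y (U j)) +
      (\<Sum>d\<in>{1..j}. card ?G * ((card S choose d) * mean_weight S B d ^ (2 * k + 2)))" if "j \<le> 4 * m" for j
    using that
  proof (induction j)
    case (Suc j)
    have "ip ?G (?Y (U j)) (?Y (U j)) \<le> ip ?G (?Y (U (Suc j))) (?Y (U (Suc j)))
        + (card S choose Suc j) * card ?G * mean_weight S B (Suc j) ^ (2 * k + 2)"
      using level_bound[OF S B, of "Suc j" "U j" "U (Suc j)" f k] U f Suc.prems m by simp
    with Suc show ?case by (simp add: mult.assoc mult.left_commute)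
  qed simp
  have top: "ip ?G (?Y (U (4 * m))) (?Y (U (4 * m)))
      \<le> (card ?G / card B / 2 ^ m) ^ (2 * k + 1) * (card ?G * (card ?G / card B))"
  proof -
    let ?u = "U (4 * m)"
    have "ip ?G (?Y ?u) (?Y ?u) \<le> (card ?G / card B / 2 ^ m) ^ (2 * k + 1) * ip ?G ?u ?u"
      by (rule walk_norm[OF S B(1) high_left_avg[OF S B(1)] high_left_avg_inv[OF S B(1)] _
            high_left_avg_bound[OF S B m] U(1)]) auto
    moreover have "ip ?G ?u ?u \<le> ip ?G f f"
    proof -
      have o: "ip ?G (\<lambda>x. f x - ?u x) ?u = 0" using U by (simp add: low_def)
      then have fu: "ip ?G f ?u = ip ?G ?u ?u" by (simp add: ip_diff_left)
      have "0 \<le> ip ?G (\<lambda>x. f x - ?u x) (\<lambda>x. f x - ?u x)" by (rule ip_nonneg)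
      also have "\<dots> = ip ?G f f - ip ?G ?u ?u"
        unfolding ip_diff_right using o fu by (simp add: ip_diff_left ip_commute[of ?G ?u f])
      finally show ?thesis by simp
    qed
    then have "(card ?G / card B / 2 ^ m) ^ (2 * k + 1) * ip ?G ?u ?u
        \<le> (card ?G / card B / 2 ^ m) ^ (2 * k + 1) * ip ?G f f"
      by (intro mult_left_mono) auto
    ultimately show ?thesis unfolding ff by linarith
  qed
  \<comment> \<open>The constant 1 is the component of f of degree 0, because f has mean 1; F and
    its adjoint fix it.\<close>
  define c where "c = (\<lambda>g. of_bool (g \<in> ?G) :: real)"
  have cF: "c \<in> Fun S" by (simp add: c_def Fun_def)
  have U0c: "?Y f = (\<lambda>x. 1 * ?Y c x + 1 * ?Y (\<lambda>x. f x - c x) x)"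
    unfolding lin_op_diff[OF lin_op_walk] by simp
  have Lc: "left_avg B c = c" and Lic: "left_avg_inv B c = c"
  proof -
    have "c (b \<circ> \<sigma>) = c \<sigma>" "c (inv' b \<circ> \<sigma>) = c \<sigma>" if "b \<in> B" for b \<sigma>
      using that B(1) AltS_comp_left_iff[OF S] AltS_inv[OF S] by (auto simp: c_def)
    then show "left_avg B c = c" "left_avg_inv B c = c"
      using cB by (simp_all add: left_avg_def left_avg_inv_def)
  qed
  have Yc: "?Y c = c"
  proof -
    have "((\<lambda>w. left_avg_inv B (left_avg B w)) ^^ k) c = c" by (induction k) (simp_all add: Lc Lic)
    then show ?thesis by (simp add: walk_def Lc)
  qed
  have fc: "(\<lambda>x. f x - c x) \<in> high S 0"
    unfolding high_def
  proof (intro CollectI conjI allI impI)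
    show "(\<lambda>x. f x - c x) \<in> Fun S" by (rule lin_sub_diff[OF lin_sub_Fun fF cF])
    fix D :: "'a set" assume "D \<subseteq> S" "card D = 0"
    then have D: "D = {}" using S finite_subset by fastforce
    show "alt_avg (S - D) (\<lambda>x. f x - c x) = (\<lambda>_. 0)"
    proof
      fix \<sigma>
      show "alt_avg (S - D) (\<lambda>x. f x - c x) \<sigma> = 0"
      proof (cases "\<sigma> \<in> ?G")
        case True
        have "(\<Sum>u\<in>?G. f (\<sigma> \<circ> u)) = (\<Sum>u\<in>?G. f u)" by (rule sum_AltS_left[OF S True])
        also have "\<dots> = (\<Sum>b\<in>B. card ?G / card B)"
          unfolding f using B(1) fG by (subst sum.mono_neutral_right[of ?G B]) auto
        finally have "(\<Sum>u\<in>?G. f (\<sigma> \<circ> u)) = card ?G" using cB by simp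
        moreover have "(\<Sum>u\<in>?G. c (\<sigma> \<circ> u)) = card ?G"
          using AltS_comp[OF S True] by (simp add: c_def)
        ultimately show ?thesis by (simp add: alt_avg_def D sum_subtractf)
      next
        case False
        have "(\<lambda>x. f x - c x) \<in> Fun S" by (rule lin_sub_diff[OF lin_sub_Fun fF cF])
        then have "alt_avg (S - D) (\<lambda>x. f x - c x) \<in> Fun S" by (intro Fun_alt_avg[OF S]) auto
        with False show ?thesis by (simp add: Fun_def)
      qed
    qed
  qed
  have cl: "c \<in> low S 0"
    unfolding low_def
  proof (intro CollectI conjI ballI cF)
    fix w assume w: "w \<in> high S 0"
    have "alt_avg (S - {}) w id = 0" using highD[OF w, of "{}"] by simp
    then have "(\<Sum>u\<in>?G. w u) = 0" using cG by (simp add: alt_avg_def)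
    then show "ip ?G c w = 0" by (simp add: ip_def c_def)
  qed
  have U0: "U 0 = (\<lambda>x. f x - c x)"
  proof -
    define z where "z = (\<lambda>x. U 0 x - (f x - c x))"
    have zh: "z \<in> high S 0" unfolding z_def by (rule lin_sub_diff[OF lin_sub_high U(1) fc])
    have "z = (\<lambda>x. c x - (f x - U 0 x))" by (auto simp: z_def fun_eq_iff)
    then have "ip ?G z z = ip ?G c z - ip ?G (\<lambda>x. f x - U 0 x) z"
      by (metis ip_diff_left)
    also have "\<dots> = 0" using cl U(2)[of 0] zh by (simp add: low_def)
    finally have "z = (\<lambda>_. 0)"
      using zh by (intro ip_self_eq_0D[OF fG]) (auto simp: high_def Fun_def)
    then show ?thesis by (auto simp: z_def fun_eq_iff)
  qed
  have "ip ?G (?Y c) (?Y (U 0)) = 0"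
    using cl walk_mem[OF high_left_avg[OF S B(1)] high_left_avg_inv[OF S B(1)] U(1)[of 0], of k]
    by (simp add: Yc low_def)
  then have "ip ?G (?Y f) (?Y f) = ip ?G c c + ip ?G (?Y (U 0)) (?Y (U 0))"
    unfolding U0c ip_add_left ip_add_right U0[symmetric] Yc
    by (simp add: ip_commute[of ?G "?Y (U 0)" c])
  also have "ip ?G c c = card ?G" by (simp add: ip_def c_def)
  finally have "ip ?G (?Y f) (?Y f) \<le> card ?G +
      ((card ?G / card B / 2 ^ m) ^ (2 * k + 1) * (card ?G * (card ?G / card B))
      + (\<Sum>d\<in>{1..4 * m}. card ?G * ((card S choose d) * mean_weight S B d ^ (2 * k + 2))))"
    using step[of "4 * m"] top by simp
  then show ?thesis by (simp add: sum_distrib_left algebra_simps)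
qed

section \<open>Moments of coordinate products\<close>

lemma fact_ratio_ge_power:
  assumes "u \<le> n"
  shows "(real n - real u) ^ u \<le> fact n / fact (n - u)"
  using assms
proof (induction u)
  case (Suc u)
  have "(real n - real (Suc u)) ^ Suc u = (real n - real (Suc u)) ^ u * (real n - real (Suc u))"
    by simp
  also have "\<dots> \<le> (real n - real u) ^ u * (real n - real u)"
    using Suc.prems by (intro mult_mono power_mono) auto
  also have "\<dots> \<le> fact n / fact (n - u) * (real n - real u)"
    using Suc by (intro mult_right_mono) auto
  also have "\<dots> = fact n / fact (n - Suc u)"
  proof -
    have "n - u = Suc (n - Suc u)" using Suc.prems by simp
    then have "fact (n - u) = (real n - real u) * fact (n - Suc u)"
      using Suc.prems by (simp add: of_nat_diff)
    then show ?thesis using Suc.prems by simp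
  qed
  finally show ?case .
qed simp

text \<open>Both summands are pure powers in u, so that sums over subsets still factor. For u \<le>
  c the falling factorial is at least (n - c)^u; for u > c it is only bounded below by (3 n / 4)^u,
  but then e^(u - c) \<ge> 1 buys the factor e^(-c).\<close>

lemma fact_ratio_inverse_le:
  assumes u: "real u \<le> real n / 4" and n: "n > 0" and c: "0 \<le> c" "c < real n"
  shows "fact (n - u) / fact n
    \<le> (1 / (1 - c / n) / n) ^ u + exp (- c) * (4 * exp 1 / 3 / n) ^ u"
proof -
  have un: "u \<le> n" using u by simp
  have pos: "0 < real n - real u" using u n by simp
  have "(real n - real u) ^ u > 0" using pos by simp
  then have 1: "fact (n - u) / fact n \<le> 1 / (real n - real u) ^ u"
    using fact_ratio_ge_power[OF un] by (simp add: field_simps)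
  have nn: "0 \<le> (1 / (1 - c / n) / n) ^ u" "0 \<le> exp (- c) * (4 * exp 1 / 3 / n) ^ u"
    using c n by (auto intro!: zero_le_power divide_nonneg_nonneg simp: field_simps)
  show ?thesis
  proof (cases "real u \<le> c")
    case True
    have "(real n - c) ^ u \<le> (real n - real u) ^ u"
      using True c by (intro power_mono) auto
    then have "1 / (real n - real u) ^ u \<le> 1 / (real n - c) ^ u"
      using c pos by (intro divide_left_mono mult_pos_pos zero_less_power) auto
    also have "\<dots> = (1 / (1 - c / n) / n) ^ u"
      using c n by (simp add: power_divide field_simps flip: power_mult_distrib)
    finally show ?thesis using 1 nn by linarith
  next
    case False
    have "(3 * real n / 4) ^ u \<le> (real n - real u) ^ u"
      using u n by (intro power_mono) auto
    then have "1 / (real n - real u) ^ u \<le> 1 / (3 * real n / 4) ^ u"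
      using n pos by (intro divide_left_mono) auto
    also have "\<dots> = (4 / 3 / n) ^ u" using n by (simp add: power_divide power_mult_distrib)
    also have "\<dots> \<le> exp (real u - c) * (4 / 3 / n) ^ u"
      using mult_right_mono[of 1 "exp (real u - c)" "(4 / 3 / real n) ^ u"] False by simp
    also have "\<dots> = exp (- c) * (4 * exp 1 / 3 / n) ^ u"
    proof -
      have "exp (real u - c) = exp (- c) * exp 1 ^ u"
        by (simp add: exp_diff exp_minus divide_inverse flip: exp_of_nat_mult)
      then show ?thesis by (simp add: power_divide power_mult_distrib)
    qed
    finally show ?thesis using 1 nn by linarith
  qed
qed

lemma sum_Pow_prod: "finite A \<Longrightarrow> (\<Sum>X\<in>Pow A. \<Prod>x\<in>X. (f x :: real)) = (\<Prod>x\<in>A. 1 + f x)"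
  using prod_add[of A f "\<lambda>_. 1"] by (simp add: add.commute)

text \<open>This is (1 + c)^p without its terms of degree 0 and 1, estimated by e^x \<le> 1 + x +
  x^2.\<close>

lemma sum_Pow_power_ge2:
  assumes "0 \<le> c" "real p * c \<le> 1"
  shows "(\<Sum>J | J \<subseteq> {..<p} \<and> card J \<ge> 2. c ^ card J) \<le> (real p * c)\<^sup>2"
proof -
  let ?P = "{J. J \<subseteq> {..<p} \<and> card J \<ge> 2}" and ?Q = "insert {} ((\<lambda>j. {j}) ` {..<p})"
  have split: "Pow {..<p} = ?P \<union> ?Q" and disj: "?P \<inter> ?Q = {}"
  proof -
    show "?P \<inter> ?Q = {}" by auto
    have "J \<in> ?Q" if J: "J \<subseteq> {..<p}" "\<not> card J \<ge> 2" for J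
    proof -
      have fJ: "finite J" using J finite_subset by blast
      consider "card J = 0" | "card J = 1" using J(2) by linarith
      then show ?thesis
      proof cases
        case 1
        then show ?thesis using fJ by simp
      next
        case 2
        then obtain j where "J = {j}" by (auto simp: card_1_singleton_iff)
        then show ?thesis using J by auto
      qed
    qed
    then show "Pow {..<p} = ?P \<union> ?Q" by auto
  qed
  have fP: "finite ?P" by (rule finite_subset[of _ "Pow {..<p}"]) auto
  have "(1 + c) ^ p = (\<Sum>J\<in>Pow {..<p}. c ^ card J)"
    using sum_Pow_prod[of "{..<p}" "\<lambda>_. c"] by simp
  also have "\<dots> = (\<Sum>J\<in>?P. c ^ card J) + (\<Sum>J\<in>?Q. c ^ card J)"
    unfolding split by (rule sum.union_disjoint[OF fP _ disj]) simp
  also have "(\<Sum>J\<in>?Q. c ^ card J) = 1 + real p * c"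
    by (subst sum.insert) (auto simp: sum.reindex inj_on_def)
  finally have "(\<Sum>J\<in>?P. c ^ card J) = (1 + c) ^ p - 1 - real p * c" by simp
  also have "(1 + c) ^ p \<le> exp (real p * c)"
  proof -
    have "(1 + c) ^ p \<le> exp c ^ p" using assms(1) exp_ge_add_one_self[of c] by (intro power_mono) auto
    then show ?thesis by (simp add: exp_of_nat_mult)
  qed
  also have "exp (real p * c) \<le> 1 + real p * c + (real p * c)\<^sup>2"
    using assms by (intro exp_bound) auto
  finally show ?thesis by simp
qed

text \<open>Expansion over E \<subseteq> Q compares a uniform permutation with independent uniform
  values. The ratio of the two is at most (N - |E|)! N^|E| / N!, and its two bounds by powers resum
  to the two products.\<close>

lemma uniform_product_moment:
  fixes \<theta> :: "'a \<Rightarrow> 'a \<Rightarrow> real"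
  assumes S: "finite S" "S \<noteq> {}" and Q: "Q \<subseteq> S" "real (card Q) \<le> real (card S) / 4" "card Q + 2 \<le> card S"
    and \<theta>: "\<And>x y. \<theta> x y \<ge> 0" and c: "0 \<le> c" "c < real (card S)"
  shows "(\<Sum>g\<in>AltS S. \<Prod>x\<in>Q. 1 + \<theta> x (g x)) \<le> card (AltS S) *
    ((\<Prod>x\<in>Q. 1 + 1 / (1 - c / card S) / card S * (\<Sum>y\<in>S. \<theta> x y))
      + exp (- c) * (\<Prod>x\<in>Q. 1 + 4 * exp 1 / 3 / card S * (\<Sum>y\<in>S. \<theta> x y)))"
proof -
  let ?G = "AltS S" and ?N = "card S"
  define \<Theta> where "\<Theta> x = (\<Sum>y\<in>S. \<theta> x y)" for x
  have \<Theta>0: "\<Theta> x \<ge> 0" for x unfolding \<Theta>_def by (intro sum_nonneg \<theta>)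
  have fQ: "finite Q" using Q S finite_subset by blast
  have N: "?N > 0" using S by (simp add: card_gt_0_iff)
  have sub: "(\<Sum>g\<in>?G. \<Prod>x\<in>E. \<theta> x (g x)) \<le> card ?G * (fact (?N - card E) / fact ?N) * (\<Prod>x\<in>E. \<Theta> x)"
    if E: "E \<subseteq> Q" for E
  proof -
    have ES: "E \<subseteq> S" using E Q by blast
    have fE: "finite E" using E fQ finite_subset by blast
    have cE: "card E \<le> card Q" by (rule card_mono[OF fQ E])
    have "(\<Sum>g\<in>?G. \<Prod>x\<in>E. \<theta> x (g x)) = (\<Sum>g\<in>?G. \<Prod>x\<in>E. \<theta> x (restrict g E x))"
      by simp
    also have "\<dots> \<le> card (AltS (S - E)) * (\<Sum>w\<in>E \<rightarrow>\<^sub>E S. \<Prod>x\<in>E. \<theta> x (w x))"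
      by (rule sum_AltS_restrict_le[OF S(1) ES]) (intro prod_nonneg \<theta> ballI)
    also have "(\<Sum>w\<in>E \<rightarrow>\<^sub>E S. \<Prod>x\<in>E. \<theta> x (w x)) = (\<Prod>x\<in>E. \<Theta> x)"
      unfolding \<Theta>_def using S by (intro prod_sum_PiE[OF fE, symmetric]) simp
    also have "real (card (AltS (S - E))) = card ?G * (fact (?N - card E) / fact ?N)"
      using card_AltS_ratio[OF S(1) ES] cE Q(3) by (simp add: field_simps)
    finally show ?thesis .
  qed
  have "(\<Sum>g\<in>?G. \<Prod>x\<in>Q. 1 + \<theta> x (g x)) = (\<Sum>E\<in>Pow Q. \<Sum>g\<in>?G. \<Prod>x\<in>E. \<theta> x (g x))"
    by (subst sum.swap) (simp add: sum_Pow_prod[OF fQ])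
  also have "\<dots> \<le> (\<Sum>E\<in>Pow Q. card ?G *
      ((\<Prod>x\<in>E. 1 / (1 - c / ?N) / ?N * \<Theta> x) + exp (- c) * (\<Prod>x\<in>E. 4 * exp 1 / 3 / ?N * \<Theta> x)))"
  proof (rule sum_mono)
    fix E assume "E \<in> Pow Q"
    then have E: "E \<subseteq> Q" by simp
    have "card E \<le> card Q" by (rule card_mono[OF fQ E])
    then have cE: "real (card E) \<le> real ?N / 4" using Q(2) by linarith
    have "(\<Sum>g\<in>?G. \<Prod>x\<in>E. \<theta> x (g x)) \<le> card ?G * ((fact (?N - card E) / fact ?N) * (\<Prod>x\<in>E. \<Theta> x))"
      using sub[OF E] by (simp add: mult.assoc)
    also have "\<dots> \<le> card ?G * (((1 / (1 - c / ?N) / ?N) ^ card E + exp (- c) * (4 * exp 1 / 3 / ?N) ^ card E) * (\<Prod>x\<in>E. \<Theta> x))"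
      by (intro mult_left_mono mult_right_mono fact_ratio_inverse_le[OF cE N c] prod_nonneg ballI \<Theta>0) simp
    also have "\<dots> = card ?G * ((\<Prod>x\<in>E. 1 / (1 - c / ?N) / ?N * \<Theta> x) + exp (- c) * (\<Prod>x\<in>E. 4 * exp 1 / 3 / ?N * \<Theta> x))"
      unfolding prod.distrib prod_constant by (simp add: algebra_simps)
    finally show "(\<Sum>g\<in>?G. \<Prod>x\<in>E. \<theta> x (g x)) \<le> \<dots>" .
  qed
  also have "\<dots> = card ?G * ((\<Sum>E\<in>Pow Q. \<Prod>x\<in>E. 1 / (1 - c / ?N) / ?N * \<Theta> x)
      + exp (- c) * (\<Sum>E\<in>Pow Q. \<Prod>x\<in>E. 4 * exp 1 / 3 / ?N * \<Theta> x))"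
    by (simp add: sum.distrib flip: sum_distrib_left)
  finally show ?thesis unfolding sum_Pow_prod[OF fQ] by (simp add: \<Theta>_def)
qed

text \<open>The index \<open>(y, J)\<close> stands for the event that the permutations \<open>\<beta> j\<close>, \<open>j \<in> J\<close>, all map a
  given point to \<open>y\<close>; the index with \<open>J = {}\<close> produces the summand \<open>1\<close>.\<close>

lemma collision_moment:
  fixes B :: "('a \<Rightarrow> 'a) set" and z \<gamma> \<epsilon> :: real
  assumes S: "finite S" "S \<noteq> {}" and fB: "finite B" and Q: "Q \<subseteq> S"
    and spread: "\<And>D w. D \<subseteq> Q \<Longrightarrow> real (card {b \<in> B. \<forall>x\<in>D. b x = w x}) \<le> card B * \<epsilon> ^ card D"
    and pos: "z \<ge> 0" "\<gamma> \<ge> 0" "\<epsilon> \<ge> 0"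
  shows "(\<Sum>\<beta>\<in>{..<p} \<rightarrow>\<^sub>E B. \<Prod>x\<in>Q. 1 + \<gamma> / card S *
      (\<Sum>y\<in>S. \<Sum>J | J \<subseteq> {..<p} \<and> card J \<ge> 2. z ^ card J * of_bool (\<forall>j\<in>J. \<beta> j x = y)))
    \<le> real (card B) ^ p * (1 + \<gamma> * (\<Sum>J | J \<subseteq> {..<p} \<and> card J \<ge> 2. (z * \<epsilon>) ^ card J)) ^ card Q"
proof -
  let ?P = "{J. J \<subseteq> {..<p} \<and> card J \<ge> 2}"
  have fQ: "finite Q" using Q S finite_subset by blast
  have fP: "finite ?P" by (rule finite_subset[of _ "Pow {..<p}"]) auto
  have N: "real (card S) > 0" using S by (simp add: card_gt_0_iff)
  obtain a0 where a0: "a0 \<in> S" using S by blast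
  \<comment> \<open>The factor at x becomes one sum over K, so that the product over x turns into a
    sum over choice functions \<chi>.\<close>
  define K where "K = insert (a0, {}) (S \<times> ?P)"
  have fK: "finite K" using S fP by (simp add: K_def)
  have K0: "(a0, {}) \<notin> S \<times> ?P" by simp
  define c where "c k = (if snd k = {} then 1 else \<gamma> / card S * z ^ card (snd k))" for k :: "'a \<times> nat set"
  have c0: "c k \<ge> 0" for k using pos by (simp add: c_def)
  have Ksub: "snd k \<subseteq> {..<p}" if "k \<in> K" for k
    using that by (auto simp: K_def)
  have Kfin: "finite (snd k)" if "k \<in> K" for k
    by (rule finite_subset[OF Ksub[OF that] finite_lessThan])
  have sumK: "(\<Sum>k\<in>K. c k * h k) = h (a0, {}) + \<gamma> / card S * (\<Sum>y\<in>S. \<Sum>J\<in>?P. z ^ card J * h (y, J))"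
    for h :: "'a \<times> nat set \<Rightarrow> real"
  proof -
    have "(\<Sum>k\<in>K. c k * h k) = c (a0, {}) * h (a0, {}) + (\<Sum>k\<in>S \<times> ?P. c k * h k)"
      unfolding K_def using S fP by (intro sum.insert[OF _ K0]) simp
    also have "(\<Sum>k\<in>S \<times> ?P. c k * h k) = (\<Sum>y\<in>S. \<Sum>J\<in>?P. \<gamma> / card S * (z ^ card J * h (y, J)))"
      unfolding sum.cartesian_product by (intro sum.cong) (auto simp: c_def)
    finally show ?thesis by (simp add: c_def sum_distrib_left)
  qed
  have "(\<Sum>\<beta>\<in>{..<p} \<rightarrow>\<^sub>E B. \<Prod>x\<in>Q. 1 + \<gamma> / card S *
      (\<Sum>y\<in>S. \<Sum>J\<in>?P. z ^ card J * of_bool (\<forall>j\<in>J. \<beta> j x = y)))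
    = (\<Sum>\<beta>\<in>{..<p} \<rightarrow>\<^sub>E B. \<Prod>x\<in>Q. \<Sum>k\<in>K. c k * of_bool (\<forall>j\<in>snd k. \<beta> j x = fst k))"
    unfolding sumK by simp
  also have "\<dots> = (\<Sum>\<beta>\<in>{..<p} \<rightarrow>\<^sub>E B. \<Sum>\<chi>\<in>Q \<rightarrow>\<^sub>E K. \<Prod>x\<in>Q. c (\<chi> x) * of_bool (\<forall>j\<in>snd (\<chi> x). \<beta> j x = fst (\<chi> x)))"
    using fK by (intro sum.cong refl prod_sum_PiE[OF fQ]) simp
  also have "\<dots> = (\<Sum>\<chi>\<in>Q \<rightarrow>\<^sub>E K. (\<Prod>x\<in>Q. c (\<chi> x)) *
      (\<Sum>\<beta>\<in>{..<p} \<rightarrow>\<^sub>E B. \<Prod>x\<in>Q. of_bool (\<forall>j\<in>snd (\<chi> x). \<beta> j x = fst (\<chi> x))))"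
    by (subst sum.swap) (simp add: prod.distrib sum_distrib_left)
  also have "\<dots> \<le> (\<Sum>\<chi>\<in>Q \<rightarrow>\<^sub>E K. (\<Prod>x\<in>Q. c (\<chi> x)) * (real (card B) ^ p * (\<Prod>x\<in>Q. \<epsilon> ^ card (snd (\<chi> x)))))"
  proof (intro sum_mono mult_left_mono prod_nonneg ballI c0)
    fix \<chi> assume \<chi>: "\<chi> \<in> Q \<rightarrow>\<^sub>E K"
    have \<chi>fin: "finite (snd (\<chi> x))" "snd (\<chi> x) \<subseteq> {..<p}" if "x \<in> Q" for x
      using Kfin[of "\<chi> x"] Ksub[of "\<chi> x"] \<chi> that by (auto simp: PiE_iff)
    \<comment> \<open>For fixed \<chi> the constraints separate by j: \<open>\<beta> j\<close> has
      to take prescribed values on \<open>E j\<close>, and \<open>spread\<close> bounds the number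
      of such elements of B.\<close>
    define E where "E j = {x \<in> Q. j \<in> snd (\<chi> x)}" for j
    have EQ: "E j \<subseteq> Q" for j by (auto simp: E_def)
    have "(\<Prod>x\<in>Q. of_bool (\<forall>j\<in>snd (\<chi> x). \<beta> j x = fst (\<chi> x)))
        = (\<Prod>j<p. of_bool (\<forall>x\<in>E j. \<beta> j x = fst (\<chi> x)) :: real)" for \<beta>
    proof (cases "\<forall>x\<in>Q. \<forall>j\<in>snd (\<chi> x). \<beta> j x = fst (\<chi> x)")
      case True
      then show ?thesis by (simp add: E_def)
    next
      case False
      then obtain x j where xj: "x \<in> Q" "j \<in> snd (\<chi> x)" "\<beta> j x \<noteq> fst (\<chi> x)" by blast
      then have jp: "j \<in> {..<p}" using \<chi>fin by blast
      have "(\<Prod>x\<in>Q. of_bool (\<forall>j\<in>snd (\<chi> x). \<beta> j x = fst (\<chi> x))) = (0::real)"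
        using xj fQ by (intro prod_zero bexI[of _ x]) auto
      moreover have "(\<Prod>j<p. of_bool (\<forall>x\<in>E j. \<beta> j x = fst (\<chi> x))) = (0::real)"
        using xj jp by (intro prod_zero bexI[of _ j]) (auto simp: E_def)
      ultimately show ?thesis by simp
    qed
    then have "(\<Sum>\<beta>\<in>{..<p} \<rightarrow>\<^sub>E B. \<Prod>x\<in>Q. of_bool (\<forall>j\<in>snd (\<chi> x). \<beta> j x = fst (\<chi> x)))
        = (\<Sum>\<beta>\<in>{..<p} \<rightarrow>\<^sub>E B. \<Prod>j<p. of_bool (\<forall>x\<in>E j. \<beta> j x = fst (\<chi> x)) :: real)"
      by simp
    also have "\<dots> = (\<Prod>j<p. \<Sum>b\<in>B. of_bool (\<forall>x\<in>E j. b x = fst (\<chi> x)))"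
      using fB by (intro prod_sum_PiE[symmetric]) auto
    also have "\<dots> = (\<Prod>j<p. real (card {b \<in> B. \<forall>x\<in>E j. b x = fst (\<chi> x)}))"
      using fB by (intro prod.cong refl) (simp add: sum.If_cases of_bool_def Int_def flip: Collect_conj_eq)
    also have "\<dots> \<le> (\<Prod>j<p. card B * \<epsilon> ^ card (E j))"
      using spread[OF EQ] by (intro prod_mono) auto
    also have "\<dots> = real (card B) ^ p * (\<Prod>j<p. \<Prod>x\<in>E j. \<epsilon>)"
      by (simp add: prod.distrib)
    \<comment> \<open>The factors \<epsilon> are regrouped by points, so that the sum over \<chi>
      factors back into a product over Q.\<close>
    also have "(\<Prod>j<p. \<Prod>x\<in>E j. \<epsilon>) = (\<Prod>x\<in>Q. \<Prod>j\<in>snd (\<chi> x). \<epsilon>)"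
    proof -
      have "(\<Prod>j<p. \<Prod>x\<in>E j. \<epsilon>) = (\<Prod>j<p. \<Prod>x\<in>Q. if j \<in> snd (\<chi> x) then \<epsilon> else 1)"
        unfolding E_def using fQ by (intro prod.cong refl prod.inter_filter)
      also have "\<dots> = (\<Prod>x\<in>Q. \<Prod>j<p. if j \<in> snd (\<chi> x) then \<epsilon> else 1)" by (rule prod.swap)
      also have "\<dots> = (\<Prod>x\<in>Q. \<Prod>j\<in>snd (\<chi> x). \<epsilon>)"
      proof (rule prod.cong[OF refl])
        fix x assume x: "x \<in> Q"
        have "{j \<in> {..<p}. j \<in> snd (\<chi> x)} = snd (\<chi> x)" using \<chi>fin(2)[OF x] by blast
        then show "(\<Prod>j<p. if j \<in> snd (\<chi> x) then \<epsilon> else 1) = (\<Prod>j\<in>snd (\<chi> x). \<epsilon>)"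
          using prod.inter_filter[of "{..<p}" "\<lambda>_. \<epsilon>" "\<lambda>j. j \<in> snd (\<chi> x)"] by simp
      qed
      finally show ?thesis .
    qed
    finally show "(\<Sum>\<beta>\<in>{..<p} \<rightarrow>\<^sub>E B. \<Prod>x\<in>Q. of_bool (\<forall>j\<in>snd (\<chi> x). \<beta> j x = fst (\<chi> x)))
        \<le> real (card B) ^ p * (\<Prod>x\<in>Q. \<epsilon> ^ card (snd (\<chi> x)))" by simp
  qed
  also have "\<dots> = real (card B) ^ p * (\<Sum>\<chi>\<in>Q \<rightarrow>\<^sub>E K. \<Prod>x\<in>Q. c (\<chi> x) * \<epsilon> ^ card (snd (\<chi> x)))"
    by (simp add: prod.distrib sum_distrib_left mult.left_commute)
  also have "(\<Sum>\<chi>\<in>Q \<rightarrow>\<^sub>E K. \<Prod>x\<in>Q. c (\<chi> x) * \<epsilon> ^ card (snd (\<chi> x)))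
      = (\<Prod>x\<in>Q. \<Sum>k\<in>K. c k * \<epsilon> ^ card (snd k))"
    using fK by (intro prod_sum_PiE[OF fQ, symmetric]) simp
  also have "(\<Sum>k\<in>K. c k * \<epsilon> ^ card (snd k)) = 1 + \<gamma> * (\<Sum>J\<in>?P. (z * \<epsilon>) ^ card J)"
    unfolding sumK using N by (simp add: power_mult_distrib)
  finally show ?thesis by simp
qed

section \<open>The noise form\<close>

lemma mean_power_le:
  fixes h :: "'b \<Rightarrow> real"
  assumes "finite B" "B \<noteq> {}" "\<And>b. b \<in> B \<Longrightarrow> h b \<ge> 0"
  shows "((\<Sum>b\<in>B. h b) / card B) ^ p \<le> (\<Sum>b\<in>B. h b ^ p) / card B"
proof -
  have c: "card B > 0" using assms by (simp add: card_gt_0_iff)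
  have conv: "convex_on {0::real..} (\<lambda>x. x ^ p)"
  proof (cases "even p")
    case True
    have "convex_on (UNIV::real set) (\<lambda>x. x ^ p)" by (rule convex_power_even[OF True])
    then show ?thesis by (rule convex_on_subset) simp_all
  next
    case False
    then show ?thesis by (rule convex_power_odd)
  qed
  have "(\<Sum>b\<in>B. (1 / card B) *\<^sub>R h b) ^ p \<le> (\<Sum>b\<in>B. (1 / card B) * h b ^ p)"
    using c assms by (intro convex_on_sum[OF assms(1,2) conv]) auto
  then show ?thesis by (simp add: sum_divide_distrib)
qed

lemma sum_power_PiE:
  fixes h :: "'b \<Rightarrow> real"
  assumes "finite B"
  shows "(\<Sum>b\<in>B. h b) ^ p = (\<Sum>\<beta>\<in>{..<p} \<rightarrow>\<^sub>E B. \<Prod>j<p. h (\<beta> j))"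
proof -
  have "(\<Sum>b\<in>B. h b) ^ p = (\<Prod>j<p. \<Sum>b\<in>B. h b)" by simp
  also have "\<dots> = (\<Sum>\<beta>\<in>{..<p} \<rightarrow>\<^sub>E B. \<Prod>j<p. h (\<beta> j))"
    using assms by (intro prod_sum_PiE) auto
  finally show ?thesis .
qed

text \<open>The quadratic form of a noise operator on the law of B restricted to Q: 1 - \<rho> +
  \<rho> N [y = y'] is the density of the transition that keeps a value with probability \<rho> and
  otherwise resamples it uniformly from S.\<close>

definition noise_form :: "'a set \<Rightarrow> ('a \<Rightarrow> 'a) set \<Rightarrow> real \<Rightarrow> 'a set \<Rightarrow> real" where
  "noise_form S B \<rho> Q =
     (\<Sum>b\<in>B. \<Sum>b'\<in>B. \<Prod>x\<in>Q. 1 - \<rho> + \<rho> * real (card S) * of_bool (b x = b' x)) / (card B)\<^sup>2"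

lemma noise_form_eq:
  assumes "finite Q"
  shows "noise_form S B \<rho> Q = (\<Sum>D\<in>Pow Q. \<rho> ^ card D * agreement_weight S B D)"
proof -
  have "(\<Prod>x\<in>Q. 1 - \<rho> + \<rho> * real (card S) * of_bool (b x = b' x))
      = (\<Sum>D\<in>Pow Q. \<rho> ^ card D * (\<Prod>x\<in>D. real (card S) * of_bool (b x = b' x) - 1))" for b b' :: "'a \<Rightarrow> 'a"
  proof -
    have "(\<Prod>x\<in>Q. 1 - \<rho> + \<rho> * real (card S) * of_bool (b x = b' x))
        = (\<Prod>x\<in>Q. 1 + \<rho> * (real (card S) * of_bool (b x = b' x) - 1))"
      by (simp add: algebra_simps)
    also have "\<dots> = (\<Sum>D\<in>Pow Q. \<Prod>x\<in>D. \<rho> * (real (card S) * of_bool (b x = b' x) - 1))"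
      by (rule sum_Pow_prod[OF assms, symmetric])
    finally show ?thesis by (simp add: prod.distrib)
  qed
  then have "(\<Sum>b\<in>B. \<Sum>b'\<in>B. \<Prod>x\<in>Q. 1 - \<rho> + \<rho> * real (card S) * of_bool (b x = b' x))
      = (\<Sum>D\<in>Pow Q. \<Sum>b\<in>B. \<Sum>b'\<in>B. \<rho> ^ card D * (\<Prod>x\<in>D. real (card S) * of_bool (b x = b' x) - 1))"
    by (simp, subst sum.swap, subst sum.swap) (simp add: sum.swap[of _ B "Pow Q"])
  then show ?thesis
    by (simp add: noise_form_def agreement_weight_def sum_divide_distrib sum_distrib_left)
qed

text \<open>Every term of the expanded noise form is nonnegative, so the d-subsets of Q alone stay
  below K; averaging over the images of Q under even permutations turns them into all
  d-sets.\<close>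

lemma mean_weight_le_noise_form:
  fixes \<rho> :: real
  assumes S: "finite S" "S \<noteq> {}" and B: "B \<subseteq> AltS S" and q: "q \<le> card S" and d: "d \<le> q" "d + 2 \<le> card S"
    and \<rho>: "\<rho> \<ge> 0" and bd: "\<And>Q. Q \<subseteq> S \<Longrightarrow> card Q = q \<Longrightarrow> noise_form S B \<rho> Q \<le> K"
  shows "(q choose d) * \<rho> ^ d * mean_weight S B d \<le> K"
proof -
  let ?G = "AltS S"
  have cG: "card ?G > 0" by (rule card_AltS_pos[OF S(1)])
  obtain Q where Q: "Q \<subseteq> S" "card Q = q" "finite Q"
    using q by (rule obtain_subset_with_card_n)
  let ?I = "{D. D \<subseteq> Q \<and> card D = d}"
  have fI: "finite ?I" using Q by simp
  have "real (card ?G) * ((q choose d) * \<rho> ^ d * mean_weight S B d)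
      = (\<Sum>D\<in>?I. \<rho> ^ d * (card ?G * mean_weight S B d))"
    using n_subsets[OF Q(3), of d] Q(2) by simp
  also have "\<dots> = (\<Sum>D\<in>?I. \<rho> ^ d * (\<Sum>g\<in>?G. agreement_weight S B (g ` D)))"
  proof (rule sum.cong[OF refl])
    fix D assume "D \<in> ?I"
    then have "D \<subseteq> S" "card D = d" using Q by auto
    then show "\<rho> ^ d * (card ?G * mean_weight S B d) = \<rho> ^ d * (\<Sum>g\<in>?G. agreement_weight S B (g ` D))"
      using sum_AltS_weight[OF S(1), of D B] d by simp
  qed
  also have "\<dots> = (\<Sum>g\<in>?G. \<Sum>D\<in>?I. \<rho> ^ d * agreement_weight S B (g ` D))"
    by (subst sum.swap) (simp add: sum_distrib_left)
  also have "\<dots> \<le> (\<Sum>g\<in>?G. K)"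
  proof (rule sum_mono)
    fix g assume g: "g \<in> ?G"
    have inj: "inj g" using AltS_bij[OF g] bij_is_inj by blast
    have gQ: "g ` Q \<subseteq> S"
      using Q(1) AltS_permutes[OF g] by (metis image_mono permutes_image)
    have cgQ: "card (g ` Q) = q"
      using Q(2) inj by (simp add: card_image inj_on_subset)
    have "(\<Sum>D\<in>?I. \<rho> ^ d * agreement_weight S B (g ` D))
        = (\<Sum>D\<in>(\<lambda>D. g ` D) ` ?I. \<rho> ^ card D * agreement_weight S B D)"
    proof (subst sum.reindex)
      show "inj_on ((`) g) ?I" using inj by (simp add: inj_on_def inj_image_eq_iff)
      show "(\<Sum>D\<in>?I. \<rho> ^ d * agreement_weight S B (g ` D))
          = sum ((\<lambda>D. \<rho> ^ card D * agreement_weight S B D) \<circ> (`) g) ?I"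
        using inj by (intro sum.cong refl) (auto simp: card_image inj_on_subset)
    qed
    also have "\<dots> \<le> (\<Sum>D\<in>Pow (g ` Q). \<rho> ^ card D * agreement_weight S B D)"
    proof (rule sum_mono2)
      show "finite (Pow (g ` Q))" using Q(3) by simp
      show "(`) g ` ?I \<subseteq> Pow (g ` Q)" by auto
      fix D assume "D \<in> Pow (g ` Q) - (`) g ` ?I"
      then have "D \<subseteq> S" using gQ by blast
      then show "0 \<le> \<rho> ^ card D * agreement_weight S B D"
        using \<rho> agreement_weight_nonneg[OF S B] by simp
    qed
    also have "\<dots> = noise_form S B \<rho> (g ` Q)"
      using Q(3) by (simp add: noise_form_eq)
    also have "\<dots> \<le> K" by (rule bd[OF gQ cgQ])
    finally show "(\<Sum>D\<in>?I. \<rho> ^ d * agreement_weight S B (g ` D)) \<le> K" .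
  qed
  also have "\<dots> = real (card ?G) * K" by simp
  finally show ?thesis using cG by simp
qed

text \<open>The $p$-th moment of \<open>\<lambda>g. \<E> \<Prod>x\<in>Q. 1 - \<rho> + \<rho> N [b x = g x]\<close> under the uniform
  measure compares its mean under \<open>B\<close> with $e^{s/p}$ times its $L^p$ norm.\<close>

lemma noise_form_moment:
  fixes s r \<rho> :: real
  assumes S: "finite S" "S \<noteq> {}" and B: "B \<subseteq> AltS S" "B \<noteq> {}"
    and dens: "card (AltS S) \<le> exp s * card B"
    and Q: "Q \<subseteq> S" "real (card Q) \<le> real (card S) / 4" "card Q + 2 \<le> card S"
    and spread: "\<And>D w. D \<subseteq> S \<Longrightarrow> card D \<le> card Q \<Longrightarrow>
      card {b \<in> B. \<forall>x\<in>D. b x = w x} * (fact (card S) / fact (card S - card D)) \<le> r ^ card D * card B"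
    and r: "r \<ge> 1" and p: "p \<ge> 1" and \<rho>: "\<rho> > 0" "p * \<rho> * r \<le> 1 / 100"
  shows "noise_form S B \<rho> Q ^ p \<le> 2 * exp (s + 3 * card S * (p * \<rho> * r)\<^sup>2)"
proof -
  let ?G = "AltS S"
  define N where "N = real (card S)"
  define q where "q = card Q"
  have N: "N > 0" using S by (simp add: N_def card_gt_0_iff)
  have fG: "finite ?G" by (rule finite_AltS[OF S(1)])
  have fB: "finite B" using B fG finite_subset by blast
  have cB: "real (card B) > 0" using fB B by (simp add: card_gt_0_iff)
  have fQ: "finite Q" using Q S finite_subset by blast
  have p\<rho>: "real p * \<rho> \<le> 1 / 100" "\<rho> \<le> 1 / 100" "\<rho> \<le> real p * \<rho>"
  proof -
    have "real p * \<rho> * 1 \<le> real p * \<rho> * r" using r \<rho> by (intro mult_left_mono) auto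
    then show "real p * \<rho> \<le> 1 / 100" using \<rho> by linarith
    moreover show "\<rho> \<le> real p * \<rho>" using p \<rho> by (simp add: mult_le_cancel_right1)
    ultimately show "\<rho> \<le> 1 / 100" by linarith
  qed
  \<comment> \<open>Chosen so that 1 - \<rho> + \<rho> N [A] = (1 - \<rho>) (1 + z [A]) for every
    condition A.\<close>
  define z where "z = \<rho> * N / (1 - \<rho>)"
  have \<rho>1: "\<rho> < 1" using p\<rho>(2) by linarith
  have z: "z \<ge> 0" using \<rho> \<rho>1 N by (simp add: z_def)
  have zN: "z / N = \<rho> / (1 - \<rho>)" using N by (simp add: z_def)
  have \<rho>z: "(1 - \<rho>) * z = \<rho> * N" using p\<rho> by (simp add: z_def)
  \<comment> \<open>This is r divided by 3 N / 4: for |D| \<le> N / 4 the falling factorial N! / (N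
    - |D|)! is at least (3 N / 4)^|D|.\<close>
  define \<epsilon> where "\<epsilon> = 4 * r / (3 * N)"
  have \<epsilon>: "\<epsilon> \<ge> 0" using r N by (simp add: \<epsilon>_def)
  \<comment> \<open>Large enough for e^(-c) to absorb the linear term of the crude product, which is
    at most 8 p \<rho> per point; small enough that c / N \<le> 2 p \<rho> keeps the excess of
    \<open>g1\<close> over 1 of first order in p \<rho>.\<close>
  define c where "c = 8 * p * q * \<rho>"
  have q4: "real q \<le> N / 4" using Q(2) by (simp add: q_def N_def)
  have cN: "0 \<le> c" "c / N \<le> 2 * (p * \<rho>)" "c < N"
  proof -
    show "0 \<le> c" using \<rho> by (simp add: c_def)
    have "c = 8 * p * \<rho> * q" by (simp add: c_def)
    also have "\<dots> \<le> 8 * p * \<rho> * (N / 4)" using q4 \<rho> by (intro mult_left_mono) auto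
    finally have "c \<le> 8 * p * \<rho> * (N / 4)" .
    then show *: "c / N \<le> 2 * (p * \<rho>)" using N by (simp add: field_simps)
    then have "c / N < 1" using p\<rho> by linarith
    then show "c < N" using N by (simp add: field_simps)
  qed
  define g1 where "g1 = 1 / (1 - c / N)"
  define g2 :: real where "g2 = 4 * exp 1 / 3"
  have g1: "1 \<le> g1" "g1 \<le> 4 / 3"
  proof -
    have c1: "0 \<le> c / N" using cN(1) N by simp
    have c2: "c / N \<le> 1 / 50" using cN(2) p\<rho>(1) by linarith
    define y where "y = c / N"
    have "0 \<le> y" "y \<le> 1 / 50" using c1 c2 by (auto simp: y_def)
    then show "1 \<le> g1" "g1 \<le> 4 / 3" unfolding g1_def y_def[symmetric] by (auto simp: field_simps)
  qed
  have g2: "0 \<le> g2" "g2 \<le> 4" unfolding g2_def using exp_le by auto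
  have eps_spread: "real (card {b \<in> B. \<forall>x\<in>D. b x = w x}) \<le> card B * \<epsilon> ^ card D" if D: "D \<subseteq> Q" for D w
  proof -
    have cD: "card D \<le> card Q" by (rule card_mono[OF fQ D])
    then have cD4: "real (card D) \<le> N / 4" using q4 by (simp add: q_def)
    have "(3 * N / 4) ^ card D \<le> (N - real (card D)) ^ card D"
      using cD4 N by (intro power_mono) auto
    also have "\<dots> \<le> fact (card S) / fact (card S - card D)"
      unfolding N_def using cD Q(3) by (intro fact_ratio_ge_power) auto
    finally have "card {b \<in> B. \<forall>x\<in>D. b x = w x} * (3 * N / 4) ^ card D
        \<le> card {b \<in> B. \<forall>x\<in>D. b x = w x} * (fact (card S) / fact (card S - card D))"
      by (intro mult_left_mono) auto
    also have "\<dots> \<le> r ^ card D * card B" using D Q(1) cD by (intro spread) auto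
    finally have "real (card {b \<in> B. \<forall>x\<in>D. b x = w x}) \<le> r ^ card D * card B / (3 * N / 4) ^ card D"
      using N by (subst pos_le_divide_eq) auto
    also have "\<dots> = card B * (r / (3 * N / 4)) ^ card D" by (simp add: power_divide)
    also have "r / (3 * N / 4) = \<epsilon>" by (simp add: \<epsilon>_def)
    finally show ?thesis .
  qed
  define \<zeta> where "\<zeta> = z * \<epsilon>"
  have \<zeta>: "0 \<le> \<zeta>" "real p * \<zeta> \<le> 3 / 2 * (p * \<rho> * r)" "real p * \<zeta> \<le> 1"
  proof -
    show "0 \<le> \<zeta>" unfolding \<zeta>_def using z \<epsilon> by simp
    have "\<zeta> = (z / N) * (4 / 3 * r)" unfolding \<zeta>_def \<epsilon>_def using N by simp
    also have "\<dots> \<le> (9 / 8 * \<rho>) * (4 / 3 * r)"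
      unfolding zN using p\<rho> \<rho> r by (intro mult_right_mono) (auto simp: field_simps)
    finally have "\<zeta> \<le> 3 / 2 * (\<rho> * r)" by simp
    then have "real p * \<zeta> \<le> real p * (3 / 2 * (\<rho> * r))" by (intro mult_left_mono) auto
    then show *: "real p * \<zeta> \<le> 3 / 2 * (p * \<rho> * r)" by (simp add: algebra_simps)
    then show "real p * \<zeta> \<le> 1" using \<rho> by linarith
  qed
  define X where "X = (p * \<rho> * r)\<^sup>2"
  have p\<zeta>2: "(real p * \<zeta>)\<^sup>2 \<le> 9 / 4 * X"
  proof -
    have "(real p * \<zeta>)\<^sup>2 \<le> (3 / 2 * (p * \<rho> * r))\<^sup>2" using \<zeta> by (intro power_mono) auto
    then show ?thesis by (simp add: X_def power_mult_distrib power2_eq_square)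
  qed
  have X0: "X \<ge> 0" by (simp add: X_def)
  have p\<rho>X: "(real p * \<rho>)\<^sup>2 \<le> X"
      using mult_left_mono[OF r, of "real p * \<rho>"] \<rho> unfolding X_def by (intro power_mono) auto
  let ?P = "{J. J \<subseteq> {..<p} \<and> card J \<ge> 2}"
  \<comment> \<open>The excess over 1 of the product of the p copies, for the value y at the point
    x. Its sum over y has the main term p z, and \<eta> collects the coincidences of two or more
    copies.\<close>
  define \<theta> where "\<theta> \<beta> x y = (\<Prod>j<p. 1 + z * of_bool (\<beta> j x = y)) - 1" for \<beta> :: "nat \<Rightarrow> 'a \<Rightarrow> 'a" and x y :: 'a
  have \<theta>0: "\<theta> \<beta> x y \<ge> 0" for \<beta> x y
    unfolding \<theta>_def using z prod_ge_1[of "{..<p}" "\<lambda>j. 1 + z * of_bool (\<beta> j x = y)"] by auto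
  define \<eta> where "\<eta> \<beta> x = (\<Sum>y\<in>S. \<Sum>J\<in>?P. z ^ card J * of_bool (\<forall>j\<in>J. \<beta> j x = y))"
    for \<beta> :: "nat \<Rightarrow> 'a \<Rightarrow> 'a" and x :: 'a
  have \<eta>0: "\<eta> \<beta> x \<ge> 0" for \<beta> x unfolding \<eta>_def using z by (intro sum_nonneg) auto
  have \<theta>sum: "(\<Sum>y\<in>S. \<theta> \<beta> x y) = p * z + \<eta> \<beta> x" if \<beta>: "\<beta> \<in> {..<p} \<rightarrow>\<^sub>E B" and x: "x \<in> Q" for \<beta> x
  proof -
    let ?R = "(\<lambda>j. {j}) ` {..<p}"
    let ?h = "\<lambda>y J. z ^ card J * of_bool (\<forall>j\<in>J. \<beta> j x = y)"
    have \<theta>y: "\<theta> \<beta> x y = (\<Sum>J\<in>?P. ?h y J) + (\<Sum>j<p. z * of_bool (\<beta> j x = y))" for y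
    proof -
      have fin: "finite J" if "J \<subseteq> {..<p}" for J using that finite_subset by blast
      have "(\<Prod>j<p. 1 + z * of_bool (\<beta> j x = y)) = (\<Sum>J\<in>Pow {..<p}. \<Prod>j\<in>J. z * of_bool (\<beta> j x = y))"
        by (rule sum_Pow_prod[symmetric]) simp
      also have "\<dots> = (\<Sum>J\<in>Pow {..<p}. ?h y J)"
        using fin by (intro sum.cong refl) (auto simp: prod.distrib)
      also have "Pow {..<p} = insert {} (?P \<union> ?R)"
      proof -
        have "J \<in> insert {} ?R" if J: "J \<subseteq> {..<p}" "\<not> card J \<ge> 2" for J
        proof -
          consider "card J = 0" | "card J = 1" using J(2) by linarith
          then show ?thesis
          proof cases
            case 1
            then show ?thesis using fin[OF J(1)] by simp
          next
            case 2
            then obtain j where "J = {j}" by (auto simp: card_1_singleton_iff)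
            then show ?thesis using J by auto
          qed
        qed
        then show ?thesis by auto
      qed
      also have "(\<Sum>J\<in>insert {} (?P \<union> ?R). ?h y J) = 1 + (\<Sum>J\<in>?P \<union> ?R. ?h y J)"
        by (subst sum.insert) (auto intro: finite_subset[of _ "Pow {..<p}"])
      also have "(\<Sum>J\<in>?P \<union> ?R. ?h y J) = (\<Sum>J\<in>?P. ?h y J) + (\<Sum>J\<in>?R. ?h y J)"
        by (rule sum.union_disjoint) (auto intro: finite_subset[of _ "Pow {..<p}"])
      also have "(\<Sum>J\<in>?R. ?h y J) = (\<Sum>j<p. z * of_bool (\<beta> j x = y))"
        by (subst sum.reindex) (auto simp: inj_on_def)
      finally show ?thesis by (simp add: \<theta>_def)
    qed
    have "(\<Sum>y\<in>S. \<theta> \<beta> x y) = (\<Sum>y\<in>S. (\<Sum>J\<in>?P. ?h y J) + (\<Sum>j<p. z * of_bool (\<beta> j x = y)))"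
      by (rule sum.cong[OF refl]) (rule \<theta>y)
    also have "\<dots> = \<eta> \<beta> x + (\<Sum>j<p. \<Sum>y\<in>S. z * of_bool (\<beta> j x = y))"
      unfolding sum.distrib \<eta>_def by (intro arg_cong2[of _ _ _ _ "(+)"] refl sum.swap)
    also have "(\<Sum>j<p. \<Sum>y\<in>S. z * of_bool (\<beta> j x = y)) = (\<Sum>j<p. z)"
    proof (rule sum.cong[OF refl])
      fix j assume "j \<in> {..<p}"
      then have "\<beta> j \<in> B" using \<beta> by auto
      then have "\<beta> j permutes S" using B AltS_permutes by blast
      then have "\<beta> j x \<in> S" using x Q(1) by (auto simp: permutes_in_image)
      then show "(\<Sum>y\<in>S. z * of_bool (\<beta> j x = y)) = z" using S by simp
    qed
    finally show ?thesis by simp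
  qed
  \<comment> \<open>The exponent separates the linear term, \<gamma> p \<rho> / (1 - \<rho>) per
    point, from the coincidences, which contribute only at second order.\<close>
  have collision: "(\<Sum>\<beta>\<in>{..<p} \<rightarrow>\<^sub>E B. \<Prod>x\<in>Q. 1 + \<gamma> / N * (\<Sum>y\<in>S. \<theta> \<beta> x y))
      \<le> real (card B) ^ p * exp (q * (\<gamma> * (p * \<rho> / (1 - \<rho>)) + \<gamma> * (9 / 4 * X)))" if \<gamma>: "\<gamma> \<ge> 0" for \<gamma>
  proof -
    let ?a = "1 + \<gamma> * (p * (z / N))"
    have a: "?a \<ge> 1" using \<gamma> z N by simp
    have "(\<Sum>\<beta>\<in>{..<p} \<rightarrow>\<^sub>E B. \<Prod>x\<in>Q. 1 + \<gamma> / N * (\<Sum>y\<in>S. \<theta> \<beta> x y))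
        \<le> (\<Sum>\<beta>\<in>{..<p} \<rightarrow>\<^sub>E B. \<Prod>x\<in>Q. ?a * (1 + \<gamma> / N * \<eta> \<beta> x))"
    proof (intro sum_mono prod_mono conjI)
      fix \<beta> x assume \<beta>: "\<beta> \<in> {..<p} \<rightarrow>\<^sub>E B" and x: "x \<in> Q"
      show "0 \<le> 1 + \<gamma> / N * (\<Sum>y\<in>S. \<theta> \<beta> x y)"
        using \<gamma> N \<theta>0 by (intro add_nonneg_nonneg mult_nonneg_nonneg sum_nonneg) auto
      have "1 + \<gamma> / N * (\<Sum>y\<in>S. \<theta> \<beta> x y) = ?a + \<gamma> / N * \<eta> \<beta> x"
        unfolding \<theta>sum[OF \<beta> x] by (simp add: algebra_simps)
      also have "\<dots> \<le> ?a + ?a * (\<gamma> / N * \<eta> \<beta> x)"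
        using mult_right_mono[OF a, of "\<gamma> / N * \<eta> \<beta> x"] \<eta>0 \<gamma> N by simp
      finally show "1 + \<gamma> / N * (\<Sum>y\<in>S. \<theta> \<beta> x y) \<le> ?a * (1 + \<gamma> / N * \<eta> \<beta> x)"
        by (simp add: distrib_left)
    qed
    also have "\<dots> = ?a ^ q * (\<Sum>\<beta>\<in>{..<p} \<rightarrow>\<^sub>E B. \<Prod>x\<in>Q. 1 + \<gamma> / N * \<eta> \<beta> x)"
      by (simp add: prod.distrib sum_distrib_left q_def)
    also have "\<dots> \<le> ?a ^ q * (real (card B) ^ p * (1 + \<gamma> * (\<Sum>J\<in>?P. \<zeta> ^ card J)) ^ q)"
      using collision_moment[OF S fB Q(1) eps_spread z \<gamma> \<epsilon>, of p] a
      unfolding \<eta>_def N_def q_def \<zeta>_def by (intro mult_left_mono) auto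
    also have "\<dots> \<le> exp (\<gamma> * (p * (z / N))) ^ q * (real (card B) ^ p * exp (\<gamma> * (9 / 4 * X)) ^ q)"
    proof -
      have P0: "0 \<le> (\<Sum>J\<in>?P. \<zeta> ^ card J)" using \<zeta> by (intro sum_nonneg) auto
      have "(\<Sum>J\<in>?P. \<zeta> ^ card J) \<le> 9 / 4 * X"
        using sum_Pow_power_ge2[OF \<zeta>(1,3)] p\<zeta>2 by linarith
      then have "1 + \<gamma> * (\<Sum>J\<in>?P. \<zeta> ^ card J) \<le> 1 + \<gamma> * (9 / 4 * X)"
        using \<gamma> by (intro add_left_mono mult_left_mono) auto
      also have "\<dots> \<le> exp (\<gamma> * (9 / 4 * X))" by (rule exp_ge_add_one_self)
      finally have 1: "(1 + \<gamma> * (\<Sum>J\<in>?P. \<zeta> ^ card J)) ^ q \<le> exp (\<gamma> * (9 / 4 * X)) ^ q"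
        using P0 \<gamma> by (intro power_mono) auto
      have 2: "?a ^ q \<le> exp (\<gamma> * (p * (z / N))) ^ q"
        using a by (intro power_mono exp_ge_add_one_self) linarith
      show ?thesis
        using 1 2 a P0 \<gamma> by (intro mult_mono mult_left_mono) auto
    qed
    also have "\<dots> = real (card B) ^ p * exp (q * (\<gamma> * (p * \<rho> / (1 - \<rho>)) + \<gamma> * (9 / 4 * X)))"
      unfolding zN by (simp add: exp_add distrib_left flip: exp_of_nat_mult)
    finally show ?thesis .
  qed
  define \<Psi> where "\<Psi> g = (\<Sum>b\<in>B. \<Prod>x\<in>Q. 1 - \<rho> + \<rho> * N * of_bool (b x = g x)) / card B" for g :: "'a \<Rightarrow> 'a"
  have \<Psi>0: "\<Psi> g \<ge> 0" for g
    unfolding \<Psi>_def using \<rho> \<rho>1 N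
    by (intro divide_nonneg_nonneg sum_nonneg prod_nonneg ballI add_nonneg_nonneg) auto
  \<comment> \<open>The p-th power of a mean over B is a mean over p independent elements of B;
    exchanging the products over j and x then gives one factor per point.\<close>
  have \<Psi>p: "\<Psi> g ^ p = (1 - \<rho>) ^ (p * q) * (\<Sum>\<beta>\<in>{..<p} \<rightarrow>\<^sub>E B. \<Prod>x\<in>Q. 1 + \<theta> \<beta> x (g x)) / card B ^ p" for g
  proof -
    have fac: "1 - \<rho> + \<rho> * N * of_bool A = (1 - \<rho>) * (1 + z * of_bool A)" for A
      by (simp add: distrib_left \<rho>z flip: mult.assoc)
    have "\<Psi> g ^ p = (\<Sum>\<beta>\<in>{..<p} \<rightarrow>\<^sub>E B. \<Prod>j<p. \<Prod>x\<in>Q. (1 - \<rho>) * (1 + z * of_bool (\<beta> j x = g x))) / card B ^ p"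
      unfolding \<Psi>_def fac power_divide sum_power_PiE[OF fB] by simp
    also have "(\<Sum>\<beta>\<in>{..<p} \<rightarrow>\<^sub>E B. \<Prod>j<p. \<Prod>x\<in>Q. (1 - \<rho>) * (1 + z * of_bool (\<beta> j x = g x)))
        = (\<Sum>\<beta>\<in>{..<p} \<rightarrow>\<^sub>E B. (1 - \<rho>) ^ (p * q) * (\<Prod>x\<in>Q. 1 + \<theta> \<beta> x (g x)))"
    proof (rule sum.cong[OF refl])
      fix \<beta>
      have "(\<Prod>j<p. \<Prod>x\<in>Q. (1 - \<rho>) * (1 + z * of_bool (\<beta> j x = g x)))
          = (\<Prod>j<p. (1 - \<rho>) ^ q) * (\<Prod>j<p. \<Prod>x\<in>Q. 1 + z * of_bool (\<beta> j x = g x))"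
        by (simp add: prod.distrib q_def)
      also have "(\<Prod>j<p. \<Prod>x\<in>Q. 1 + z * of_bool (\<beta> j x = g x)) = (\<Prod>x\<in>Q. \<Prod>j<p. 1 + z * of_bool (\<beta> j x = g x))"
        by (rule prod.swap)
      finally show "(\<Prod>j<p. \<Prod>x\<in>Q. (1 - \<rho>) * (1 + z * of_bool (\<beta> j x = g x)))
          = (1 - \<rho>) ^ (p * q) * (\<Prod>x\<in>Q. 1 + \<theta> \<beta> x (g x))"
        by (simp add: \<theta>_def mult.commute flip: power_mult)
    qed
    finally show ?thesis by (simp add: sum_distrib_left)
  qed
  have K0: "0 \<le> (1 - \<rho>) ^ (p * q) / card B ^ p" using \<rho>1 by simp
  have "(\<Sum>g\<in>?G. \<Psi> g ^ p) = (1 - \<rho>) ^ (p * q) / card B ^ p *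
      (\<Sum>\<beta>\<in>{..<p} \<rightarrow>\<^sub>E B. \<Sum>g\<in>?G. \<Prod>x\<in>Q. 1 + \<theta> \<beta> x (g x))"
    unfolding \<Psi>p by (subst sum.swap) (simp add: sum_distrib_left sum_divide_distrib)
  also have "\<dots> \<le> (1 - \<rho>) ^ (p * q) / card B ^ p * (\<Sum>\<beta>\<in>{..<p} \<rightarrow>\<^sub>E B. card ?G *
      ((\<Prod>x\<in>Q. 1 + g1 / N * (\<Sum>y\<in>S. \<theta> \<beta> x y)) + exp (- c) * (\<Prod>x\<in>Q. 1 + g2 / N * (\<Sum>y\<in>S. \<theta> \<beta> x y))))"
  proof (intro mult_left_mono sum_mono K0)
    fix \<beta>
    show "(\<Sum>g\<in>?G. \<Prod>x\<in>Q. 1 + \<theta> \<beta> x (g x)) \<le> card ?G *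
        ((\<Prod>x\<in>Q. 1 + g1 / N * (\<Sum>y\<in>S. \<theta> \<beta> x y)) + exp (- c) * (\<Prod>x\<in>Q. 1 + g2 / N * (\<Sum>y\<in>S. \<theta> \<beta> x y)))"
      unfolding g1_def g2_def N_def
      by (rule uniform_product_moment[OF S Q \<theta>0 cN(1) cN(3)[unfolded N_def]])
  qed
  also have "\<dots> = (1 - \<rho>) ^ (p * q) / card B ^ p * (card ?G *
      ((\<Sum>\<beta>\<in>{..<p} \<rightarrow>\<^sub>E B. \<Prod>x\<in>Q. 1 + g1 / N * (\<Sum>y\<in>S. \<theta> \<beta> x y))
        + exp (- c) * (\<Sum>\<beta>\<in>{..<p} \<rightarrow>\<^sub>E B. \<Prod>x\<in>Q. 1 + g2 / N * (\<Sum>y\<in>S. \<theta> \<beta> x y))))"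
    by (simp add: sum.distrib flip: sum_distrib_left)
  also have "\<dots> \<le> (1 - \<rho>) ^ (p * q) / card B ^ p * (card ?G *
      (real (card B) ^ p * exp (q * (g1 * (p * \<rho> / (1 - \<rho>)) + g1 * (9 / 4 * X)))
        + exp (- c) * (real (card B) ^ p * exp (q * (g2 * (p * \<rho> / (1 - \<rho>)) + g2 * (9 / 4 * X))))))"
    using g1 g2 by (intro mult_left_mono add_mono collision K0) auto
  also have "\<dots> = card ?G * ((1 - \<rho>) ^ (p * q) *
      (exp (q * (g1 * (p * \<rho> / (1 - \<rho>)) + g1 * (9 / 4 * X)))
        + exp (- c + q * (g2 * (p * \<rho> / (1 - \<rho>)) + g2 * (9 / 4 * X)))))"
  proof -
    have "K / P * (R * (P * E1 + t * (P * E2))) = R * (K * (E1 + t * E2))" if "P > 0" for K P R E1 E2 t :: real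
      using that by (simp add: field_simps)
    then show ?thesis unfolding exp_add of_nat_power using cB by simp
  qed
  also have "\<dots> \<le> card ?G * (exp (- \<rho> * (p * q)) *
      (exp (q * (g1 * (p * \<rho> / (1 - \<rho>)) + g1 * (9 / 4 * X)))
        + exp (- c + q * (g2 * (p * \<rho> / (1 - \<rho>)) + g2 * (9 / 4 * X)))))"
  proof -
    have "(1 - \<rho>) ^ (p * q) \<le> exp (- \<rho>) ^ (p * q)"
      using p\<rho> exp_ge_add_one_self[of "- \<rho>"] by (intro power_mono) auto
    also have "\<dots> = exp (- \<rho> * (p * q))" by (simp add: mult.commute flip: exp_of_nat_mult)
    finally show ?thesis by (intro mult_left_mono mult_right_mono) auto
  qed
  also have "\<dots> = card ?G * (exp (q * (g1 * (p * \<rho> / (1 - \<rho>)) - p * \<rho> + g1 * (9 / 4 * X)))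
        + exp (- c + q * (g2 * (p * \<rho> / (1 - \<rho>)) - p * \<rho> + g2 * (9 / 4 * X))))"
    by (simp add: distrib_left algebra_simps flip: exp_add)
  also have "\<dots> \<le> card ?G * (exp (3 * N * X) + exp (3 * N * X))"
  proof -
    \<comment> \<open>In the main product the normalisation (1 - \<rho>)^(p q) cancels the linear
      term p \<rho>. What remains is at most 4 X + 3 X per point, and there are at most N / 4
      points.\<close>
    have 1: "q * (g1 * (p * \<rho> / (1 - \<rho>)) - p * \<rho> + g1 * (9 / 4 * X)) \<le> 3 * N * X"
    proof -
      define y where "y = real p * \<rho>"
      have y: "y \<le> 1 / 100" "\<rho> \<le> y" "0 \<le> y" using p\<rho> \<rho> by (auto simp: y_def)
      have "(1 - c / N) * (1 - \<rho>) \<ge> 1 - 3 * y"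
      proof -
        have "(1 - c / N) * (1 - \<rho>) = 1 - c / N - \<rho> + c / N * \<rho>"
          by (simp add: left_diff_distrib right_diff_distrib)
        moreover have "0 \<le> c / N * \<rho>" using cN N \<rho> by simp
        ultimately show ?thesis using cN(2) y by (simp add: y_def)
      qed
      then have "g1 / (1 - \<rho>) \<le> 1 / (1 - 3 * y)"
        unfolding g1_def using y by (simp add: frac_le)
      also have "\<dots> \<le> 1 + 4 * y"
      proof -
        have "1 \<le> (1 + 4 * y) * (1 - 3 * y)"
        proof -
          have "(1 + 4 * y) * (1 - 3 * y) = 1 + y * (1 - 12 * y)" by (simp add: algebra_simps)
          then show ?thesis using y by simp
        qed
        then show ?thesis using y by (simp add: field_simps)
      qed
      finally have "y * (g1 / (1 - \<rho>)) \<le> y * (1 + 4 * y)" using y by (intro mult_left_mono)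
      then have "g1 * (p * \<rho> / (1 - \<rho>)) - p * \<rho> \<le> 4 * y\<^sup>2"
        by (simp add: y_def power2_eq_square algebra_simps)
      also have "\<dots> \<le> 4 * X" using p\<rho>X by (simp add: y_def)
      finally have "g1 * (p * \<rho> / (1 - \<rho>)) - p * \<rho> \<le> 4 * X" .
      moreover have "g1 * (9 / 4 * X) \<le> 4 / 3 * (9 / 4 * X)" using g1 X0 by (intro mult_right_mono) auto
      ultimately have "g1 * (p * \<rho> / (1 - \<rho>)) - p * \<rho> + g1 * (9 / 4 * X) \<le> 7 * X" by linarith
      then have "q * (g1 * (p * \<rho> / (1 - \<rho>)) - p * \<rho> + g1 * (9 / 4 * X)) \<le> q * (7 * X)"
        by (intro mult_left_mono) auto
      also have "\<dots> \<le> N / 4 * (7 * X)" using q4 X0 by (intro mult_right_mono) auto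
      also have "\<dots> \<le> 3 * N * X" using N X0 by (simp add: mult_right_mono)
      finally show ?thesis .
    qed
    \<comment> \<open>In the crude product nothing has to cancel, because c pays for the linear
      term.\<close>
    have 2: "- c + q * (g2 * (p * \<rho> / (1 - \<rho>)) - p * \<rho> + g2 * (9 / 4 * X)) \<le> 3 * N * X"
    proof -
      have "p * \<rho> / (1 - \<rho>) \<le> 2 * (p * \<rho>)"
        using p\<rho> \<rho> by (subst pos_divide_le_eq) (auto simp: algebra_simps intro: mult_left_mono)
      then have "g2 * (p * \<rho> / (1 - \<rho>)) \<le> 4 * (2 * (p * \<rho>))"
        using g2 \<rho> \<rho>1 by (intro mult_mono) auto
      moreover have "g2 * (9 / 4 * X) \<le> 4 * (9 / 4 * X)" using g2 X0 by (intro mult_right_mono) auto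
      moreover have "0 \<le> real p * \<rho>" using \<rho> by simp
      ultimately have "g2 * (p * \<rho> / (1 - \<rho>)) - p * \<rho> + g2 * (9 / 4 * X) \<le> 8 * (p * \<rho>) + 9 * X"
        by linarith
      then have "q * (g2 * (p * \<rho> / (1 - \<rho>)) - p * \<rho> + g2 * (9 / 4 * X)) \<le> q * (8 * (p * \<rho>) + 9 * X)"
        by (intro mult_left_mono) auto
      also have "\<dots> = c + q * (9 * X)" by (simp add: c_def algebra_simps)
      finally have "- c + q * (g2 * (p * \<rho> / (1 - \<rho>)) - p * \<rho> + g2 * (9 / 4 * X)) \<le> q * (9 * X)" by simp
      also have "\<dots> \<le> N / 4 * (9 * X)" using q4 X0 by (intro mult_right_mono) auto
      also have "\<dots> \<le> 3 * N * X" using N X0 by (simp add: mult_right_mono)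
      finally show ?thesis .
    qed
    show ?thesis using 1 2 by (intro mult_left_mono add_mono) auto
  qed
  finally have mom: "(\<Sum>g\<in>?G. \<Psi> g ^ p) \<le> card ?G * (2 * exp (3 * N * X))" by simp
  have "noise_form S B \<rho> Q = (\<Sum>b\<in>B. \<Psi> b) / card B"
    unfolding noise_form_def \<Psi>_def N_def
    by (subst sum.swap) (simp add: power2_eq_square sum_divide_distrib)
  then have "noise_form S B \<rho> Q ^ p \<le> (\<Sum>b\<in>B. \<Psi> b ^ p) / card B"
    using mean_power_le[OF fB B(2), of \<Psi> p] \<Psi>0 by simp
  \<comment> \<open>Change of measure: \<Psi> is nonnegative, so the sum over B is extended to the
    whole group, and the relative size of B enters as the factor e^s.\<close>
  also have "\<dots> \<le> (\<Sum>g\<in>?G. \<Psi> g ^ p) / card B"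
    using \<Psi>0 B fG by (intro divide_right_mono sum_mono2) auto
  also have "\<dots> \<le> card ?G * (2 * exp (3 * N * X)) / card B"
    by (rule divide_right_mono[OF mom]) simp
  also have "\<dots> \<le> (exp s * card B) * (2 * exp (3 * N * X)) / card B"
    by (intro divide_right_mono mult_right_mono dens) auto
  also have "\<dots> = 2 * exp (s + 3 * N * X)" using cB by (simp add: exp_add)
  finally show ?thesis by (simp add: N_def X_def)
qed

lemma mean_weight_bound:
  fixes s r :: real
  assumes S: "finite S" and B: "B \<subseteq> AltS S" "B \<noteq> {}"
    and dens: "card (AltS S) \<le> exp s * card B"
    and spread: "\<And>D w. D \<subseteq> S \<Longrightarrow> card D \<le> card S div 4 \<Longrightarrow>
      card {b \<in> B. \<forall>x\<in>D. b x = w x} * (fact (card S) / fact (card S - card D)) \<le> r ^ card D * card B"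
    and s: "1 \<le> s" "10 ^ 6 * s \<le> card S" and r: "1 \<le> r" and d: "1 \<le> d" "real d \<le> 20 * s"
  shows "mean_weight S B d \<le> (1350 * r * sqrt (s / card S)) ^ d"
proof -
  define N where "N = real (card S)"
  define q where "q = card S div 4"
  define p where "p = nat \<lceil>s / d\<rceil>"
  \<comment> \<open>With T = p d between s and 21 s, this choice gives p \<rho> r = T / (10 sqrt (s
    N)), hence 3 N (p \<rho> r)^2 \<le> 63/100 T. The p-th power of the noise form is then at most
    e^(3 T), the p-th power of e^(3 d).\<close>
  define \<rho> where "\<rho> = real d / (10 * r * sqrt (s * N))"
  define T where "T = real p * real d"
  have N: "N \<ge> 10 ^ 6" using s by (simp add: N_def)
  have S0: "S \<noteq> {}" using N by (auto simp: N_def)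
  have q: "N / 5 \<le> q" "q \<le> N / 4" "q + 2 \<le> card S"
  proof -
    have "card S < 4 * q + 4" "4 * q \<le> card S" by (auto simp: q_def)
    then have "real (card S) < 4 * real q + 4" "4 * real q \<le> real (card S)" by linarith+
    then show "N / 5 \<le> q" "q \<le> N / 4" using N by (auto simp: N_def)
    then have "real (q + 2) \<le> real (card S)" using N by (simp add: N_def)
    then show "q + 2 \<le> card S" by linarith
  qed
  have dq: "d \<le> q" using q d s by (simp add: N_def)
  have d0: "real d \<ge> 1" using d by simp
  have p: "p \<ge> 1" "s \<le> T" "T \<le> 21 * s"
  proof -
    have pos: "s / d > 0" using s d0 by simp
    have ge: "s / d \<le> p" unfolding p_def by linarith
    have "real p > 0" using pos ge by linarith
    then show "p \<ge> 1" by simp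
    show "s \<le> T" using ge d0 by (simp add: T_def field_simps)
    have "p \<le> s / d + 1" unfolding p_def using pos by linarith
    then have "p * real d \<le> (s / d + 1) * d" by (rule mult_right_mono) simp
    also have "\<dots> = s + d" using d0 by (simp add: field_simps)
    finally show "T \<le> 21 * s" using d by (simp add: T_def)
  qed
  have sN: "sqrt (s * N) > 0" "(sqrt (s * N))\<^sup>2 = s * N" using s N by auto
  have \<rho>0: "\<rho> > 0" using sN r d0 by (simp add: \<rho>_def)
  have p\<rho>r: "p * \<rho> * r = T / (10 * sqrt (s * N))" using r by (simp add: \<rho>_def T_def field_simps)
  have "p * \<rho> * r \<le> 1 / 100"
  proof -
    have "(1000 * s)\<^sup>2 \<le> s * N"
    proof -
      have "(1000 * s)\<^sup>2 = s * (10 ^ 6 * s)" by (simp add: power2_eq_square)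
      also have "\<dots> \<le> s * N" using s by (intro mult_left_mono) (auto simp: N_def)
      finally show ?thesis .
    qed
    then have "1000 * s \<le> sqrt (s * N)" by (rule real_le_rsqrt)
    then show ?thesis using p s sN unfolding p\<rho>r by (simp add: divide_le_eq)
  qed
  have W: "(q choose d) * \<rho> ^ d * mean_weight S B d \<le> exp (3 * d)"
  proof (rule mean_weight_le_noise_form[OF S S0 B(1) _ dq])
    show "q \<le> card S" "d + 2 \<le> card S" "0 \<le> \<rho>" using q dq \<rho>0 by auto
    fix Q assume Q: "Q \<subseteq> S" "card Q = q"
    have "noise_form S B \<rho> Q ^ p \<le> 2 * exp (s + 3 * card S * (p * \<rho> * r)\<^sup>2)"
    proof (rule noise_form_moment[OF S S0 B dens Q(1)])
      show "real (card Q) \<le> real (card S) / 4" "card Q + 2 \<le> card S"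
        using q Q by (auto simp: N_def)
      fix D w assume "D \<subseteq> S" "card D \<le> card Q"
      then show "card {b \<in> B. \<forall>x\<in>D. b x = w x} * (fact (card S) / fact (card S - card D)) \<le> r ^ card D * card B"
        using Q by (intro spread) (auto simp: q_def)
    qed fact+
    also have "3 * card S * (p * \<rho> * r)\<^sup>2 \<le> 63 / 100 * T"
    proof -
      have "3 * card S * (p * \<rho> * r)\<^sup>2 = 3 * T * T / (100 * s)"
        unfolding p\<rho>r power_divide power_mult_distrib sN using N s
        by (simp add: N_def power2_eq_square field_simps)
      also have "\<dots> \<le> 3 * T * (21 * s) / (100 * s)"
        using p s by (intro divide_right_mono mult_left_mono) auto
      also have "\<dots> = 63 / 100 * T" using s by simp
      finally show ?thesis .
    qed
    then have "2 * exp (s + 3 * card S * (p * \<rho> * r)\<^sup>2) \<le> 2 * exp (2 * T)"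
      using p s by simp
    also have "\<dots> \<le> exp T * exp (2 * T)"
    proof (rule mult_right_mono)
      show "2 \<le> exp T" using p s exp_ge_add_one_self[of T] by linarith
    qed simp
    also have "\<dots> = exp (3 * d) ^ p" by (simp add: T_def algebra_simps flip: exp_add exp_of_nat_mult)
    finally show "noise_form S B \<rho> Q \<le> exp (3 * d)"
      using power_le_imp_le_base[of _ "p - 1" "exp (3 * real d)"] p(1) by simp
  qed
  \<comment> \<open>(q / d) \<rho> \<ge> 1 / L because q \<ge> N / 5; the constant 1350 is 50 times
    27, where 27 \<ge> e^3.\<close>
  define L where "L = 50 * r * sqrt (s / N)"
  have L: "L > 0" using r s N by (simp add: L_def)
  have "1 / L \<le> q / d * \<rho>"
  proof -
    have "1 / L = N / 5 / d * \<rho>"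
      using r d0 s N by (simp add: L_def \<rho>_def real_sqrt_divide real_sqrt_mult field_simps)
    also have "\<dots> \<le> q / d * \<rho>" using q \<rho>0 d0 by (intro mult_right_mono divide_right_mono) auto
    finally show ?thesis .
  qed
  then have "(1 / L) ^ d \<le> (q / d * \<rho>) ^ d" using L by (intro power_mono) auto
  also have "\<dots> \<le> (q choose d) * \<rho> ^ d"
    unfolding power_mult_distrib using binomial_ge_n_over_k_pow_k[OF dq] \<rho>0 by (intro mult_right_mono) auto
  finally have "(1 / L) ^ d * mean_weight S B d \<le> (q choose d) * \<rho> ^ d * mean_weight S B d"
    using mean_weight_nonneg[OF S S0 B(1)] by (rule mult_right_mono)
  also have "\<dots> \<le> exp 3 ^ d" using W by (simp add: mult.commute flip: exp_of_nat_mult)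
  also have "\<dots> \<le> 27 ^ d"
  proof (rule power_mono)
    have "exp (3::real) = exp 1 ^ 3" by (simp flip: exp_of_nat_mult)
    also have "\<dots> \<le> 3 ^ 3" using exp_le by (intro power_mono) auto
    finally show "exp (3::real) \<le> 27" by simp
  qed simp
  finally have "mean_weight S B d \<le> (27 * L) ^ d"
    using L by (simp add: power_divide power_mult_distrib field_simps)
  also have "27 * L = 1350 * r * sqrt (s / card S)" by (simp add: L_def N_def)
  finally show ?thesis .
qed

section \<open>Supports of walks and products of words\<close>

text \<open>The counterpart of \<open>set_pow\<close> for bare composition, without a group
  structure attached, so that words over B^(-1) B can be regrouped into words over A.\<close>

definition words :: "('a \<Rightarrow> 'a) set \<Rightarrow> nat \<Rightarrow> ('a \<Rightarrow> 'a) set" where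
  "words Q k = {foldr (\<circ>) xs id | xs. length xs = k \<and> set xs \<subseteq> Q}"

lemma words_0: "id \<in> words Q 0"
  by (simp add: words_def)

lemma words_Suc: "a \<in> Q \<Longrightarrow> x \<in> words Q k \<Longrightarrow> a \<circ> x \<in> words Q (Suc k)"
  unfolding words_def by (force intro: exI[of _ "a # _"])

lemma words_SucE:
  assumes "x \<in> words Q (Suc k)"
  obtains a y where "a \<in> Q" "y \<in> words Q k" "x = a \<circ> y"
proof -
  from assms obtain xs where xs: "x = foldr (\<circ>) xs id" "length xs = Suc k" "set xs \<subseteq> Q"
    unfolding words_def by blast
  then obtain a ys where "xs = a # ys" by (metis length_Suc_conv)
  with xs show thesis by (intro that[of a "foldr (\<circ>) ys id"]) (auto simp: words_def)
qed

lemma words_add: "x \<in> words Q j \<Longrightarrow> y \<in> words Q k \<Longrightarrow> x \<circ> y \<in> words Q (j + k)"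
proof (induction j arbitrary: x)
  case 0
  then have "x = id" by (simp add: words_def)
  with 0 show ?case by simp
next
  case (Suc j)
  from Suc.prems(1) obtain a z where az: "a \<in> Q" "z \<in> words Q j" "x = a \<circ> z" by (rule words_SucE)
  have "a \<circ> (z \<circ> y) \<in> words Q (Suc (j + k))" by (rule words_Suc[OF az(1) Suc.IH[OF az(2) Suc.prems(2)]])
  then show ?case by (simp only: az(3) comp_assoc add_Suc)
qed

lemma words_words: "Q \<subseteq> words A j \<Longrightarrow> x \<in> words Q k \<Longrightarrow> x \<in> words A (k * j)"
proof (induction k arbitrary: x)
  case 0
  then have "x = id" by (simp add: words_def)
  then show ?case using words_0[of A] by (simp only: mult_0)
next
  case (Suc k)
  from Suc.prems(2) obtain a z where az: "a \<in> Q" "z \<in> words Q k" "x = a \<circ> z" by (rule words_SucE)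
  then have "a \<circ> z \<in> words A (j + k * j)" using Suc by (intro words_add) auto
  then show ?case by (simp only: az(3) mult_Suc)
qed

text \<open>D and the set of all x^(-1) g with x in D both fill more than half of the group, so they
  meet.\<close>

lemma AltS_half_product:
  assumes S: "finite S" and D: "D \<subseteq> AltS S" "2 * card D > card (AltS S)" and g: "g \<in> AltS S"
  shows "\<exists>x\<in>D. \<exists>y\<in>D. g = x \<circ> y"
proof -
  let ?h = "\<lambda>x. inv' x \<circ> g"
  have fD: "finite D" using D(1) finite_AltS[OF S] finite_subset by blast
  have gx: "x \<circ> ?h x = g" if "x \<in> D" for x
  proof -
    have "x \<circ> inv' x = id" using that D(1) AltS_comp_inv by blast
    then show ?thesis by (simp add: comp_assoc[symmetric])
  qed
  have "inj_on ?h D"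
  proof (rule inj_onI)
    fix x y assume xy: "x \<in> D" "y \<in> D" "?h x = ?h y"
    have b: "bij x" "bij y" "bij g" using xy D(1) g AltS_bij by blast+
    have "inv' x = inv' y"
      using xy(3) b(3) by (metis bij_is_surj comp_assoc comp_id surj_iff)
    then show "x = y" using b by (metis inv_inv_eq)
  qed
  then have "card (?h ` D) = card D" by (rule card_image)
  moreover have sub: "?h ` D \<subseteq> AltS S"
    using D(1) g AltS_comp[OF S] AltS_inv[OF S] by blast
  ultimately have "\<not> card D + card (?h ` D) \<le> card (AltS S)" using D(2) by linarith
  then have "D \<inter> ?h ` D \<noteq> {}"
    using card_Un_disjoint[OF fD finite_imageI[OF fD]] D(1) sub card_mono[OF finite_AltS[OF S], of "D \<union> ?h ` D"]
    by force
  then obtain x where "x \<in> D" "?h x \<in> D" by blast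
  then show ?thesis using gx by metis
qed

text \<open>A nonzero average has a nonzero term: F prefixes the elements of a support with some
  b^(-1), its adjoint prefixes them with some b, and f starts in B.\<close>

lemma walk_support:
  assumes B: "B \<subseteq> AltS S" and f: "\<And>x. f x \<noteq> 0 \<Longrightarrow> x \<in> B" and "walk B k f \<sigma> \<noteq> 0"
  shows "\<sigma> \<in> words ((\<lambda>(b, b'). inv' b \<circ> b') ` (B \<times> B)) (Suc k)"
proof -
  let ?Q = "(\<lambda>(b, b'). inv' b \<circ> b') ` (B \<times> B)"
  let ?T = "\<lambda>w. left_avg_inv B (left_avg B w)"
  have la: "\<exists>b\<in>B. v (b \<circ> \<tau>) \<noteq> 0" if "left_avg B v \<tau> \<noteq> 0" for v \<tau>
    using that by (auto simp: left_avg_def intro: ccontr)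
  have lai: "\<exists>b\<in>B. v (inv' b \<circ> \<tau>) \<noteq> 0" if "left_avg_inv B v \<tau> \<noteq> 0" for v \<tau>
    using that by (auto simp: left_avg_inv_def intro: ccontr)
  have cancel: "\<tau> = b \<circ> \<rho>" if "inv' b \<circ> \<tau> = \<rho>" "b \<in> B" for b \<tau> \<rho>
  proof -
    have "b \<circ> inv' b = id" using that B AltS_comp_inv by blast
    then show ?thesis using that(1) by (metis comp_assoc id_comp)
  qed
  have cancel': "\<tau> = inv' b \<circ> \<rho>" if "b \<circ> \<tau> = \<rho>" "b \<in> B" for b \<tau> \<rho>
  proof -
    have "inv' b \<circ> b = id" using that B AltS_inv_comp by blast
    then show ?thesis using that(1) by (metis comp_assoc id_comp)
  qed
  have iter: "\<exists>b\<in>B. \<exists>x\<in>words ?Q k. \<tau> = b \<circ> x" if "(?T ^^ k) f \<tau> \<noteq> 0" for k \<tau>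
    using that
  proof (induction k arbitrary: \<tau>)
    case 0
    then have "\<tau> \<in> B" using f by simp
    then show ?case using words_0[of ?Q] by (metis comp_id)
  next
    case (Suc k)
    then have "left_avg_inv B (left_avg B ((?T ^^ k) f)) \<tau> \<noteq> 0" by simp
    from lai[OF this] obtain b' where b': "b' \<in> B" "left_avg B ((?T ^^ k) f) (inv' b' \<circ> \<tau>) \<noteq> 0" by blast
    from la[OF this(2)] obtain b'' where b'': "b'' \<in> B" "(?T ^^ k) f (b'' \<circ> (inv' b' \<circ> \<tau>)) \<noteq> 0" by blast
    from Suc.IH[OF this(2)] obtain b x where x: "b \<in> B" "x \<in> words ?Q k" "b'' \<circ> (inv' b' \<circ> \<tau>) = b \<circ> x" by blast
    have "inv' b' \<circ> \<tau> = inv' b'' \<circ> (b \<circ> x)" by (rule cancel'[OF x(3) b''(1)])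
    then have "\<tau> = b' \<circ> (inv' b'' \<circ> (b \<circ> x))" by (rule cancel[OF _ b'(1)])
    then have "\<tau> = b' \<circ> ((inv' b'' \<circ> b) \<circ> x)" by (simp only: comp_assoc)
    moreover have "(inv' b'' \<circ> b) \<circ> x \<in> words ?Q (Suc k)"
      using b''(1) x(1,2) by (intro words_Suc) auto
    ultimately show ?case using b'(1) by blast
  qed
  from la assms(3) obtain b where b: "b \<in> B" "(?T ^^ k) f (b \<circ> \<sigma>) \<noteq> 0"
    unfolding walk_def by blast
  from iter[OF b(2)] obtain b' x where x: "b' \<in> B" "x \<in> words ?Q k" "b \<circ> \<sigma> = b' \<circ> x" by blast
  have "\<sigma> = inv' b \<circ> (b' \<circ> x)" by (rule cancel'[OF x(3) b(1)])
  then have "\<sigma> = (inv' b \<circ> b') \<circ> x" by (simp only: comp_assoc)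
  then show ?thesis using b(1) x(1,2) by (auto intro!: words_Suc)
qed

lemma sum_left_avg:
  assumes S: "finite S" and B: "B \<subseteq> AltS S" "B \<noteq> {}"
  shows "(\<Sum>\<sigma>\<in>AltS S. left_avg B v \<sigma>) = (\<Sum>\<sigma>\<in>AltS S. v \<sigma>)"
    and "(\<Sum>\<sigma>\<in>AltS S. left_avg_inv B v \<sigma>) = (\<Sum>\<sigma>\<in>AltS S. v \<sigma>)"
proof -
  have c: "card B > 0" using B finite_AltS[OF S] finite_subset by (metis card_gt_0_iff)
  have "(\<Sum>\<sigma>\<in>AltS S. left_avg B v \<sigma>) = (\<Sum>b\<in>B. \<Sum>\<sigma>\<in>AltS S. v (b \<circ> \<sigma>)) / card B"
    unfolding left_avg_def sum_divide_distrib[symmetric] by (subst sum.swap) simp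
  also have "(\<Sum>b\<in>B. \<Sum>\<sigma>\<in>AltS S. v (b \<circ> \<sigma>)) = (\<Sum>b\<in>B. \<Sum>\<sigma>\<in>AltS S. v \<sigma>)"
    using B by (intro sum.cong refl sum_AltS_left[OF S]) auto
  finally show "(\<Sum>\<sigma>\<in>AltS S. left_avg B v \<sigma>) = (\<Sum>\<sigma>\<in>AltS S. v \<sigma>)" using c by simp
  have "(\<Sum>\<sigma>\<in>AltS S. left_avg_inv B v \<sigma>) = (\<Sum>b\<in>B. \<Sum>\<sigma>\<in>AltS S. v (inv' b \<circ> \<sigma>)) / card B"
    unfolding left_avg_inv_def sum_divide_distrib[symmetric] by (subst sum.swap) simp
  also have "(\<Sum>b\<in>B. \<Sum>\<sigma>\<in>AltS S. v (inv' b \<circ> \<sigma>)) = (\<Sum>b\<in>B. \<Sum>\<sigma>\<in>AltS S. v \<sigma>)"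
    using B by (intro sum.cong refl sum_AltS_left[OF S] AltS_inv[OF S]) auto
  finally show "(\<Sum>\<sigma>\<in>AltS S. left_avg_inv B v \<sigma>) = (\<Sum>\<sigma>\<in>AltS S. v \<sigma>)" using c by simp
qed

lemma sum_walk:
  assumes S: "finite S" and B: "B \<subseteq> AltS S" "B \<noteq> {}"
  shows "(\<Sum>\<sigma>\<in>AltS S. walk B k v \<sigma>) = (\<Sum>\<sigma>\<in>AltS S. v \<sigma>)"
proof -
  have "(\<Sum>\<sigma>\<in>AltS S. ((\<lambda>w. left_avg_inv B (left_avg B w)) ^^ k) v \<sigma>) = (\<Sum>\<sigma>\<in>AltS S. v \<sigma>)"
    by (induction k) (simp_all add: sum_left_avg[OF assms])
  then show ?thesis by (simp add: walk_def sum_left_avg[OF assms])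
qed

text \<open>Cauchy-Schwarz between h and the indicator of its support.\<close>

lemma support_gt_half:
  fixes h :: "'b \<Rightarrow> real"
  assumes "finite G" "G \<noteq> {}" "(\<Sum>x\<in>G. h x) = card G" "ip G h h < 2 * card G"
  shows "card G < 2 * card {x \<in> G. h x \<noteq> 0}"
proof -
  let ?D = "{x \<in> G. h x \<noteq> 0}"
  let ?e = "\<lambda>x. of_bool (h x \<noteq> 0) :: real"
  have cG: "real (card G) > 0" using assms by (simp add: card_gt_0_iff)
  have "ip G ?e h = (\<Sum>x\<in>G. h x)" unfolding ip_def by (intro sum.cong) auto
  moreover have "ip G ?e ?e = card ?D"
  proof -
    have "ip G ?e ?e = (\<Sum>x\<in>G. if h x \<noteq> 0 then 1 else 0)" unfolding ip_def by (intro sum.cong) auto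
    then show ?thesis using assms(1) by (simp add: sum.If_cases Int_def)
  qed
  ultimately have "(real (card G))\<^sup>2 \<le> card ?D * ip G h h"
    using ip_Cauchy_Schwarz[of G ?e h] assms(3) by simp
  also have "\<dots> \<le> card ?D * (2 * real (card G))" using assms(4) by (intro mult_left_mono) auto
  \<comment> \<open>The weak inequality shows that the support is nonempty, which makes the same
    estimate strict in a second pass.\<close>
  finally have le: "real (card G) \<le> 2 * card ?D" using cG by (simp add: power2_eq_square)
  then have "card ?D > 0" using cG by linarith
  then have "card ?D * ip G h h < card ?D * (2 * real (card G))" using assms(4) by simp
  then have "(real (card G))\<^sup>2 < card ?D * (2 * real (card G))"
    using \<open>(real (card G))\<^sup>2 \<le> card ?D * ip G h h\<close> by linarith
  then have "real (card G) * card G < (2 * real (card ?D)) * card G"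
    by (simp add: power2_eq_square mult_ac)
  then have "real (card G) < 2 * real (card ?D)" using cG by (simp only: mult_less_cancel_right_pos)
  then show ?thesis by linarith
qed

section \<open>Restriction to a global set\<close>

text \<open>Comparing the maximiser with I = {} gives the lower bound for |B|, and comparing it with
  the enlargement of I by D gives the bound on prescribed values. Translation by a0 cancels in
  b^(-1) b'.\<close>

lemma global_restriction:
  fixes r :: real
  assumes S: "finite S" and A: "A \<subseteq> AltS S" "A \<noteq> {}" and r: "r > 0"
  obtains I B where "I \<subseteq> S" "2 * card I \<le> card S" "B \<subseteq> AltS (S - I)" "B \<noteq> {}"
    "\<And>b b'. b \<in> B \<Longrightarrow> b' \<in> B \<Longrightarrow> \<exists>a\<in>A. \<exists>a'\<in>A. inv' b \<circ> b' = inv' a \<circ> a'"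
    "card A * r ^ card I \<le> card B * (fact (card S) / fact (card S - card I))"
    "\<And>D w. D \<subseteq> S - I \<Longrightarrow> 2 * (card I + card D) \<le> card S \<Longrightarrow>
      card {b \<in> B. \<forall>x\<in>D. b x = w x} * (fact (card S - card I) / fact (card S - card I - card D))
        \<le> r ^ card D * card B"
proof -
  let ?n = "card S"
  define X where "X I a0 = {a \<in> A. \<forall>x\<in>I. a x = a0 x}" for I :: "'a set" and a0 :: "'a \<Rightarrow> 'a"
  \<comment> \<open>When two points remain, (n - |I|)! is twice the order of U_I, so this is the
    relative density over r^|I| up to a constant factor.\<close>
  define \<Phi> where "\<Phi> P = (case P of (I, a0) \<Rightarrow> card (X I a0) / (fact (?n - card I) * r ^ card I))"
    for P :: "'a set \<times> ('a \<Rightarrow> 'a)"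
  define K where "K = {I. I \<subseteq> S \<and> 2 * card I \<le> ?n} \<times> A"
  have fA: "finite A" using A finite_AltS[OF S] finite_subset by blast
  have "finite {I. I \<subseteq> S \<and> 2 * card I \<le> ?n}" by (rule finite_subset[of _ "Pow S"]) (use S in auto)
  then have fK: "finite K" using fA by (simp add: K_def)
  obtain a where a: "a \<in> A" using A by blast
  then have aK: "({}, a) \<in> K" by (simp add: K_def)
  then have "Max (\<Phi> ` K) \<in> \<Phi> ` K" using fK by (intro Max_in) auto
  then obtain I a0 where Ia: "(I, a0) \<in> K" "\<Phi> (I, a0) = Max (\<Phi> ` K)" by auto
  have max: "\<Phi> P \<le> \<Phi> (I, a0)" if "P \<in> K" for P
    unfolding Ia(2) using fK that by (intro Max_ge) auto
  have I: "I \<subseteq> S" "2 * card I \<le> ?n" "a0 \<in> A" using Ia(1) by (auto simp: K_def)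
  have fI: "finite I" using I S finite_subset by blast
  have a0: "a0 \<in> AltS S" "bij a0" using I A AltS_bij by blast+
  have inva0: "a0 (inv' a0 y) = y" "inv' a0 (a0 y) = y" for y
    using a0(2) by (simp_all add: bij_is_surj surj_f_inv_f bij_is_inj inv_f_f)
  define B where "B = (\<lambda>a. inv' a0 \<circ> a) ` X I a0"
  have inj: "inj_on (\<lambda>a. inv' a0 \<circ> a) Z" for Z :: "('a \<Rightarrow> 'a) set"
    by (rule inj_on_comp_left) (rule bij_imp_bij_inv[OF a0(2)])
  have fX: "finite (X J b)" for J b using fA by (simp add: X_def)
  have cB: "card B = card (X I a0)" unfolding B_def by (rule card_image[OF inj])
  have fact_pos: "(0::real) < fact m * r ^ k" for m k using r by simp
  show thesis
  proof (rule that[of I B])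
    show "I \<subseteq> S" "2 * card I \<le> ?n" by fact+
    show "B \<subseteq> AltS (S - I)"
    proof
      fix b assume "b \<in> B"
      then obtain a where a: "a \<in> A" "\<forall>x\<in>I. a x = a0 x" "b = inv' a0 \<circ> a" by (auto simp: B_def X_def)
      have "inv' a0 \<circ> a \<in> AltS S" using a(1) A(1) by (intro AltS_comp[OF S AltS_inv[OF S a0(1)]]) blast
      then have "b \<in> AltS S" by (simp only: a(3))
      moreover have "\<forall>x\<in>I. b x = x" using a inva0 by simp
      ultimately show "b \<in> AltS (S - I)" using AltS_fixing[OF I(1)] by blast
    qed
    have "a0 \<in> X I a0" using I by (simp add: X_def)
    then show "B \<noteq> {}" by (auto simp: B_def)
    show "\<exists>a\<in>A. \<exists>a'\<in>A. inv' b \<circ> b' = inv' a \<circ> a'" if bb: "b \<in> B" "b' \<in> B" for b b'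
    proof -
      from bb obtain a a' where aa: "a \<in> A" "a' \<in> A" "b = inv' a0 \<circ> a" "b' = inv' a0 \<circ> a'"
        by (auto simp: B_def X_def)
      have "bij a" using aa A AltS_bij by blast
      then have "inv' b = inv' a \<circ> a0"
        unfolding aa using a0(2) by (simp add: o_inv_distrib bij_imp_bij_inv inv_inv_eq)
      then have "inv' b \<circ> b' = inv' a \<circ> a'" unfolding aa(4) using inva0 by (simp add: fun_eq_iff)
      then show ?thesis using aa by blast
    qed
    have "\<Phi> ({}, a) \<le> \<Phi> (I, a0)" by (rule max[OF aK])
    then have "real (card A) / fact ?n \<le> card B / (fact (?n - card I) * r ^ card I)"
      by (simp add: \<Phi>_def X_def cB)
    then have "real (card A) / fact ?n * (fact ?n * r ^ card I)
        \<le> card B / (fact (?n - card I) * r ^ card I) * (fact ?n * r ^ card I)"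
      using r by (intro mult_right_mono) auto
    then show "card A * r ^ card I \<le> card B * (fact ?n / fact (?n - card I))"
      using r by simp
    show "card {b \<in> B. \<forall>x\<in>D. b x = w x} * (fact (?n - card I) / fact (?n - card I - card D)) \<le> r ^ card D * card B"
      if D: "D \<subseteq> S - I" "2 * (card I + card D) \<le> ?n" for D w
    proof (cases "{b \<in> B. \<forall>x\<in>D. b x = w x} = {}")
      case True
      show ?thesis unfolding True using r by simp
    next
      case False
      then obtain a1 where a1: "a1 \<in> X I a0" "\<forall>x\<in>D. (inv' a0 \<circ> a1) x = w x"
        unfolding B_def by blast
      have fD: "finite D" using D S finite_subset by blast
      \<comment> \<open>The values w prescribed on D are realised by some a1 in A that agrees with
        a0 on I, so the enlarged constraint competes in the maximum.\<close>
      have "(I \<union> D, a1) \<in> K" using a1 D I fD fI card_Un_le[of I D] by (auto simp: K_def X_def)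
      from max[OF this] have "\<Phi> (I \<union> D, a1) \<le> \<Phi> (I, a0)" .
      moreover have "card (I \<union> D) = card I + card D" using D fD fI by (intro card_Un_disjoint) auto
      ultimately have le: "card (X (I \<union> D) a1) / (fact (?n - card I - card D) * (r ^ card I * r ^ card D))
          \<le> card B / (fact (?n - card I) * r ^ card I)"
        by (simp add: \<Phi>_def cB power_add)
      have "{b \<in> B. \<forall>x\<in>D. b x = w x} \<subseteq> (\<lambda>a. inv' a0 \<circ> a) ` X (I \<union> D) a1"
      proof
        fix b assume "b \<in> {b \<in> B. \<forall>x\<in>D. b x = w x}"
        then obtain a where a: "a \<in> X I a0" "b = inv' a0 \<circ> a" "\<forall>x\<in>D. b x = w x" by (auto simp: B_def)
        have "a x = a1 x" if "x \<in> D" for x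
        proof -
          have "inv' a0 (a x) = inv' a0 (a1 x)" using a a1 that by simp
          then show ?thesis using inva0(1) by metis
        qed
        then have "a \<in> X (I \<union> D) a1" using a(1) a1(1) by (auto simp: X_def)
        then show "b \<in> (\<lambda>a. inv' a0 \<circ> a) ` X (I \<union> D) a1" using a(2) by blast
      qed
      then have "card {b \<in> B. \<forall>x\<in>D. b x = w x} \<le> card (X (I \<union> D) a1)"
        using fX by (meson card_image_le card_mono finite_imageI le_trans)
      then have "card {b \<in> B. \<forall>x\<in>D. b x = w x} * (fact (?n - card I) / fact (?n - card I - card D))
          \<le> card (X (I \<union> D) a1) * (fact (?n - card I) / fact (?n - card I - card D))"
        by (intro mult_right_mono) auto
      also have "\<dots> = card (X (I \<union> D) a1) / (fact (?n - card I - card D) * (r ^ card I * r ^ card D))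
          * (fact (?n - card I) * (r ^ card I * r ^ card D))"
        using r by simp
      also have "\<dots> \<le> card B / (fact (?n - card I) * r ^ card I) * (fact (?n - card I) * (r ^ card I * r ^ card D))"
        using le r by (intro mult_right_mono) auto
      also have "\<dots> = r ^ card D * card B" using r by simp
      finally show ?thesis .
    qed
  qed
qed

lemma sum_eighth_power: "(\<Sum>d\<in>{1..k}. (1 / 8) ^ d) = (1 - (1 / 8) ^ k) / (7::real)"
  by (induction k) simp_all

lemma global_walk_norm:
  fixes s r n :: real
  assumes S: "finite S" and B: "B \<subseteq> AltS S" "B \<noteq> {}"
    and dens: "card (AltS S) \<le> exp s * card B"
    and spread: "\<And>D w. D \<subseteq> S \<Longrightarrow> card D \<le> card S div 4 \<Longrightarrow>
      card {b \<in> B. \<forall>x\<in>D. b x = w x} * (fact (card S) / fact (card S - card D)) \<le> r ^ card D * card B"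
    and s: "1 \<le> s" "s * r ^ 5 \<le> n / 10 ^ 8" and r: "1 \<le> r" "r ^ (5 * M) = n"
    and n: "card S \<le> n" "n \<le> 2 * real (card S)" and M: "M \<ge> 1"
    and f: "f = (\<lambda>g. if g \<in> B then card (AltS S) / card B else 0)"
  shows "ip (AltS S) (walk B (2 * M - 1) f) (walk B (2 * M - 1) f) < 2 * card (AltS S)"
proof -
  let ?G = "AltS S"
  define N where "N = real (card S)"
  \<comment> \<open>m \<ge> 4 s makes 2^m at least e^(2 s), so that \<open>\<delta> / 2 ^ m\<close>
    is at most e^(-s); m \<le> 4 s + 1 keeps the degrees up to 4 m within the range 20 s of
    \<open>mean_weight_bound\<close>.\<close>
  define m where "m = nat \<lceil>4 * s\<rceil>"
  define \<delta> where "\<delta> = real (card ?G) / card B"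
  have m: "4 * s \<le> m" "m \<le> 4 * s + 1" unfolding m_def using s by linarith+
  have r5: "1 \<le> r ^ 5" using r by simp
  have s5: "s \<le> n / 10 ^ 8"
  proof -
    have "s * 1 \<le> s * r ^ 5" using r5 s by (intro mult_left_mono) auto
    then show ?thesis using s by linarith
  qed
  have sN: "10 ^ 6 * s \<le> N" using s5 n s by (simp add: N_def)
  have N0: "N > 0" using sN s by simp
  have "real (4 * m + 5) \<le> real (card S)" using m sN s by (simp add: N_def)
  then have mN: "4 * m + 5 \<le> card S" by linarith
  have cB: "real (card B) > 0" using B finite_AltS[OF S] finite_subset by (metis card_gt_0_iff of_nat_0_less_iff)
  have cG: "real (card ?G) > 0" using card_AltS_pos[OF S] by simp
  have \<delta>: "0 \<le> \<delta>" "\<delta> \<le> exp s" using dens cB by (auto simp: \<delta>_def divide_le_eq)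
  \<comment> \<open>The square of the base in \<open>mean_weight_bound\<close>; the hypothesis s r^5
    \<le> n / 10^8 brings it below r^(-3) / 8.\<close>
  define Y where "Y = 1350\<^sup>2 * (r\<^sup>2 * (s / N))"
  have Y: "0 \<le> Y" "Y \<le> 1 / 8 / r ^ 3"
  proof -
    show "0 \<le> Y" using s N0 by (simp add: Y_def)
    have "r ^ 3 * Y = 1350\<^sup>2 * (s * r ^ 5) / N" by (simp add: Y_def power_numeral_reduce)
    also have "\<dots> \<le> 1350\<^sup>2 * (2 * N / 10 ^ 8) / N"
      using s n N0 by (intro divide_right_mono mult_left_mono) (auto simp: N_def)
    also have "\<dots> \<le> 1 / 8" using N0 by simp
    finally show "Y \<le> 1 / 8 / r ^ 3" using r by (simp add: pos_le_divide_eq mult.commute)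
  qed
  \<comment> \<open>N \<le> r^(5 M) is beaten by the factor r^(-6 M) supplied by Y; this is why the
    walk is run with parameter 2 M - 1.\<close>
  have NY: "N * Y ^ (2 * M) \<le> 1 / 8"
  proof -
    have "Y ^ (2 * M) \<le> (1 / 8 / r ^ 3) ^ (2 * M)" using Y by (intro power_mono)
    then have "N * Y ^ (2 * M) \<le> r ^ (5 * M) * (1 / 8 / r ^ 3) ^ (2 * M)"
      using r n N0 Y by (intro mult_mono) (auto simp: N_def)
    also have "\<dots> = (1 / 8) ^ (2 * M) * (r ^ (5 * M) / r ^ (6 * M))"
      by (simp add: power_divide flip: power_mult)
    also have "\<dots> \<le> (1 / 8) ^ (2 * M) * 1"
      using r by (intro mult_left_mono) (auto simp: divide_le_eq intro!: power_increasing)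
    also have "\<dots> \<le> (1 / 8) ^ 1" unfolding mult_1_right by (rule power_decreasing) (use M in auto)
    finally show ?thesis by simp
  qed
  have term_le: "(card S choose d) * mean_weight S B d ^ (4 * M) \<le> (1 / 8) ^ d" if d: "d \<in> {1..4 * m}" for d
  proof -
    have "real d \<le> real (4 * m)" using d by (simp only: of_nat_le_iff) simp
    then have d20: "real d \<le> 20 * s" using m s by simp
    have S0: "S \<noteq> {}" using N0 by (auto simp: N_def)
    have "mean_weight S B d \<le> (1350 * r * sqrt (s / N)) ^ d"
      unfolding N_def using d d20 sN by (intro mean_weight_bound[OF S B dens spread s(1) _ r(1)]) (auto simp: N_def)
    then have "mean_weight S B d ^ (4 * M) \<le> ((1350 * r * sqrt (s / N)) ^ d) ^ (4 * M)"
      using mean_weight_nonneg[OF S S0 B(1)] by (intro power_mono)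
    also have "\<dots> = (((1350 * r * sqrt (s / N))\<^sup>2) ^ (2 * M)) ^ d"
      by (simp flip: power_mult) (simp add: ac_simps)
    also have "(1350 * r * sqrt (s / N))\<^sup>2 = Y"
      using s N0 by (simp add: Y_def power_mult_distrib)
    finally have 1: "mean_weight S B d ^ (4 * M) \<le> (Y ^ (2 * M)) ^ d" .
    have 2: "real (card S choose d) \<le> N ^ d"
    proof (cases "d \<le> card S")
      case True
      then show ?thesis unfolding N_def using binomial_le_pow[OF True] by (metis of_nat_le_iff of_nat_power)
    next
      case False
      then show ?thesis using N0 by (simp add: binomial_eq_0)
    qed
    have "(card S choose d) * mean_weight S B d ^ (4 * M) \<le> N ^ d * (Y ^ (2 * M)) ^ d"
      using 1 2 N0 mean_weight_nonneg[OF S S0 B(1)] by (intro mult_mono) auto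
    also have "\<dots> = (N * Y ^ (2 * M)) ^ d" by (simp add: power_mult_distrib)
    also have "\<dots> \<le> (1 / 8) ^ d" using NY N0 Y by (intro power_mono) auto
    finally show ?thesis .
  qed
  have low_part: "(\<Sum>d\<in>{1..4 * m}. (card S choose d) * mean_weight S B d ^ (4 * M)) \<le> 1 / 7"
  proof -
    have "(\<Sum>d\<in>{1..4 * m}. (card S choose d) * mean_weight S B d ^ (4 * M)) \<le> (\<Sum>d\<in>{1..4 * m}. (1 / 8) ^ d)"
      by (rule sum_mono[OF term_le])
    also have "\<dots> \<le> 1 / 7" unfolding sum_eighth_power by (simp add: divide_right_mono)
    finally show ?thesis .
  qed
  \<comment> \<open>Three of the 4 M - 1 factors e^(-s) already beat the mean square of f, which is
    at most e^s.\<close>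
  have high_part: "(\<delta> / 2 ^ m) ^ (4 * M - 1) * \<delta> \<le> 1 / 4"
  proof -
    have "exp (2 * s) \<le> exp (m * (1 / 2))" using m by simp
    also have "\<dots> = exp (1 / 2) ^ m" by (rule exp_of_nat_mult)
    also have "\<dots> \<le> 2 ^ m"
    proof (rule power_mono)
      have "exp (1 / 2 :: real) ^ 2 = exp 1" by (simp flip: exp_of_nat_mult)
      then have "exp (1 / 2 :: real) ^ 2 \<le> 2 ^ 2" using exp_le by simp
      then show "exp (1 / 2 :: real) \<le> 2" by (rule power2_le_imp_le) simp
    qed simp
    finally have "\<delta> / 2 ^ m \<le> exp s / exp (2 * s)" using \<delta> by (intro frac_le) auto
    also have "\<dots> = exp (- s)" by (simp flip: exp_diff)
    finally have x: "\<delta> / 2 ^ m \<le> exp (- s)" .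
    have "(\<delta> / 2 ^ m) ^ (4 * M - 1) \<le> exp (- s) ^ (4 * M - 1)" using x \<delta> by (intro power_mono) auto
    also have "\<dots> \<le> exp (- s) ^ 3" using M s by (intro power_decreasing) auto
    finally have "(\<delta> / 2 ^ m) ^ (4 * M - 1) * \<delta> \<le> exp (- s) ^ 3 * exp s"
      using \<delta> by (intro mult_mono) auto
    also have "\<dots> = exp (- s) ^ 2" by (simp add: power_numeral_reduce flip: exp_add)
    also have "\<dots> \<le> (1 / 2) ^ 2"
    proof (rule power_mono)
      have "2 \<le> exp s" using exp_ge_add_one_self[of s] s by linarith
      then show "exp (- s) \<le> 1 / 2" by (simp add: exp_minus field_simps)
    qed simp
    finally show ?thesis by (simp add: power2_eq_square)
  qed
  \<comment> \<open>The walk consists of 4 M - 1 operators, and f supplies one further factor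
    \<open>mean_weight\<close>.\<close>
  have k: "2 * (2 * M - 1) + 2 = 4 * M" "2 * (2 * M - 1) + 1 = 4 * M - 1" using M by auto
  have "ip ?G (walk B (2 * M - 1) f) (walk B (2 * M - 1) f) \<le> card ?G *
      (1 + (\<Sum>d\<in>{1..4 * m}. (card S choose d) * mean_weight S B d ^ (4 * M)) + (\<delta> / 2 ^ m) ^ (4 * M - 1) * \<delta>)"
    using walk_norm_bound[OF S B mN f, of "2 * M - 1"] unfolding k \<delta>_def .
  also have "\<dots> \<le> card ?G * (1 + 1 / 7 + 1 / 4)"
    using low_part high_part by (intro mult_left_mono add_mono) auto
  also have "\<dots> < 2 * card ?G" using cG by simp
  finally show ?thesis .
qed

lemma large_set_words:
  assumes S: "finite S" and A: "A \<subseteq> AltS S" "2 * card A > card (AltS S)" and k: "k \<ge> 2"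
  shows "AltS S \<subseteq> words A k"
  using k
proof (induction k rule: dec_induct)
  case base
  show ?case
  proof
    fix g assume "g \<in> AltS S"
    from AltS_half_product[OF S A this] obtain x y where xy: "x \<in> A" "y \<in> A" "g = x \<circ> y" by blast
    have "x \<circ> (y \<circ> id) \<in> words A (Suc (Suc 0))" by (intro words_Suc words_0 xy)
    then show "g \<in> words A 2" by (simp add: xy(3) numeral_2_eq_2)
  qed
next
  case (step k)
  have "card A > 0" using A(2) by linarith
  then obtain a where a: "a \<in> A" by (auto simp: card_gt_0_iff)
  show ?case
  proof
    \<comment> \<open>Words have an exact length, so a shorter one is padded by a letter a, writing
      g as a o (a^(-1) o g).\<close>
    fix g assume g: "g \<in> AltS S"
    have "inv' a \<circ> g \<in> AltS S" using a A(1) g by (intro AltS_comp[OF S AltS_inv[OF S]]) auto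
    then have "a \<circ> (inv' a \<circ> g) \<in> words A (Suc k)" using step a by (intro words_Suc) auto
    moreover have "a \<circ> inv' a = id" using a A(1) AltS_comp_inv by blast
    ultimately show "g \<in> words A (Suc k)" by (metis comp_assoc id_comp)
  qed
qed

lemma stabilizer_in_words:
  fixes r s :: real
  assumes S: "finite S" and A: "A \<subseteq> AltS S" "A \<noteq> {}" and inv: "\<And>a. a \<in> A \<Longrightarrow> inv' a \<in> A"
    and dens: "card (AltS S) \<le> exp (s / 2) * card A"
    and s: "1 \<le> s" "s * r ^ 5 \<le> card S / 10 ^ 8" and r: "exp 1 \<le> r ^ 5" "0 \<le> r" "r ^ (5 * M) = card S"
    and M: "M \<ge> 1"
  obtains I where "I \<subseteq> S" "AltS (S - I) \<subseteq> words A (8 * M)"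
    "(card A / card (AltS S)) ^ (5 * M) \<le> card (AltS (S - I)) / card (AltS S)"
proof -
  let ?n = "card S"
  have r1: "1 \<le> r"
  proof (rule ccontr)
    assume "\<not> 1 \<le> r"
    then have "r ^ 5 \<le> 1" using r(2) by (intro power_le_one) auto
    then show False using r(1) exp_ge_add_one_self[of 1] by linarith
  qed
  obtain I B where I: "I \<subseteq> S" "2 * card I \<le> ?n" and B: "B \<subseteq> AltS (S - I)" "B \<noteq> {}"
    and BA: "\<And>b b'. b \<in> B \<Longrightarrow> b' \<in> B \<Longrightarrow> \<exists>a\<in>A. \<exists>a'\<in>A. inv' b \<circ> b' = inv' a \<circ> a'"
    and big: "card A * r ^ card I \<le> card B * (fact ?n / fact (?n - card I))"
    and spread: "\<And>D w. D \<subseteq> S - I \<Longrightarrow> 2 * (card I + card D) \<le> ?n \<Longrightarrow>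
      card {b \<in> B. \<forall>x\<in>D. b x = w x} * (fact (?n - card I) / fact (?n - card I - card D)) \<le> r ^ card D * card B"
    using global_restriction[OF S A, of r] r1 by auto
  define T where "T = S - I"
  define i where "i = card I"
  have fT: "finite T" and cT: "card T = ?n - i"
    using S I by (simp_all add: T_def i_def card_Diff_subset finite_subset)
  have r5: "1 \<le> r ^ 5" using r1 by simp
  have "s * 1 \<le> s * r ^ 5" using s(1) r5 by (intro mult_left_mono) auto
  then have sn: "s \<le> ?n / 10 ^ 8" using s(2) by linarith
  then have n4: "real ?n \<ge> 10 ^ 8" using s(1) by simp
  have "i + 2 \<le> ?n"
  proof -
    have "real 4 \<le> real ?n" using n4 by simp
    then have "4 \<le> ?n" by (simp only: of_nat_le_iff)
    then show ?thesis using I(2) by (simp add: i_def)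
  qed
  then have ratio: "real (card (AltS S)) = fact ?n / fact (?n - i) * card (AltS T)"
    unfolding T_def i_def using card_AltS_ratio[OF S I(1)] by simp
  have cAT: "real (card (AltS T)) > 0" using card_AltS_pos[OF fT] by simp
  have cAS: "real (card (AltS S)) > 0" using card_AltS_pos[OF S] by simp
  have cA: "real (card A) > 0" using A finite_AltS[OF S] finite_subset by (metis card_gt_0_iff of_nat_0_less_iff)
  have cB: "real (card B) > 0" using B finite_AltS[OF fT] finite_subset unfolding T_def by (metis card_gt_0_iff of_nat_0_less_iff)
  have "card B \<le> card (AltS T)" using B(1) finite_AltS[OF fT] by (simp add: card_mono T_def)
  then have "card B * (fact ?n / fact (?n - i)) \<le> card (AltS T) * (fact ?n / fact (?n - i) :: real)"
    by (intro mult_right_mono) auto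
  \<comment> \<open>The relative density of B in U_I is at most 1.\<close>
  then have ri: "card A * r ^ i \<le> card (AltS S)"
    using big by (simp add: ratio i_def mult.commute)
  have "r ^ i * card A \<le> exp (s / 2) * card A" using ri dens by (simp add: mult.commute)
  then have ris: "r ^ i \<le> exp (s / 2)" using cA by simp
  \<comment> \<open>The hypothesis e \<le> r^5 turns the bound on r^i into a linear bound on
    i.\<close>
  have i: "real i \<le> 5 / 2 * s"
  proof -
    have "exp (real i) = exp 1 ^ i" by (simp flip: exp_of_nat_mult)
    also have "\<dots> \<le> (r ^ 5) ^ i" using r(1) by (intro power_mono) auto
    also have "\<dots> = (r ^ i) ^ 5" by (simp add: mult.commute flip: power_mult)
    also have "\<dots> \<le> exp (s / 2) ^ 5" using ris r1 by (intro power_mono) auto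
    also have "\<dots> = exp (5 / 2 * s)" by (simp flip: exp_of_nat_mult)
    finally show ?thesis by simp
  qed
  have in_le: "10 ^ 6 * real i \<le> ?n" using i sn by simp
  have cT': "real (card T) = real ?n - real i" using I(2) by (simp add: cT i_def of_nat_diff)
  have densB: "card (AltS T) \<le> exp s * card B"
  proof -
    have "card (AltS T) * (card A * r ^ i) \<le> card (AltS T) * (card B * (fact ?n / fact (?n - i)))"
      using big by (intro mult_left_mono) (auto simp: i_def)
    also have "\<dots> = card B * real (card (AltS S))" by (simp add: ratio)
    also have "\<dots> \<le> card B * (exp (s / 2) * card A)" using dens by (intro mult_left_mono) auto
    finally have "(card (AltS T) * r ^ i) * card A \<le> (exp (s / 2) * card B) * card A" by (simp add: mult_ac)
    then have "card (AltS T) * r ^ i \<le> exp (s / 2) * card B" using cA by simp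
    moreover have "real (card (AltS T)) * 1 \<le> card (AltS T) * r ^ i" using r1 by (intro mult_left_mono) auto
    moreover have "exp (s / 2) * card B \<le> exp s * card B" using s(1) by (intro mult_right_mono) auto
    ultimately show ?thesis by linarith
  qed
  define f where "f = (\<lambda>g. if g \<in> B then card (AltS T) / card B else 0)"
  define h where "h = walk B (2 * M - 1) f"
  have "ip (AltS T) h h < 2 * card (AltS T)"
    unfolding h_def
  proof (rule global_walk_norm[OF fT _ B(2) densB _ s r1 r(3) _ _ M f_def])
    show "B \<subseteq> AltS T" using B(1) by (simp add: T_def)
    show "real (card T) \<le> ?n" "real ?n \<le> 2 * real (card T)" unfolding cT' using in_le by auto
    fix D w assume D: "D \<subseteq> T" "card D \<le> card T div 4"
    have "2 * (card I + card D) \<le> ?n"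
    proof -
      have "real (4 * card D) \<le> real (card T)" unfolding of_nat_le_iff using D(2) by linarith
      then have "real (2 * (card I + card D)) \<le> real ?n" using in_le unfolding cT' i_def by simp
      then show ?thesis by linarith
    qed
    then show "card {b \<in> B. \<forall>x\<in>D. b x = w x} * (fact (card T) / fact (card T - card D)) \<le> r ^ card D * card B"
      unfolding cT i_def using spread[of D w] D(1) by (simp add: T_def)
  qed
  moreover have "(\<Sum>x\<in>AltS T. h x) = card (AltS T)"
  proof -
    have "(\<Sum>x\<in>AltS T. h x) = (\<Sum>x\<in>AltS T. f x)" unfolding h_def
      using B by (intro sum_walk fT) (auto simp: T_def)
    also have "\<dots> = (\<Sum>x\<in>B. card (AltS T) / card B)" unfolding f_def
      using B(1) finite_AltS[OF fT] by (subst sum.mono_neutral_right[of "AltS T" B]) (auto simp: T_def)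
    finally show ?thesis using cB by simp
  qed
  moreover have "finite (AltS T)" by (rule finite_AltS[OF fT])
  moreover have "AltS T \<noteq> {}" using id_AltS by blast
  ultimately have half: "card (AltS T) < 2 * card {x \<in> AltS T. h x \<noteq> 0}"
    by (intro support_gt_half)
  \<comment> \<open>The walk yields 2 M factors b^(-1) b', each of them a word of length 2 because A
    is closed under inverses.\<close>
  have supp: "\<sigma> \<in> words A (4 * M)" if "h \<sigma> \<noteq> 0" for \<sigma>
  proof -
    let ?Q = "(\<lambda>(b, b'). inv' b \<circ> b') ` (B \<times> B)"
    have "\<sigma> \<in> words ?Q (Suc (2 * M - 1))"
      using that unfolding h_def by (intro walk_support[OF B(1)]) (auto simp: f_def split: if_splits)
    moreover have "?Q \<subseteq> words A 2"
    proof clarify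
      fix b b' assume "b \<in> B" "b' \<in> B"
      from BA[OF this] obtain a a' where a: "a \<in> A" "a' \<in> A" "inv' b \<circ> b' = inv' a \<circ> a'" by blast
      have "inv' a \<circ> (a' \<circ> id) \<in> words A (Suc (Suc 0))" by (intro words_Suc words_0 inv a)
      then show "inv' b \<circ> b' \<in> words A 2" by (simp add: a(3) numeral_2_eq_2)
    qed
    ultimately have "\<sigma> \<in> words A (Suc (2 * M - 1) * 2)" by (intro words_words[of ?Q])
    moreover have "Suc (2 * M - 1) * 2 = 4 * M" using M by simp
    ultimately show ?thesis by simp
  qed
  show thesis
  proof (rule that[OF I(1)])
    show "AltS (S - I) \<subseteq> words A (8 * M)"
    proof
      fix g assume "g \<in> AltS (S - I)"
      then have "\<exists>x\<in>{x \<in> AltS T. h x \<noteq> 0}. \<exists>y\<in>{x \<in> AltS T. h x \<noteq> 0}. g = x \<circ> y"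
        unfolding T_def[symmetric] by (intro AltS_half_product[OF fT _ half]) auto
      then obtain x y where "h x \<noteq> 0" "h y \<noteq> 0" "g = x \<circ> y" by blast
      then have "g \<in> words A (4 * M + 4 * M)" using words_add[OF supp supp] by blast
      then show "g \<in> words A (8 * M)" by simp
    qed
    have "fact ?n / fact (?n - i) \<le> real ?n ^ i"
      using I(2) by (intro fact_ratio_le_power) (simp add: i_def)
    also have "\<dots> = (r ^ i) ^ (5 * M)" unfolding r(3)[symmetric] by (simp add: mult.commute flip: power_mult)
    finally have F: "fact ?n / fact (?n - i) \<le> (r ^ i) ^ (5 * M)" .
    have "(card A / card (AltS S)) ^ (5 * M) * (fact ?n / fact (?n - i))
        \<le> (card A / card (AltS S)) ^ (5 * M) * (r ^ i) ^ (5 * M)"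
      by (intro mult_left_mono F) simp
    also have "\<dots> = (card A * r ^ i / card (AltS S)) ^ (5 * M)" by (simp flip: power_mult_distrib)
    also have "\<dots> \<le> 1" using ri r1 cAS by (intro power_le_one) auto
    finally have "(card A / card (AltS S)) ^ (5 * M) \<le> 1 / (fact ?n / fact (?n - i))"
      by (subst pos_le_divide_eq) auto
    also have "\<dots> = card (AltS (S - I)) / card (AltS S)"
      unfolding ratio using cAT by (simp add: T_def)
    finally show "(card A / card (AltS S)) ^ (5 * M) \<le> card (AltS (S - I)) / card (AltS S)" .
  qed
qed

theorem theorem1p3:
  shows "\<exists>c::real. c > 0 \<and>
    (\<forall>(n::nat) (M::nat) (A::(nat \<Rightarrow> nat) set).
       n \<ge> 1 \<longrightarrow> M \<ge> 1 \<longrightarrow> real M < ln (real n) \<longrightarrow>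
       A \<subseteq> carrier (alt_group n) \<longrightarrow>
       A = set_inv\<^bsub>alt_group n\<^esub> A \<longrightarrow>
       alt_density n A \<ge> exp (- c * real n powr (1 - 1 / real M)) \<longrightarrow>
       (\<exists>I \<subseteq> {1..n}.
          pointwise_stab n I \<subseteq> set_pow (alt_group n) A (8 * M) \<and>
          alt_density n (pointwise_stab n I) \<ge> alt_density n A ^ (5 * M)))"
proof (intro exI[of _ "1 / 10 ^ 9"] conjI allI impI)
  fix n M :: nat and A :: "(nat \<Rightarrow> nat) set"
  assume n: "n \<ge> 1" and M: "M \<ge> 1" "real M < ln (real n)"
    and A: "A \<subseteq> carrier (alt_group n)" "A = set_inv\<^bsub>alt_group n\<^esub> A"
    and dens: "alt_density n A \<ge> exp (- (1 / 10 ^ 9) * real n powr (1 - 1 / real M))"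
  let ?S = "{1..n}"
  have S: "finite ?S" by simp
  have carrier: "carrier (alt_group n) = AltS ?S"
    by (auto simp: AltS_def alt_group_carrier)
  have density: "alt_density n X = card X / card (AltS ?S)" for X
    by (simp add: alt_density_def order_def carrier)
  have stab: "pointwise_stab n I = AltS (?S - I)" if "I \<subseteq> ?S" for I
    using AltS_fixing[OF that] by (simp add: pointwise_stab_def carrier)
  have pow: "set_pow (alt_group n) A k = words A k" for k
    by (simp add: set_pow_def words_def alt_group_mult alt_group_one)
  have inv: "inv' a \<in> A" if "a \<in> A" for a
  proof -
    have "inv\<^bsub>alt_group n\<^esub> a \<in> set_inv\<^bsub>alt_group n\<^esub> A" using that by (auto simp: SET_INV_def)
    then show ?thesis using A that alt_group_inv_equality by auto
  qed
  have AS: "A \<subseteq> AltS ?S" using A(1) by (simp add: carrier)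
  have cG: "real (card (AltS ?S)) > 0" using card_AltS_pos[OF S] by simp
  have "card A \<le> card (AltS ?S)" using AS finite_AltS[OF S] by (rule card_mono[rotated])
  then have dens1: "card A / card (AltS ?S) \<le> 1" using cG by simp
  show "\<exists>I\<subseteq>?S. pointwise_stab n I \<subseteq> set_pow (alt_group n) A (8 * M) \<and>
    alt_density n (pointwise_stab n I) \<ge> alt_density n A ^ (5 * M)"
  proof (cases "2 * card A > card (AltS ?S)")
    case True
    have "AltS ?S \<subseteq> words A (8 * M)" using M(1) by (intro large_set_words[OF S AS True]) simp
    moreover have "(card A / card (AltS ?S)) ^ (5 * M) \<le> 1" using dens1 by (intro power_le_one) auto
    ultimately show ?thesis using cG
      by (intro exI[of _ "{}"]) (simp add: stab pow density)
  next
    case False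
    define X where "X = real n powr (1 - 1 / real M)"
    \<comment> \<open>The factor 2 ensures s \<ge> 1 once the density is at most 1/2, through 1 - s
      / 2 \<le> e^(-s/2) \<le> 1/2.\<close>
    define s where "s = 2 / 10 ^ 9 * X"
    define r where "r = real n powr (1 / (5 * real M))"
    have "exp (- (s / 2)) \<le> card A / card (AltS ?S)"
      using dens by (simp add: density s_def X_def)
    then have le: "exp (- (s / 2)) * card (AltS ?S) \<le> card A" using cG by (simp add: pos_le_divide_eq)
    have "exp (- (s / 2)) \<le> 1 / 2"
    proof -
      have "2 * real (card A) \<le> real (card (AltS ?S))" using False by linarith
      then have "exp (- (s / 2)) * card (AltS ?S) \<le> 1 / 2 * card (AltS ?S)" using le by linarith
      then show ?thesis using cG by (simp only: mult_le_cancel_right_pos)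
    qed
    then have s1: "1 \<le> s" using exp_ge_add_one_self[of "- (s / 2)"] by linarith
    have rpow: "r ^ k = real n powr (real k / (5 * real M))" for k
      using n by (simp add: r_def powr_power)
    have r5: "r ^ 5 = real n powr (1 / real M)" unfolding rpow by simp
    \<comment> \<open>r^5 = n^(1/M) is exactly what X lacks to be n, so s r^5 = 2 n / 10^9; this
      meets the bound n / 10^8 and accounts for the size of c.\<close>
    have "X * r ^ 5 = n" unfolding r5 X_def using n by (simp flip: powr_add)
    then have sr: "s * r ^ 5 \<le> card ?S / 10 ^ 8" by (simp add: s_def)
    have "exp 1 \<le> r ^ 5"
    proof -
      have "1 \<le> ln (real n) / M" using M by (simp add: le_divide_eq)
      then show ?thesis unfolding r5 using n by (simp add: powr_def)
    qed
    moreover have "0 \<le> r" by (simp add: r_def)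
    moreover have "r ^ (5 * M) = card ?S" unfolding rpow using M(1) n by simp
    moreover have "A \<noteq> {}"
    proof
      assume "A = {}"
      then show False using le cG by (simp add: mult_le_0_iff)
    qed
    moreover have "card (AltS ?S) \<le> exp (s / 2) * card A"
      using le by (simp add: exp_minus field_simps)
    ultimately obtain I where "I \<subseteq> ?S" "AltS (?S - I) \<subseteq> words A (8 * M)"
      "(card A / card (AltS ?S)) ^ (5 * M) \<le> card (AltS (?S - I)) / card (AltS ?S)"
      using stabilizer_in_words[OF S AS _ inv _ s1 sr _ _ _ M(1)] by metis
    then show ?thesis by (intro exI[of _ I]) (simp add: stab pow density)
  qed
qed simp

end
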